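(* Let $p\in[2,\infty)$. For each $n\in\mathbb{N}$ let $X^{(n,p)}$ be uniformly distributed on the unit $\ell^p$ ball $\mathbb{B}_{n,p}$ of $\mathbb{R}^n$, let $\Theta^{(n)}$ be independent of $X^{(n,p)}$ and distributed according to the rotationally invariant probability measure on the unit sphere $\mathbb{S}^{n-1}\subset\mathbb{R}^n$, and set $$W^{(n,p)} := \frac{n^{1/p}}{n^{1/2}}\sum_{i=1}^n X^{(n,p)}_i\,\Theta^{(n)}_i .$$ Then the sequence $(W^{(n,p)})_{n\in\mathbb{N}}$ satisfies a large deviation principle (with speed $n$) with the quasiconvex, symmetric, good rate function $\mathbb{I}^{\mathsf{an}}_p$ defined by $$\mathbb{I}^{\mathsf{an}}_p(w) := \inf\left\{\Phi_p^*(\tau_0,\tau_1,\tau_2)\;:\;\tau_0>0,\ \tau_1\in\mathbb{R},\ \tau_2>0,\ \tau_0^{-1/2}\tau_1\tau_2^{-1/p}=w\right\},\quad w\in\mathbb{R},$$ where $\Phi_p(t_0,t_1,t_2):=\log\int_{\mathbb{R}}\int_{\mathbb{R}} e^{t_0z^2+t_1zy+t_2|y|^p}\,\mu_2(dz)\,\mu_p(dy)$ for $t_0,t_1,t_2\in\mathbb{R}$, and $\Phi_p^*$ is its Legendre transform.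
   Context: $\mathbb{B}_{n,p}=\{x\in\mathbb{R}^n:\sum_{i=1}^n|x_i|^p\le 1\}$. For $p\in[1,\infty)$, $\mu_p$ is the probability measure on $\mathbb{R}$ with density $f_p(y)=\frac{1}{2p^{1/p}\Gamma(1+1/p)}e^{-|y|^p/p}$ (so $\mu_2$ is standard Gaussian). Legendre transform: for $\Lambda:\mathbb{R}^d\to(-\infty,+\infty]$, $\Lambda^*(\tau)=\sup_{t\in\mathbb{R}^d}\{\langle t,\tau\rangle-\Lambda(t)\}$. Large deviation principle (LDP): a sequence $(\xi_n)$ of random variables in a topological space $\Sigma$ satisfies an LDP with speed $s(n)$ and rate function $I:\Sigma\to[0,\infty]$ if $I$ is lower semi-continuous and for all Borel $\Gamma\subset\Sigma$, $-\inf_{\Gamma^\circ}I\le\liminf_n\frac{1}{s(n)}\log\mathbb{P}(\xi_n\in\Gamma^\circ)\le\limsup_n\frac1{s(n)}\log\mathbb{P}(\xi_n\in\bar\Gamma)\le-\inf_{\bar\Gamma}I$. $I$ is good if its level sets $\{I\le c\}$ are compact. A function $f:\mathbb{R}\to(-\infty,\infty]$ is quasiconvex if $\{f\le c\}$ is convex for all $c\in\mathbb{R}$, and symmetric if $f(-w)=f(w)$. *)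

theory Defs
  imports "HOL-Probability.Probability"
begin

section \<open>Large deviation principles\<close>

text \<open>
  The logarithm on \<open>[0, \<infinity>]\<close> with values in \<open>[-\<infinity>, \<infinity>]\<close>. The library's \<^const>\<open>ln\<close> cannot be used
  directly, because \<open>ln 0 = 0\<close> on the reals.
\<close>

definition elog :: "ennreal \<Rightarrow> ereal" where
  "elog x = (if x = 0 then -\<infinity> else if x = \<infinity> then \<infinity> else ereal (ln (enn2real x)))"

definition lower_semicontinuous :: "('a::topological_space \<Rightarrow> ereal) \<Rightarrow> bool" where
  "lower_semicontinuous f \<longleftrightarrow> (\<forall>x. \<forall>a < f x. eventually (\<lambda>y. a < f y) (nhds x))"

text \<open>
  The \<open>n\<close>-th variable \<open>\<xi> n\<close> lives on its own probability space \<open>M n\<close>. Sequences are indexed by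
  the positive integers, so nothing is required at \<open>n = 0\<close>.
\<close>

definition satisfies_LDP ::
  "(nat \<Rightarrow> 'w measure) \<Rightarrow> (nat \<Rightarrow> 'w \<Rightarrow> 'a::topological_space) \<Rightarrow> (nat \<Rightarrow> real) \<Rightarrow> ('a \<Rightarrow> ereal) \<Rightarrow> bool"
where
  "satisfies_LDP M \<xi> s I \<longleftrightarrow>
     (\<forall>n\<ge>1. prob_space (M n) \<and> \<xi> n \<in> borel_measurable (M n)) \<and>
     (\<forall>x. 0 \<le> I x) \<and> lower_semicontinuous I \<and>
     (\<forall>\<Gamma> \<in> sets borel.
        - (INF x \<in> interior \<Gamma>. I x)
          \<le> liminf (\<lambda>n. ereal (1 / s n) * elog (emeasure (M n) {\<omega> \<in> space (M n). \<xi> n \<omega> \<in> interior \<Gamma>})) \<and>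
        liminf (\<lambda>n. ereal (1 / s n) * elog (emeasure (M n) {\<omega> \<in> space (M n). \<xi> n \<omega> \<in> interior \<Gamma>}))
          \<le> limsup (\<lambda>n. ereal (1 / s n) * elog (emeasure (M n) {\<omega> \<in> space (M n). \<xi> n \<omega> \<in> closure \<Gamma>})) \<and>
        limsup (\<lambda>n. ereal (1 / s n) * elog (emeasure (M n) {\<omega> \<in> space (M n). \<xi> n \<omega> \<in> closure \<Gamma>}))
          \<le> - (INF x \<in> closure \<Gamma>. I x))"

definition good_rate :: "('a::topological_space \<Rightarrow> ereal) \<Rightarrow> bool" where
  "good_rate I \<longleftrightarrow> (\<forall>c::real. compact {x. I x \<le> ereal c})"

definition quasiconvex :: "(real \<Rightarrow> ereal) \<Rightarrow> bool" where
  "quasiconvex f \<longleftrightarrow> (\<forall>c::real. convex {w. f w \<le> ereal c})"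

definition symmetric_fun :: "(real \<Rightarrow> ereal) \<Rightarrow> bool" where
  "symmetric_fun f \<longleftrightarrow> (\<forall>w. f (- w) = f w)"

definition legendre :: "('a::real_inner \<Rightarrow> ereal) \<Rightarrow> 'a \<Rightarrow> ereal" where
  "legendre \<Lambda> \<tau> = (SUP t. ereal (t \<bullet> \<tau>) - \<Lambda> t)"


section \<open>The ball, the sphere and their uniform distributions\<close>

text \<open>
  Since the dimension \<open>n\<close> varies, \<open>\<real>\<^sup>n\<close> is represented by the functions \<open>{1..n} \<rightarrow> \<real>\<close>
  (extended by \<^const>\<open>undefined\<close>), with Lebesgue measure as a product measure.
\<close>

definition lborel_Rn :: "nat \<Rightarrow> (nat \<Rightarrow> real) measure" where
  "lborel_Rn n = Pi\<^sub>M {1..n} (\<lambda>_. lborel)"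

definition lp_ball :: "nat \<Rightarrow> real \<Rightarrow> (nat \<Rightarrow> real) set" where
  "lp_ball n p = {x \<in> space (lborel_Rn n). (\<Sum>i=1..n. \<bar>x i\<bar> powr p) \<le> 1}"

definition unit_sphere :: "nat \<Rightarrow> (nat \<Rightarrow> real) set" where
  "unit_sphere n = {x \<in> space (lborel_Rn n). (\<Sum>i=1..n. (x i)\<^sup>2) = 1}"

definition orthogonal_mat :: "nat \<Rightarrow> (nat \<Rightarrow> nat \<Rightarrow> real) \<Rightarrow> bool" where
  "orthogonal_mat n Q \<longleftrightarrow>
     (\<forall>i\<in>{1..n}. \<forall>j\<in>{1..n}. (\<Sum>k=1..n. Q k i * Q k j) = (if i = j then 1 else 0))"

definition mat_apply :: "nat \<Rightarrow> (nat \<Rightarrow> nat \<Rightarrow> real) \<Rightarrow> (nat \<Rightarrow> real) \<Rightarrow> (nat \<Rightarrow> real)" where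
  "mat_apply n Q x = (\<lambda>i\<in>{1..n}. \<Sum>j=1..n. Q i j * x j)"

text \<open>
  For \<open>n \<ge> 1\<close> there is exactly one measure with this property. Invariance is under all of \<open>O(n)\<close>;
  for \<open>n \<ge> 2\<close> this is the same as under \<open>SO(n)\<close>, and for \<open>n = 1\<close>, where \<open>SO(1)\<close> is trivial, it is
  what gives both points of the sphere equal mass.
\<close>

definition sphere_uniform :: "nat \<Rightarrow> (nat \<Rightarrow> real) measure \<Rightarrow> bool" where
  "sphere_uniform n \<nu> \<longleftrightarrow>
     prob_space \<nu> \<and> sets \<nu> = sets (lborel_Rn n) \<and> emeasure \<nu> (unit_sphere n) = 1 \<and>
     (\<forall>Q. orthogonal_mat n Q \<longrightarrow> distr \<nu> (lborel_Rn n) (mat_apply n Q) = \<nu>)"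


section \<open>The annealed rate function\<close>

definition f_density :: "real \<Rightarrow> real \<Rightarrow> real" where
  "f_density p y = 1 / (2 * p powr (1 / p) * Gamma (1 + 1 / p)) * exp (- (\<bar>y\<bar> powr p) / p)"

definition \<mu> :: "real \<Rightarrow> real measure" where
  "\<mu> p = density lborel (\<lambda>y. ennreal (f_density p y))"

definition \<Phi> :: "real \<Rightarrow> real \<times> real \<times> real \<Rightarrow> ereal" where
  "\<Phi> p = (\<lambda>(t0, t1, t2).
     elog (\<integral>\<^sup>+ y. (\<integral>\<^sup>+ z. ennreal (exp (t0 * z\<^sup>2 + t1 * z * y + t2 * \<bar>y\<bar> powr p)) \<partial>\<mu> 2) \<partial>\<mu> p))"

definition I_an :: "real \<Rightarrow> real \<Rightarrow> ereal" where
  "I_an p w = Inf {legendre (\<Phi> p) (\<tau>0, \<tau>1, \<tau>2) | \<tau>0 \<tau>1 \<tau>2.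
     \<tau>0 > 0 \<and> \<tau>2 > 0 \<and> \<tau>0 powr (- 1 / 2) * \<tau>1 * \<tau>2 powr (- 1 / p) = w}"

end

theory Submission
  imports Defs
begin

text \<open>
  By rotation invariance \<open>W\<close> has, given \<open>X\<close>, the law of \<open>n\<^bsup>1/p - 1/2\<^esup> \<bar>X\<bar>\<close> times one coordinate of \<open>\<Theta>\<close>. Its tail is bounded
  by comparing \<open>\<Theta>\<close> with a Gaussian vector of a prescribed norm, and the uniform law on the ball with the product density
  \<open>exp (a y\<^sup>2 - b \<bar>y\<bar>\<^bsup>p\<^esup>)\<close>; the exponential bounds that come out are exactly \<open>\<langle>t, (1, w, 1)\<rangle> - \<Phi>(t)\<close>. Scaling the
  two integration variables shows that the infimum that defines the rate function is attained at \<open>\<tau>\<^sub>0 = \<tau>\<^sub>2 = 1\<close>, so that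
  \<open>I(w) = \<Phi>\<^sup>*(1, w, 1)\<close>, which is convex, lower semicontinuous and infinite for \<open>\<bar>w\<bar> > 1\<close>. For the lower bound, \<open>(1, w, 1)\<close>
  with \<open>\<bar>w\<bar> < 1\<close> is the mean of an exponentially tilted measure, found by the intermediate value theorem.
\<close>

section \<open>Gaussian integrals and product densities\<close>

text \<open>The plan is one-dimensional: a closed set lies in two half-lines and an open set
  contains an interval, so tails and short intervals are all that has to be estimated. The upper
  bound has three free parameters: A, the squared norm per coordinate of the auxiliary Gaussian
  vector; \<kappa>, the slope of a linear Chernoff bound, which together with A fixes
  \<open>a = \<kappa>\<^sup>2 / (2 * A)\<close>; and b. For \<open>A = 1 - 2 * t0\<close>,
  \<open>\<kappa> = t1\<close> and \<open>b = 1/p - t2\<close> the exponents add up to a dual value.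
  The lower bound factors W into a norm of X and a cosine. Each factor is forced by a change of
  measure, and the total cost is recognised as the dual value at one explicit t. The sphere
  estimates are uniform in the vector y because they are integrated over the ball afterwards. The
  case p = 2 is borderline throughout: y^2 and |y|^p then have the same degree, finiteness requires
  a < b, and the Laplace concentration that serves p > 2 for large a gives way to an explicit
  formula.\<close>

definition sq_norm :: "nat \<Rightarrow> (nat \<Rightarrow> real) \<Rightarrow> real" where
  "sq_norm n x = (\<Sum>i=1..n. (x i)\<^sup>2)"

definition dot :: "nat \<Rightarrow> (nat \<Rightarrow> real) \<Rightarrow> (nat \<Rightarrow> real) \<Rightarrow> real" where
  "dot n x y = (\<Sum>i=1..n. x i * y i)"

lemma sq_norm_nonneg [simp]: "0 \<le> sq_norm n x"
  by (simp add: sq_norm_def sum_nonneg)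

lemma coord_measurable:
  "i \<in> {1..n} \<Longrightarrow> (\<lambda>x. x i) \<in> borel_measurable (lborel_Rn n)"
  unfolding lborel_Rn_def by (rule measurable_component_singleton[of _ _ "\<lambda>_. lborel", simplified]) simp

lemma sum_coord_measurable:
  fixes F :: "nat \<Rightarrow> real \<Rightarrow> real"
  assumes "\<And>i. F i \<in> borel_measurable borel"
  shows "(\<lambda>x. \<Sum>i=1..n. F i (x i)) \<in> borel_measurable (lborel_Rn n)"
  by (intro borel_measurable_sum measurable_compose[OF coord_measurable assms])

lemma sq_norm_measurable [measurable]: "sq_norm n \<in> borel_measurable (lborel_Rn n)"
  unfolding sq_norm_def[abs_def] by (rule sum_coord_measurable) measurable

lemma dot_measurable [measurable]: "dot n y \<in> borel_measurable (lborel_Rn n)"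
  unfolding dot_def[abs_def] by (rule sum_coord_measurable) measurable

lemma dot_measurable_pair [measurable]:
  "(\<lambda>(x, y). dot n x y) \<in> borel_measurable (lborel_Rn n \<Otimes>\<^sub>M lborel_Rn n)"
proof -
  have "(\<lambda>z. fst z i * snd z i) \<in> borel_measurable (lborel_Rn n \<Otimes>\<^sub>M lborel_Rn n)" if "i \<in> {1..n}" for i
    by (intro borel_measurable_times measurable_compose[OF measurable_fst coord_measurable]
        measurable_compose[OF measurable_snd coord_measurable] that)
  then show ?thesis
    unfolding dot_def[abs_def] split_beta by (intro borel_measurable_sum)
qed

text \<open>All n-dimensional weights are written as exp of a sum over coordinates, so this one
  factorisation covers the Gaussian and the tilted densities.\<close>

lemma nn_integral_exp_sum:
  fixes F :: "nat \<Rightarrow> real \<Rightarrow> real"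
  assumes "\<And>i. F i \<in> borel_measurable borel"
  shows "(\<integral>\<^sup>+x. ennreal (exp (\<Sum>i=1..n. F i (x i))) \<partial>lborel_Rn n)
       = (\<Prod>i=1..n. \<integral>\<^sup>+y. ennreal (exp (F i y)) \<partial>lborel)"
proof -
  interpret product_sigma_finite "\<lambda>_::nat. lborel::real measure" ..
  have "(\<integral>\<^sup>+x. (\<Prod>i=1..n. ennreal (exp (F i (x i)))) \<partial>Pi\<^sub>M {1..n} (\<lambda>_. lborel))
       = (\<Prod>i=1..n. \<integral>\<^sup>+y. ennreal (exp (F i y)) \<partial>lborel)"
    using assms by (intro product_nn_integral_prod) auto
  then show ?thesis
    by (simp add: lborel_Rn_def exp_sum prod_ennreal)
qed

lemma nn_integral_gauss:
  fixes a b :: real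
  assumes "0 < a"
  shows "(\<integral>\<^sup>+z. ennreal (exp (b * z - a * z\<^sup>2)) \<partial>lborel) = ennreal (sqrt (pi / a) * exp (b\<^sup>2 / (4 * a)))"
proof -
  define s where "s = sqrt (1 / (2 * a))"
  have s: "0 < s" "s\<^sup>2 = 1 / (2 * a)" using assms by (auto simp: s_def)
  have eq: "exp (b * z - a * z\<^sup>2) = sqrt (pi / a) * exp (b\<^sup>2 / (4 * a)) * normal_density (b / (2 * a)) s z" for z
  proof -
    have "b * z - a * z\<^sup>2 = b\<^sup>2 / (4 * a) + (-(z - b / (2 * a))\<^sup>2 / (2 * s\<^sup>2))"
      using assms unfolding s(2) by (simp add: field_simps power2_eq_square)
    moreover have "sqrt (2 * pi * s\<^sup>2) = sqrt (pi / a)" by (simp add: s(2))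
    ultimately show ?thesis
      using assms by (simp add: normal_density_def flip: exp_add)
  qed
  have "(\<integral>\<^sup>+z. ennreal (normal_density (b / (2 * a)) s z) \<partial>lborel) = 1"
    using s by (simp add: nn_integral_eq_integral)
  then show ?thesis
    unfolding eq using assms by (subst ennreal_mult) (simp_all add: nn_integral_cmult)
qed

lemma nn_integral_gauss_n:
  fixes a b :: real
  assumes "0 < a"
  shows "(\<integral>\<^sup>+g. ennreal (exp (b * dot n \<theta> g - a * sq_norm n g)) \<partial>lborel_Rn n)
       = ennreal (sqrt (pi / a) ^ n * exp (b\<^sup>2 * sq_norm n \<theta> / (4 * a)))"
proof -
  have "(\<integral>\<^sup>+g. ennreal (exp (b * dot n \<theta> g - a * sq_norm n g)) \<partial>lborel_Rn n)
    = (\<integral>\<^sup>+g. ennreal (exp (\<Sum>i=1..n. (b * \<theta> i) * g i - a * (g i)\<^sup>2)) \<partial>lborel_Rn n)"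
    by (simp add: dot_def sq_norm_def sum_subtractf sum_distrib_left mult.assoc)
  also have "\<dots> = (\<Prod>i=1..n. \<integral>\<^sup>+y. ennreal (exp ((b * \<theta> i) * y - a * y\<^sup>2)) \<partial>lborel)"
    by (rule nn_integral_exp_sum) measurable
  also have "\<dots> = (\<Prod>i=1..n. ennreal (sqrt (pi / a) * exp ((b * \<theta> i)\<^sup>2 / (4 * a))))"
    using assms by (simp add: nn_integral_gauss)
  also have "\<dots> = ennreal (\<Prod>i=1..n. sqrt (pi / a) * exp ((b * \<theta> i)\<^sup>2 / (4 * a)))"
    using assms by (intro prod_ennreal) auto
  also have "(\<Prod>i=1..n. sqrt (pi / a) * exp ((b * \<theta> i)\<^sup>2 / (4 * a)))
     = sqrt (pi / a) ^ n * exp (\<Sum>i=1..n. (b * \<theta> i)\<^sup>2 / (4 * a))"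
    by (simp add: prod.distrib exp_sum)
  also have "(\<Sum>i=1..n. (b * \<theta> i)\<^sup>2 / (4 * a)) = b\<^sup>2 * sq_norm n \<theta> / (4 * a)"
    by (simp add: sq_norm_def sum_distrib_left sum_divide_distrib power_mult_distrib)
  finally show ?thesis .
qed

section \<open>Exponential tail bounds\<close>

lemma emeasure_le_exp:
  assumes [measurable]: "h \<in> borel_measurable M"
  shows "emeasure M {x \<in> space M. c \<le> h x} \<le> (\<integral>\<^sup>+x. ennreal (exp (h x - c)) \<partial>M)"
proof -
  have "emeasure M {x \<in> space M. c \<le> h x} = (\<integral>\<^sup>+x. indicator {x \<in> space M. c \<le> h x} x \<partial>M)"
    by simp
  also have "\<dots> \<le> (\<integral>\<^sup>+x. ennreal (exp (h x - c)) \<partial>M)"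
    by (intro nn_integral_mono) (auto simp: indicator_def)
  finally show ?thesis .
qed

text \<open>Chernoff bounds are one-sided, so a two-sided band for two statistics has four tails;
  1/8 each leaves mass 1/2. A fixed positive mass disappears at the exponential scale.\<close>

lemma (in prob_space) prob_band_ge:
  fixes f g :: "'a \<Rightarrow> real"
  assumes [measurable]: "f \<in> borel_measurable M" "g \<in> borel_measurable M"
    and "emeasure M {x \<in> space M. c + d \<le> f x} \<le> ennreal (1/8)"
    and "emeasure M {x \<in> space M. - c + d \<le> - f x} \<le> ennreal (1/8)"
    and "emeasure M {x \<in> space M. c' + d \<le> g x} \<le> ennreal (1/8)"
    and "emeasure M {x \<in> space M. - c' + d \<le> - g x} \<le> ennreal (1/8)"
  shows "ennreal (1/2) \<le> emeasure M {x \<in> space M. \<bar>f x - c\<bar> < d \<and> \<bar>g x - c'\<bar> < d}"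
proof -
  let ?A = "{x \<in> space M. c + d \<le> f x}" and ?B = "{x \<in> space M. - c + d \<le> - f x}"
  let ?C = "{x \<in> space M. c' + d \<le> g x}" and ?D = "{x \<in> space M. - c' + d \<le> - g x}"
  let ?E = "{x \<in> space M. \<bar>f x - c\<bar> < d \<and> \<bar>g x - c'\<bar> < d}"
  have le: "prob ?A \<le> 1/8" "prob ?B \<le> 1/8" "prob ?C \<le> 1/8" "prob ?D \<le> 1/8"
    using assms(3-6) by (simp_all add: emeasure_eq_measure)
  have "space M = ?E \<union> (?A \<union> (?B \<union> (?C \<union> ?D)))" by auto
  then have "1 = prob (?E \<union> (?A \<union> (?B \<union> (?C \<union> ?D))))" using prob_space by simp
  also have "\<dots> \<le> prob ?E + prob (?A \<union> (?B \<union> (?C \<union> ?D)))"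
    by (rule measure_Un_le) measurable
  also have "prob (?A \<union> (?B \<union> (?C \<union> ?D))) \<le> prob ?A + prob (?B \<union> (?C \<union> ?D))"
    by (rule measure_Un_le) measurable
  also have "prob (?B \<union> (?C \<union> ?D)) \<le> prob ?B + prob (?C \<union> ?D)"
    by (rule measure_Un_le) measurable
  also have "prob (?C \<union> ?D) \<le> prob ?C + prob ?D"
    by (rule measure_Un_le) measurable
  finally have "1 / 2 \<le> prob ?E" using le by simp
  then show ?thesis by (simp add: emeasure_eq_measure del: ennreal_half)
qed

lemma eventually_exp_mult_le:
  fixes k c :: real
  assumes "k < 0" "0 < c"
  shows "eventually (\<lambda>n. exp (real n * k) \<le> c) sequentially"
proof -
  have "(\<lambda>n. exp k ^ n) \<longlonglongrightarrow> 0"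
    using assms by (intro LIMSEQ_power_zero) auto
  then have "eventually (\<lambda>n. exp k ^ n < c) sequentially"
    using assms by (simp add: order_tendstoD)
  then show ?thesis
    by eventually_elim (simp add: exp_of_nat_mult)
qed


section \<open>The tilted Gaussian measure\<close>

text \<open>For a unit vector \<theta> this is the normal density with mean
  \<open>sqrt n * m\<close> times \<theta> and covariance s^2 times the identity, with the square
  expanded. A shift of order sqrt n changes the squared norm by order n, which is the large
  deviation scale.\<close>

definition gauss_tilt_density :: "nat \<Rightarrow> real \<Rightarrow> real \<Rightarrow> (nat \<Rightarrow> real) \<Rightarrow> (nat \<Rightarrow> real) \<Rightarrow> real" where
  "gauss_tilt_density n m s \<theta> g =
     exp (sqrt n * m / s\<^sup>2 * dot n \<theta> g - sq_norm n g / (2 * s\<^sup>2) - n * m\<^sup>2 / (2 * s\<^sup>2)) / (s * sqrt (2 * pi)) ^ n"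

definition gauss :: "nat \<Rightarrow> (nat \<Rightarrow> real) measure" where
  "gauss n = density (lborel_Rn n) (\<lambda>g. ennreal (exp (- sq_norm n g / 2) / sqrt (2 * pi) ^ n))"

lemma gauss_tilt_density_measurable [measurable]:
  "gauss_tilt_density n m s \<theta> \<in> borel_measurable (lborel_Rn n)"
  unfolding gauss_tilt_density_def[abs_def] by measurable

text \<open>The logarithmic moment generating function per coordinate of
  \<open>\<alpha> * sq_norm n g + \<beta> * sqrt n * dot n \<theta> g\<close> under the tilted law.
  Its partial derivatives at the origin, m^2 + s^2 and m, are the centres of the bands
  below.\<close>

definition gauss_tilt_cgf :: "real \<Rightarrow> real \<Rightarrow> real \<Rightarrow> real \<Rightarrow> real" where
  "gauss_tilt_cgf m s \<alpha> \<beta> = - ln (1 - 2 * \<alpha> * s\<^sup>2) / 2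
     + (m + \<beta> * s\<^sup>2)\<^sup>2 / (2 * s\<^sup>2 * (1 - 2 * \<alpha> * s\<^sup>2)) - m\<^sup>2 / (2 * s\<^sup>2)"

lemma gauss_tilt_mgf:
  assumes s: "0 < s" and \<alpha>: "2 * \<alpha> * s\<^sup>2 < 1" and \<theta>: "sq_norm n \<theta> = 1"
  shows "(\<integral>\<^sup>+g. ennreal (exp (\<alpha> * sq_norm n g + \<beta> * sqrt n * dot n \<theta> g))
            \<partial>density (lborel_Rn n) (\<lambda>g. ennreal (gauss_tilt_density n m s \<theta> g)))
       = ennreal (exp (n * gauss_tilt_cgf m s \<alpha> \<beta>))"
proof -
  define D where "D = 1 - 2 * \<alpha> * s\<^sup>2"
  define a where "a = D / (2 * s\<^sup>2)"
  define b where "b = sqrt n * (m / s\<^sup>2 + \<beta>)"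
  define C where "C = exp (- n * m\<^sup>2 / (2 * s\<^sup>2)) / (s * sqrt (2 * pi)) ^ n"
  have D: "0 < D" using \<alpha> by (simp add: D_def)
  have a: "0 < a" using D s by (simp add: a_def)
  have C: "0 \<le> C" using s by (simp add: C_def)
  have "gauss_tilt_density n m s \<theta> g * exp (\<alpha> * sq_norm n g + \<beta> * sqrt n * dot n \<theta> g)
      = C * exp (b * dot n \<theta> g - a * sq_norm n g)" for g
  proof -
    have "(sqrt n * m / s\<^sup>2 * dot n \<theta> g - sq_norm n g / (2 * s\<^sup>2) - n * m\<^sup>2 / (2 * s\<^sup>2))
        + (\<alpha> * sq_norm n g + \<beta> * sqrt n * dot n \<theta> g)
        = - n * m\<^sup>2 / (2 * s\<^sup>2) + (b * dot n \<theta> g - a * sq_norm n g)"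
      using s by (simp add: a_def b_def D_def field_simps)
    then have "exp (sqrt n * m / s\<^sup>2 * dot n \<theta> g - sq_norm n g / (2 * s\<^sup>2) - n * m\<^sup>2 / (2 * s\<^sup>2))
        * exp (\<alpha> * sq_norm n g + \<beta> * sqrt n * dot n \<theta> g)
        = exp (- n * m\<^sup>2 / (2 * s\<^sup>2)) * exp (b * dot n \<theta> g - a * sq_norm n g)"
      by (simp flip: exp_add)
    then show ?thesis
      by (simp add: gauss_tilt_density_def C_def)
  qed
  then have "(\<integral>\<^sup>+g. ennreal (exp (\<alpha> * sq_norm n g + \<beta> * sqrt n * dot n \<theta> g))
            \<partial>density (lborel_Rn n) (\<lambda>g. ennreal (gauss_tilt_density n m s \<theta> g)))
     = (\<integral>\<^sup>+g. ennreal C * ennreal (exp (b * dot n \<theta> g - a * sq_norm n g)) \<partial>lborel_Rn n)"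
    using C by (subst nn_integral_density) (auto simp flip: ennreal_mult'' intro!: nn_integral_cong)
  also have "\<dots> = ennreal C * ennreal (sqrt (pi / a) ^ n * exp (b\<^sup>2 * sq_norm n \<theta> / (4 * a)))"
    using a by (simp add: nn_integral_cmult nn_integral_gauss_n)
  also have "\<dots> = ennreal (C * (sqrt (pi / a) ^ n * exp (b\<^sup>2 / (4 * a))))"
    using C \<theta> by (simp add: ennreal_mult')
  also have "C * (sqrt (pi / a) ^ n * exp (b\<^sup>2 / (4 * a)))
     = exp (- n * m\<^sup>2 / (2 * s\<^sup>2)) * (sqrt (pi / a) / (s * sqrt (2 * pi))) ^ n * exp (b\<^sup>2 / (4 * a))"
    by (simp add: C_def power_divide)
  also have "sqrt (pi / a) / (s * sqrt (2 * pi)) = exp (- ln D / 2)"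
  proof -
    have "sqrt (pi / a) = sqrt (s\<^sup>2 * (2 * pi) * (1 / D))"
      by (simp add: a_def field_simps)
    also have "\<dots> = s * sqrt (2 * pi) * sqrt (1 / D)"
      unfolding real_sqrt_mult using s by simp
    finally have "sqrt (pi / a) / (s * sqrt (2 * pi)) = sqrt (1 / D)"
      using s by simp
    also have "\<dots> = exp (- ln D / 2)"
      using D by (simp add: real_sqrt_divide ln_sqrt[symmetric] exp_minus field_simps)
    finally show ?thesis .
  qed
  also have "exp (- n * m\<^sup>2 / (2 * s\<^sup>2)) * exp (- ln D / 2) ^ n * exp (b\<^sup>2 / (4 * a))
     = exp (- n * m\<^sup>2 / (2 * s\<^sup>2) + n * (- ln D / 2) + b\<^sup>2 / (4 * a))"
    by (simp only: exp_add exp_of_nat_mult)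
  also have "b\<^sup>2 / (4 * a) = n * ((m + \<beta> * s\<^sup>2)\<^sup>2 / (2 * s\<^sup>2 * D))"
    using s D by (simp add: b_def a_def power_mult_distrib field_simps power2_eq_square)
  also have "- n * m\<^sup>2 / (2 * s\<^sup>2) + n * (- ln D / 2) + n * ((m + \<beta> * s\<^sup>2)\<^sup>2 / (2 * s\<^sup>2 * D))
     = n * gauss_tilt_cgf m s \<alpha> \<beta>"
    by (simp add: gauss_tilt_cgf_def D_def algebra_simps)
  finally show ?thesis .
qed

lemma prob_space_gauss_tilt:
  assumes "0 < s" "sq_norm n \<theta> = 1"
  shows "prob_space (density (lborel_Rn n) (\<lambda>g. ennreal (gauss_tilt_density n m s \<theta> g)))"
proof
  have "(\<integral>\<^sup>+g. 1 \<partial>density (lborel_Rn n) (\<lambda>g. ennreal (gauss_tilt_density n m s \<theta> g))) = 1"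
    using gauss_tilt_mgf[where m = m and \<alpha> = 0 and \<beta> = 0, OF assms(1) _ assms(2)] by (simp add: gauss_tilt_cgf_def)
  then show "emeasure (density (lborel_Rn n) (\<lambda>g. ennreal (gauss_tilt_density n m s \<theta> g)))
     (space (density (lborel_Rn n) (\<lambda>g. ennreal (gauss_tilt_density n m s \<theta> g)))) = 1"
    by simp
qed

lemma prob_space_gauss: "prob_space (gauss n)"
proof
  have *: "(\<integral>\<^sup>+g. ennreal (exp (- sq_norm n g / 2)) \<partial>lborel_Rn n) = ennreal (sqrt (2 * pi) ^ n)"
    using nn_integral_gauss_n[where a = "1/2" and b = 0 and n = n] by (simp add: mult.commute)
  have "ennreal (exp (- sq_norm n g / 2) / sqrt (2 * pi) ^ n)
      = ennreal (exp (- sq_norm n g / 2)) * ennreal (1 / sqrt (2 * pi) ^ n)" for g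
    by (simp flip: ennreal_mult)
  then have "emeasure (gauss n) (space (gauss n)) = (\<integral>\<^sup>+g. ennreal (exp (- sq_norm n g / 2)) * ennreal (1 / sqrt (2 * pi) ^ n) \<partial>lborel_Rn n)"
    unfolding gauss_def by (subst emeasure_density) (auto intro!: nn_integral_cong)
  also have "\<dots> = ennreal (sqrt (2 * pi) ^ n) * ennreal (1 / sqrt (2 * pi) ^ n)"
    by (simp add: nn_integral_multc *[simplified])
  finally show "emeasure (gauss n) (space (gauss n)) = 1"
    by (simp flip: ennreal_mult)
qed

text \<open>L stands for a logarithmic moment generating function and c for the mean. L stays close
  to its tangent at 0, so both Chernoff exponents, at \<eta> and at -\<eta>, are negative for small
  \<eta>; the bound e keeps \<eta> where L is the finite moment function.\<close>

lemma derivative_two_sided: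
  fixes L :: "real \<Rightarrow> real"
  assumes L: "(L has_real_derivative c) (at 0)" "L 0 = 0" and d: "0 < d" and e: "0 < e"
  shows "\<exists>\<eta>>0. \<eta> < e \<and> L \<eta> - \<eta> * (c + d) < 0 \<and> L (- \<eta>) - \<eta> * (- c + d) < 0"
proof -
  have "((\<lambda>h. L h / h) \<longlongrightarrow> c) (at 0)"
    using L by (simp add: DERIV_def)
  then have "eventually (\<lambda>h. dist (L h / h) c < d) (at 0)"
    using d by (rule tendstoD)
  then obtain r where r: "0 < r" "\<And>h. h \<noteq> 0 \<Longrightarrow> dist h 0 < r \<Longrightarrow> dist (L h / h) c < d"
    unfolding eventually_at by auto
  define \<eta> where "\<eta> = min r e / 2"
  have \<eta>: "0 < \<eta>" "\<eta> < r" "\<eta> < e" using r e by (auto simp: \<eta>_def)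
  have "\<bar>L \<eta> / \<eta> - c\<bar> < d" "\<bar>L (- \<eta>) / (- \<eta>) - c\<bar> < d"
    using r(2)[of \<eta>] r(2)[of "- \<eta>"] \<eta> by (auto simp: dist_real_def)
  then have "L \<eta> / \<eta> < c + d" "L (- \<eta>) / \<eta> < - c + d" by auto
  then have "L \<eta> < \<eta> * (c + d)" "L (- \<eta>) < \<eta> * (- c + d)"
    using \<eta> by (simp_all add: pos_divide_less_eq mult.commute)
  then show ?thesis using \<eta> by (intro exI[of _ \<eta>]) auto
qed

text \<open>Change of measure: under the tilted law the band has mass at least 1/2, and on the band
  the standard Gaussian density divided by the tilted one is at least exp of -n times the relative
  entropy per coordinate, up to an error linear in d. The threshold for n does not depend on
  \<theta>, since the estimate is later integrated over the sphere.\<close>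

lemma gauss_band_lower:
  assumes s: "0 < s" and d: "0 < d"
  shows "eventually (\<lambda>n. \<forall>\<theta>. sq_norm n \<theta> = 1 \<longrightarrow>
    ennreal (1/2 * exp (n * (ln s - (m\<^sup>2 + s\<^sup>2) / 2 + 1/2 - d * (1/2 + (1 + 2 * \<bar>m\<bar>) / (2 * s\<^sup>2)))))
    \<le> emeasure (gauss n) {g \<in> space (gauss n).
        \<bar>sq_norm n g / n - (m\<^sup>2 + s\<^sup>2)\<bar> < d \<and> \<bar>dot n \<theta> g / sqrt n - m\<bar> < d}) sequentially"
proof -
  define L where "L = (\<lambda>\<alpha>. gauss_tilt_cgf m s \<alpha> 0)"
  have L0: "L 0 = 0" by (simp add: L_def gauss_tilt_cgf_def)
  have dL: "(L has_real_derivative (m\<^sup>2 + s\<^sup>2)) (at 0)"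
    unfolding L_def gauss_tilt_cgf_def using s
    by (auto intro!: derivative_eq_intros simp: field_simps power2_eq_square)
  obtain \<eta> where \<eta>: "0 < \<eta>" "\<eta> < 1 / (2 * s\<^sup>2)" "L \<eta> - \<eta> * (m\<^sup>2 + s\<^sup>2 + d) < 0"
      "L (- \<eta>) - \<eta> * (- (m\<^sup>2 + s\<^sup>2) + d) < 0"
    using derivative_two_sided[OF dL L0 d, of "1 / (2 * s\<^sup>2)"] s by auto
  \<comment> \<open>Minimiser of \<open>s\<^sup>2 * \<kappa>\<^sup>2 / 2 - \<kappa> * d\<close>: the
    moment function of a linear functional is exactly quadratic, so the optimal Chernoff parameter
    is explicit.\<close>
  define \<kappa> where "\<kappa> = d / s\<^sup>2"
  have \<kappa>: "0 < \<kappa>" using s d by (simp add: \<kappa>_def)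
  define L' where "L' = (\<lambda>\<beta>. gauss_tilt_cgf m s 0 \<beta>)"
  have L': "L' \<beta> = m * \<beta> + s\<^sup>2 * \<beta>\<^sup>2 / 2" for \<beta>
    using s by (simp add: L'_def gauss_tilt_cgf_def field_simps power2_eq_square)
  have L'p: "L' \<kappa> - \<kappa> * (m + d) < 0" "L' (- \<kappa>) - \<kappa> * (- m + d) < 0"
    using s d by (simp_all add: L' \<kappa>_def field_simps power2_eq_square)
  have ev: "eventually (\<lambda>n. n \<ge> 1 \<and> exp (real n * (L \<eta> - \<eta> * (m\<^sup>2 + s\<^sup>2 + d))) \<le> 1/8 \<and>
      exp (real n * (L (- \<eta>) - \<eta> * (- (m\<^sup>2 + s\<^sup>2) + d))) \<le> 1/8 \<and>
      exp (real n * (L' \<kappa> - \<kappa> * (m + d))) \<le> 1/8 \<and>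
      exp (real n * (L' (- \<kappa>) - \<kappa> * (- m + d))) \<le> 1/8) sequentially"
    by (intro eventually_conj eventually_ge_at_top eventually_exp_mult_le \<eta> L'p) auto
  show ?thesis
    using ev
  proof eventually_elim
    case (elim n)
    show ?case
    proof (intro allI impI)
      fix \<theta> assume \<theta>: "sq_norm n \<theta> = 1"
      define Q where "Q = density (lborel_Rn n) (\<lambda>g. ennreal (gauss_tilt_density n m s \<theta> g))"
      interpret Q: prob_space Q
        unfolding Q_def by (rule prob_space_gauss_tilt[OF s \<theta>])
      have [measurable_cong]: "sets Q = sets (lborel_Rn n)" by (simp add: Q_def)
      have n: "1 \<le> real n" using elim by simp
      \<comment> \<open>One template for four tails: f is one of the two statistics or its negative,
        r is the positive Chernoff parameter, and one of \<alpha>, \<beta> is r or -r while the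
        other is 0.\<close>
      have bnd: "emeasure Q {g \<in> space Q. c \<le> f g} \<le> ennreal (1/8)"
        if "f \<in> borel_measurable Q" "0 < r" "2 * \<alpha> * s\<^sup>2 < 1"
          and eq: "\<And>g. n * r * f g = \<alpha> * sq_norm n g + \<beta> * sqrt n * dot n \<theta> g"
          and le: "exp (n * (gauss_tilt_cgf m s \<alpha> \<beta> - r * c)) \<le> 1/8" for f :: "(nat \<Rightarrow> real) \<Rightarrow> real" and r c \<alpha> \<beta> :: real
      proof -
        have [measurable]: "f \<in> borel_measurable Q" by fact
        have "{g \<in> space Q. c \<le> f g} = {g \<in> space Q. n * r * c \<le> n * r * f g}"
          using n \<open>0 < r\<close> by simp
        then have "emeasure Q {g \<in> space Q. c \<le> f g} \<le> (\<integral>\<^sup>+g. ennreal (exp (n * r * f g - n * r * c)) \<partial>Q)"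
          using emeasure_le_exp[of "\<lambda>g. n * r * f g" Q "n * r * c"] by simp
        also have "\<dots> = (\<integral>\<^sup>+g. ennreal (exp (\<alpha> * sq_norm n g + \<beta> * sqrt n * dot n \<theta> g)) * ennreal (exp (- n * r * c)) \<partial>Q)"
          unfolding eq by (simp add: exp_add[symmetric] ennreal_mult[symmetric])
        also have "\<dots> = ennreal (exp (n * gauss_tilt_cgf m s \<alpha> \<beta>)) * ennreal (exp (- n * r * c))"
          unfolding Q_def using gauss_tilt_mgf[OF s \<open>2 * \<alpha> * s\<^sup>2 < 1\<close> \<theta>, of m \<beta>]
          by (subst nn_integral_multc) auto
        also have "\<dots> = ennreal (exp (n * (gauss_tilt_cgf m s \<alpha> \<beta> - r * c)))"
          by (simp add: ennreal_mult[symmetric] exp_add[symmetric] algebra_simps)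
        also have "\<dots> \<le> ennreal (1/8)"
          using le by (intro ennreal_leI)
        finally show ?thesis .
      qed
      have \<eta>': "2 * \<eta> * s\<^sup>2 < 1" "2 * (- \<eta>) * s\<^sup>2 < 1"
      proof -
        have "0 < \<eta> * s\<^sup>2" "2 * (\<eta> * s\<^sup>2) < 1"
          using \<eta>(1,2) s by (simp_all add: pos_less_divide_eq algebra_simps)
        then show "2 * \<eta> * s\<^sup>2 < 1" "2 * (- \<eta>) * s\<^sup>2 < 1" by linarith+
      qed
      have sn: "n * x / sqrt n = sqrt n * x" for x :: real
      proof -
        have "n * x / sqrt n = n / sqrt n * x" by simp
        also have "n / sqrt n = sqrt n" by (rule real_div_sqrt) simp
        finally show ?thesis .
      qed
      have e2: "n * r * x / sqrt n = r * sqrt n * x" for r x :: real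
      proof -
        have "n * r * x / sqrt n = r * (n * x / sqrt n)" by simp
        also have "\<dots> = r * (sqrt n * x)" by (simp only: sn)
        finally show ?thesis by (simp only: mult.assoc)
      qed
      have *: "ennreal (1/2) \<le> emeasure Q {g \<in> space Q. \<bar>sq_norm n g / n - (m\<^sup>2 + s\<^sup>2)\<bar> < d \<and> \<bar>dot n \<theta> g / sqrt n - m\<bar> < d}"
      proof (rule Q.prob_band_ge)
        show "emeasure Q {x \<in> space Q. m\<^sup>2 + s\<^sup>2 + d \<le> sq_norm n x / n} \<le> ennreal (1/8)"
          using elim n \<eta> by (intro bnd[of _ \<eta> \<eta> 0] \<eta>') (auto simp: L_def)
        show "emeasure Q {x \<in> space Q. - (m\<^sup>2 + s\<^sup>2) + d \<le> - (sq_norm n x / n)} \<le> ennreal (1/8)"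
          using elim n \<eta> by (intro bnd[of _ \<eta> "- \<eta>" 0] \<eta>') (auto simp: L_def)
        show "emeasure Q {x \<in> space Q. m + d \<le> dot n \<theta> x / sqrt n} \<le> ennreal (1/8)"
          using elim n \<kappa> by (intro bnd[of _ \<kappa> 0 \<kappa>]) (auto simp: L'_def e2)
        show "emeasure Q {x \<in> space Q. - m + d \<le> - (dot n \<theta> x / sqrt n)} \<le> ennreal (1/8)"
          using elim n \<kappa> by (intro bnd[of _ \<kappa> 0 "- \<kappa>"]) (auto simp: L'_def e2)
      qed measurable
      let ?E = "{g \<in> space (lborel_Rn n). \<bar>sq_norm n g / n - (m\<^sup>2 + s\<^sup>2)\<bar> < d \<and> \<bar>dot n \<theta> g / sqrt n - m\<bar> < d}"
      \<comment> \<open>Minus the relative entropy per coordinate of the tilted law with respect to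
        the standard Gaussian, reduced by what displacements below d can change: d/2 through the
        standard density, the rest through the tilted one.\<close>
      define k where "k = ln s - (m\<^sup>2 + s\<^sup>2) / 2 + 1/2 - d * (1/2 + (1 + 2 * \<bar>m\<bar>) / (2 * s\<^sup>2))"
      have pw: "exp (n * k) * gauss_tilt_density n m s \<theta> g \<le> exp (- sq_norm n g / 2) / sqrt (2 * pi) ^ n"
        if g: "g \<in> ?E" for g
      proof -
        define u where "u = sq_norm n g / n"
        define v where "v = dot n \<theta> g / sqrt n"
        have uv: "\<bar>u - (m\<^sup>2 + s\<^sup>2)\<bar> < d" "\<bar>v - m\<bar> < d" using g by (auto simp: u_def v_def)
        have e: "sq_norm n g = n * u" "sqrt n * dot n \<theta> g = n * v"
          using n sn[of "dot n \<theta> g"] by (simp_all add: u_def v_def)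
        have "k + m * v / s\<^sup>2 - u / (2 * s\<^sup>2) - m\<^sup>2 / (2 * s\<^sup>2) \<le> - u / 2 + ln s"
        proof -
          have "m * (v - m) \<le> \<bar>m\<bar> * d"
          proof -
            have "m * (v - m) \<le> \<bar>m\<bar> * \<bar>v - m\<bar>" by (metis abs_ge_self abs_mult)
            also have "\<dots> \<le> \<bar>m\<bar> * d" using uv(2) by (intro mult_left_mono) auto
            finally show ?thesis .
          qed
          then have mv: "m * v \<le> m\<^sup>2 + \<bar>m\<bar> * d" by (simp add: power2_eq_square algebra_simps)
          have ul: "m\<^sup>2 + s\<^sup>2 - d \<le> u" "u \<le> m\<^sup>2 + s\<^sup>2 + d" using uv(1) by auto
          have "m * v / s\<^sup>2 - u / (2 * s\<^sup>2) - m\<^sup>2 / (2 * s\<^sup>2) = (2 * (m * v) - u - m\<^sup>2) / (2 * s\<^sup>2)"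
            using s by (simp add: field_simps)
          also have "\<dots> \<le> (2 * (m\<^sup>2 + \<bar>m\<bar> * d) - (m\<^sup>2 + s\<^sup>2 - d) - m\<^sup>2) / (2 * s\<^sup>2)"
            using mv ul s by (intro divide_right_mono) auto
          also have "\<dots> = d * (1 + 2 * \<bar>m\<bar>) / (2 * s\<^sup>2) - 1/2"
            using s by (simp add: field_simps power2_eq_square)
          finally have "m * v / s\<^sup>2 - u / (2 * s\<^sup>2) - m\<^sup>2 / (2 * s\<^sup>2) \<le> d * (1 + 2 * \<bar>m\<bar>) / (2 * s\<^sup>2) - 1/2" .
          moreover have "k = ln s - (m\<^sup>2 + s\<^sup>2) / 2 + 1/2 - d / 2 - d * (1 + 2 * \<bar>m\<bar>) / (2 * s\<^sup>2)"
            by (simp add: k_def distrib_left)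
          moreover have "k + x - y - z \<le> - u / 2 + l"
            if "x - y - z \<le> T - 1/2" "k = l - c / 2 + 1/2 - d / 2 - T" "u \<le> c + d" for x y z l c T :: real
            using that by linarith
          ultimately show ?thesis
            using ul(2) by blast
        qed
        from mult_left_mono[OF this, of n] have
          "n * k + (sqrt n * m / s\<^sup>2 * dot n \<theta> g - sq_norm n g / (2 * s\<^sup>2) - n * m\<^sup>2 / (2 * s\<^sup>2))
            \<le> - sq_norm n g / 2 + n * ln s"
          using e by (simp add: algebra_simps)
        then have "exp (n * k) * exp (sqrt n * m / s\<^sup>2 * dot n \<theta> g - sq_norm n g / (2 * s\<^sup>2) - n * m\<^sup>2 / (2 * s\<^sup>2))
            \<le> exp (- sq_norm n g / 2) * exp (ln s) ^ n"
          by (simp flip: exp_add exp_of_nat_mult)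
        then show ?thesis
          using s by (simp add: gauss_tilt_density_def power_mult_distrib field_simps)
      qed
      have "ennreal (1/2 * exp (n * k)) = ennreal (exp (n * k)) * ennreal (1/2)"
        unfolding mult.commute[of "1/2 :: real"] by (rule ennreal_mult) simp_all
      also have "\<dots> \<le> ennreal (exp (n * k)) * emeasure Q ?E"
        using * by (intro mult_left_mono) (simp_all add: Q_def)
      also have "\<dots> = (\<integral>\<^sup>+g. ennreal (exp (n * k)) * (ennreal (gauss_tilt_density n m s \<theta> g) * indicator ?E g) \<partial>lborel_Rn n)"
        unfolding Q_def by (subst emeasure_density, measurable) (simp add: nn_integral_cmult)
      also have "\<dots> \<le> (\<integral>\<^sup>+g. ennreal (exp (- sq_norm n g / 2) / sqrt (2 * pi) ^ n) * indicator ?E g \<partial>lborel_Rn n)"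
        using pw by (intro nn_integral_mono) (auto simp: indicator_def ennreal_mult'[symmetric] intro!: ennreal_leI)
      also have "\<dots> = emeasure (gauss n) ?E"
        unfolding gauss_def by (subst emeasure_density) measurable
      finally show "ennreal (1/2 * exp (n * (ln s - (m\<^sup>2 + s\<^sup>2) / 2 + 1/2 - d * (1/2 + (1 + 2 * \<bar>m\<bar>) / (2 * s\<^sup>2)))))
        \<le> emeasure (gauss n) {g \<in> space (gauss n).
        \<bar>sq_norm n g / n - (m\<^sup>2 + s\<^sup>2)\<bar> < d \<and> \<bar>dot n \<theta> g / sqrt n - m\<bar> < d}"
        by (simp add: k_def gauss_def)
    qed
  qed
qed


section \<open>Spherical caps\<close>

lemma mat_apply_measurable [measurable]:
  "mat_apply n Q \<in> measurable (lborel_Rn n) (lborel_Rn n)"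
proof -
  have "(\<lambda>x. \<Sum>j=1..n. Q i j * x j) \<in> borel_measurable (lborel_Rn n)" for i
    by (rule sum_coord_measurable) measurable
  then show ?thesis
    unfolding mat_apply_def[abs_def]
    by (subst (2) lborel_Rn_def) (auto intro!: measurable_restrict)
qed

lemma unit_sphere_eq: "unit_sphere n = {x \<in> space (lborel_Rn n). sq_norm n x = 1}"
  by (simp add: unit_sphere_def sq_norm_def)

lemma sphere_uniformD:
  assumes "sphere_uniform n \<nu>"
  shows "prob_space \<nu>" "sets \<nu> = sets (lborel_Rn n)" "space \<nu> = space (lborel_Rn n)"
    "AE \<theta> in \<nu>. sq_norm n \<theta> = 1"
    "\<And>Q. orthogonal_mat n Q \<Longrightarrow> distr \<nu> (lborel_Rn n) (mat_apply n Q) = \<nu>"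
proof -
  show p: "prob_space \<nu>" and s: "sets \<nu> = sets (lborel_Rn n)"
    and "\<And>Q. orthogonal_mat n Q \<Longrightarrow> distr \<nu> (lborel_Rn n) (mat_apply n Q) = \<nu>"
    using assms by (auto simp: sphere_uniform_def)
  show sp: "space \<nu> = space (lborel_Rn n)" by (rule sets_eq_imp_space_eq[OF s])
  interpret prob_space \<nu> by (rule p)
  have "prob (unit_sphere n) = 1"
    using assms by (simp add: sphere_uniform_def emeasure_eq_measure)
  then have "AE \<theta> in \<nu>. \<theta> \<in> unit_sphere n" by (rule AE_prob_1)
  then show "AE \<theta> in \<nu>. sq_norm n \<theta> = 1" by (simp add: unit_sphere_eq)
qed

text \<open>The Householder reflection that exchanges \<open>x\<close> and \<open>g\<close>.\<close>

lemma sphere_dot_law: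
  assumes \<nu>: "sphere_uniform n \<nu>" and eq: "sq_norm n x = sq_norm n g" and S [measurable]: "S \<in> sets borel"
  shows "emeasure \<nu> {\<theta> \<in> space \<nu>. dot n x \<theta> \<in> S} = emeasure \<nu> {\<theta> \<in> space \<nu>. dot n g \<theta> \<in> S}"
proof -
  note [measurable_cong] = sphere_uniformD(2)[OF \<nu>]
  define v where "v = (\<lambda>i. g i - x i)"
  define N where "N = sq_norm n v"
  show ?thesis
  proof (cases "N = 0")
    case True
    then have "\<forall>i\<in>{1..n}. (v i)\<^sup>2 = 0"
      unfolding N_def sq_norm_def by (subst (asm) sum_nonneg_eq_0_iff) auto
    then have "dot n x \<theta> = dot n g \<theta>" for \<theta>
      unfolding dot_def v_def by (intro sum.cong) auto
    then show ?thesis by simp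
  next
    case False
    define Q where "Q = (\<lambda>i j. (if i = j then 1 else 0) - 2 * v i * v j / N)"
    have N_sum: "(\<Sum>k=1..n. v k * v k) = N"
      by (simp add: N_def sq_norm_def power2_eq_square)
    have orth: "orthogonal_mat n Q"
      unfolding orthogonal_mat_def
    proof (intro ballI)
      fix i j assume ij: "i \<in> {1..n}" "j \<in> {1..n}"
      define C where "C = 4 * v i * v j / N\<^sup>2"
      have "(\<Sum>k=1..n. Q k i * Q k j) = (\<Sum>k=1..n. (if k = i then (if i = j then 1 else 0) else 0)
          - (if k = i then 2 * v k * v j / N else 0) - (if k = j then 2 * v k * v i / N else 0)
          + (v k * v k) * C)"
        unfolding Q_def C_def by (intro sum.cong refl) (auto simp: algebra_simps power2_eq_square)
      also have "\<dots> = (if i = j then 1 else 0) - 2 * v i * v j / N - 2 * v j * v i / N + N * C"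
        using ij by (simp add: sum.distrib sum_subtractf sum_distrib_right[symmetric] N_sum[simplified])
      also have "\<dots> = (if i = j then 1 else 0)"
        using False by (simp add: C_def field_simps power2_eq_square)
      finally show "(\<Sum>k=1..n. Q k i * Q k j) = (if i = j then 1 else 0)" .
    qed
    \<comment> \<open>Equal norms enter here: they make the reflection along v send g to
      \<open>g - v = x\<close>.\<close>
    have gv: "2 * (\<Sum>i=1..n. g i * v i) = N"
    proof -
      have "N = (\<Sum>i=1..n. 2 * (g i * v i) + ((x i)\<^sup>2 - (g i)\<^sup>2))"
        unfolding N_def sq_norm_def v_def by (intro sum.cong) (auto simp: power2_eq_square algebra_simps)
      also have "\<dots> = 2 * (\<Sum>i=1..n. g i * v i) + (sq_norm n x - sq_norm n g)"
        by (simp add: sum.distrib sum_subtractf sum_distrib_left sq_norm_def)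
      finally show ?thesis using eq by simp
    qed
    have dotQ: "dot n g (mat_apply n Q \<theta>) = dot n x \<theta>" for \<theta>
    proof -
      have "dot n g (mat_apply n Q \<theta>) = (\<Sum>i=1..n. \<Sum>j=1..n. g i * (Q i j * \<theta> j))"
        by (simp add: dot_def mat_apply_def sum_distrib_left)
      also have "\<dots> = (\<Sum>j=1..n. \<Sum>i=1..n. g i * (Q i j * \<theta> j))" by (rule sum.swap)
      also have "\<dots> = (\<Sum>j=1..n. x j * \<theta> j)"
      proof (intro sum.cong refl)
        fix j assume j: "j \<in> {1..n}"
        have "(\<Sum>i=1..n. g i * (Q i j * \<theta> j)) = (\<Sum>i=1..n. (if i = j then g i * \<theta> j else 0) - (2 * (g i * v i)) * (v j * \<theta> j / N))"
          unfolding Q_def by (intro sum.cong refl) (auto simp: algebra_simps)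
        also have "\<dots> = g j * \<theta> j - (2 * (\<Sum>i=1..n. g i * v i)) * (v j * \<theta> j / N)"
          using j by (simp add: sum_subtractf sum_distrib_right sum_distrib_left sum_divide_distrib)
        also have "\<dots> = x j * \<theta> j" unfolding gv using False by (simp add: v_def field_simps)
        finally show "(\<Sum>i=1..n. g i * (Q i j * \<theta> j)) = x j * \<theta> j" .
      qed
      finally show ?thesis by (simp add: dot_def)
    qed
    have "emeasure \<nu> {\<theta> \<in> space \<nu>. dot n g \<theta> \<in> S}
        = emeasure (distr \<nu> (lborel_Rn n) (mat_apply n Q)) {\<theta> \<in> space \<nu>. dot n g \<theta> \<in> S}"
      using sphere_uniformD(5)[OF \<nu> orth] by simp
    also have "\<dots> = emeasure \<nu> (mat_apply n Q -` {\<theta> \<in> space \<nu>. dot n g \<theta> \<in> S} \<inter> space \<nu>)"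
      by (subst emeasure_distr) (auto simp: sphere_uniformD(3)[OF \<nu>])
    also have "mat_apply n Q -` {\<theta> \<in> space \<nu>. dot n g \<theta> \<in> S} \<inter> space \<nu> = {\<theta> \<in> space \<nu>. dot n x \<theta> \<in> S}"
      using measurable_space[OF mat_apply_measurable] by (auto simp: dotQ sphere_uniformD(3)[OF \<nu>])
    finally show ?thesis by simp
  qed
qed

text \<open>Polar decomposition of the Gaussian measure without polar coordinates: average the rotation
  invariant quantity over \<open>g\<close> and swap the two integrations.\<close>

lemma sphere_gauss_exchange:
  assumes \<nu>: "sphere_uniform n \<nu>" and R [measurable]: "R \<in> sets borel" and Rpos: "R \<subseteq> {0<..}"
    and S [measurable]: "S \<in> sets borel"
  shows "emeasure \<nu> {\<theta> \<in> space \<nu>. dot n y \<theta> \<in> S} * emeasure (gauss n) {g \<in> space (gauss n). sq_norm n g \<in> R}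
    = (\<integral>\<^sup>+\<theta>. emeasure (gauss n) {g \<in> space (gauss n). sq_norm n g \<in> R
          \<and> sqrt (sq_norm n y) * dot n \<theta> g / sqrt (sq_norm n g) \<in> S} \<partial>\<nu>)"
proof -
  note [measurable_cong] = sphere_uniformD(2)[OF \<nu>]
  have [measurable_cong]: "sets (gauss n) = sets (lborel_Rn n)" by (simp add: gauss_def)
  interpret N: prob_space \<nu> by (rule sphere_uniformD[OF \<nu>])
  interpret G: prob_space "gauss n" by (rule prob_space_gauss)
  interpret P: pair_sigma_finite "gauss n" \<nu> ..
  define l where "l = sqrt (sq_norm n y)"
  \<comment> \<open>For fixed \<theta> this indicates a Gaussian event. For fixed g with squared
    norm in R, the multiple \<open>l / sqrt (sq_norm n g)\<close> of g has the norm of y, so its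
    inner product with \<theta> has the law of \<open>dot n y \<theta>\<close>. Points of R are
    positive, which permits the division.\<close>
  define f :: "(nat \<Rightarrow> real) \<times> (nat \<Rightarrow> real) \<Rightarrow> ennreal"
    where "f = (\<lambda>(g, \<theta>). indicator R (sq_norm n g) * indicator S (l * dot n \<theta> g / sqrt (sq_norm n g)))"
  have dsw: "dot n \<theta> g = dot n g \<theta>" for \<theta> g by (simp add: dot_def mult.commute)
  have sets_eq: "sets (gauss n \<Otimes>\<^sub>M \<nu>) = sets (lborel_Rn n \<Otimes>\<^sub>M lborel_Rn n)"
    by (rule sets_pair_measure_cong) (simp_all add: gauss_def sphere_uniformD(2)[OF \<nu>])
  have "(\<lambda>z. dot n (fst z) (snd z)) \<in> borel_measurable (gauss n \<Otimes>\<^sub>M \<nu>)"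
    using dot_measurable_pair[of n] unfolding measurable_cong_sets[OF sets_eq refl] split_beta .
  then have [measurable]: "(\<lambda>z. dot n (snd z) (fst z)) \<in> borel_measurable (gauss n \<Otimes>\<^sub>M \<nu>)"
    by (subst dsw)
  have f [measurable]: "f \<in> borel_measurable (gauss n \<Otimes>\<^sub>M \<nu>)"
    unfolding f_def split_beta by measurable
  have "(\<integral>\<^sup>+\<theta>. f (g, \<theta>) \<partial>\<nu>) = emeasure \<nu> {\<theta> \<in> space \<nu>. dot n y \<theta> \<in> S} * indicator R (sq_norm n g)" for g
  proof (cases "sq_norm n g \<in> R")
    case True
    then have pos: "0 < sq_norm n g" using Rpos by auto
    define c where "c = l / sqrt (sq_norm n g)"
    have "sq_norm n (\<lambda>i. c * g i) = c\<^sup>2 * sq_norm n g"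
      by (simp add: sq_norm_def power_mult_distrib sum_distrib_left)
    also have "\<dots> = sq_norm n y"
      using pos by (simp add: c_def l_def power_divide)
    finally have "emeasure \<nu> {\<theta> \<in> space \<nu>. dot n y \<theta> \<in> S} = emeasure \<nu> {\<theta> \<in> space \<nu>. dot n (\<lambda>i. c * g i) \<theta> \<in> S}"
      by (intro sphere_dot_law[OF \<nu> _ S]) simp
    also have "\<dots> = emeasure \<nu> {\<theta> \<in> space \<nu>. l * dot n \<theta> g / sqrt (sq_norm n g) \<in> S}"
    proof -
      have "dot n (\<lambda>i. c * g i) \<theta> = l * dot n \<theta> g / sqrt (sq_norm n g)" for \<theta>
        unfolding c_def dot_def sum_distrib_left sum_divide_distrib
        by (intro sum.cong) (auto simp: mult_ac)
      then show ?thesis by simp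
    qed
    also have "\<dots> = (\<integral>\<^sup>+\<theta>. indicator {\<theta> \<in> space \<nu>. l * dot n \<theta> g / sqrt (sq_norm n g) \<in> S} \<theta> \<partial>\<nu>)"
      by (rule nn_integral_indicator[symmetric], subst dsw) measurable
    also have "\<dots> = (\<integral>\<^sup>+\<theta>. f (g, \<theta>) \<partial>\<nu>)"
      using True by (intro nn_integral_cong) (simp add: f_def indicator_def)
    finally show ?thesis using True by simp
  qed (simp add: f_def)
  then have "(\<integral>\<^sup>+g. \<integral>\<^sup>+\<theta>. f (g, \<theta>) \<partial>\<nu> \<partial>gauss n)
      = emeasure \<nu> {\<theta> \<in> space \<nu>. dot n y \<theta> \<in> S} * (\<integral>\<^sup>+g. indicator R (sq_norm n g) \<partial>gauss n)"
    by (simp add: nn_integral_cmult)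
  also have "(\<integral>\<^sup>+g. indicator R (sq_norm n g) \<partial>gauss n) = (\<integral>\<^sup>+g. indicator {g \<in> space (gauss n). sq_norm n g \<in> R} g \<partial>gauss n)"
    by (intro nn_integral_cong) (simp add: indicator_def)
  also have "\<dots> = emeasure (gauss n) {g \<in> space (gauss n). sq_norm n g \<in> R}" by simp
  finally have 1: "emeasure \<nu> {\<theta> \<in> space \<nu>. dot n y \<theta> \<in> S} * emeasure (gauss n) {g \<in> space (gauss n). sq_norm n g \<in> R}
     = (\<integral>\<^sup>+g. \<integral>\<^sup>+\<theta>. f (g, \<theta>) \<partial>\<nu> \<partial>gauss n)" by simp
  also have "\<dots> = (\<integral>\<^sup>+\<theta>. \<integral>\<^sup>+g. f (g, \<theta>) \<partial>gauss n \<partial>\<nu>)"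
    by (rule P.Fubini[OF f, symmetric])
  also have "\<dots> = (\<integral>\<^sup>+\<theta>. emeasure (gauss n) {g \<in> space (gauss n). sq_norm n g \<in> R
          \<and> l * dot n \<theta> g / sqrt (sq_norm n g) \<in> S} \<partial>\<nu>)"
  proof (intro nn_integral_cong)
    fix \<theta>
    have "(\<integral>\<^sup>+g. f (g, \<theta>) \<partial>gauss n) = (\<integral>\<^sup>+g. indicator {g \<in> space (gauss n). sq_norm n g \<in> R
          \<and> l * dot n \<theta> g / sqrt (sq_norm n g) \<in> S} g \<partial>gauss n)"
      by (intro nn_integral_cong) (simp add: f_def indicator_def)
    also have "\<dots> = emeasure (gauss n) {g \<in> space (gauss n). sq_norm n g \<in> R
          \<and> l * dot n \<theta> g / sqrt (sq_norm n g) \<in> S}"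
      by (rule nn_integral_indicator) measurable
    finally show "(\<integral>\<^sup>+g. f (g, \<theta>) \<partial>gauss n) = emeasure (gauss n) {g \<in> space (gauss n). sq_norm n g \<in> R
          \<and> l * dot n \<theta> g / sqrt (sq_norm n g) \<in> S}" .
  qed
  finally show ?thesis by (simp add: l_def)
qed

lemma ennreal_le_divide_real:
  fixes a :: ennreal
  assumes "a * ennreal k \<le> ennreal u" "0 < k" "0 \<le> u"
  shows "a \<le> ennreal (u / k)"
proof -
  have "a = a * ennreal k * ennreal (1 / k)"
    using assms by (simp add: mult.assoc flip: ennreal_mult)
  also have "\<dots> \<le> ennreal u * ennreal (1 / k)" by (intro mult_right_mono assms) simp
  also have "\<dots> = ennreal (u / k)" using assms by (simp flip: ennreal_mult)
  finally show ?thesis .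
qed

lemma gauss_linear_mgf:
  "(\<integral>\<^sup>+g. ennreal (exp (b * dot n \<theta> g)) \<partial>gauss n) = ennreal (exp (b\<^sup>2 * sq_norm n \<theta> / 2))"
proof -
  have "(\<integral>\<^sup>+g. ennreal (exp (b * dot n \<theta> g)) \<partial>gauss n)
    = (\<integral>\<^sup>+g. ennreal (1 / sqrt (2 * pi) ^ n) * ennreal (exp (b * dot n \<theta> g - 1/2 * sq_norm n g)) \<partial>lborel_Rn n)"
    unfolding gauss_def
    by (subst nn_integral_density) (auto simp: ennreal_mult[symmetric] exp_add[symmetric] intro!: nn_integral_cong)
  also have "\<dots> = ennreal (1 / sqrt (2 * pi) ^ n) * ennreal (sqrt (2 * pi) ^ n * exp (b\<^sup>2 * sq_norm n \<theta> / 2))"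
    using nn_integral_gauss_n[where a = "1/2" and b = b and \<theta> = \<theta> and n = n]
    by (subst nn_integral_cmult) (simp_all add: mult.commute[of pi])
  also have "\<dots> = ennreal (exp (b\<^sup>2 * sq_norm n \<theta> / 2))"
    by (simp flip: ennreal_mult)
  finally show ?thesis .
qed

text \<open>Where \<open>sq_norm n g > n * A\<close>, and since w \<ge> 0, the normalised event
  forces g into a half-space, whose Gaussian probability has a Chernoff bound with slope \<kappa>.
  Dividing by the probability of the norm event costs \<open>(A - 1 - ln A) / 2\<close> per
  coordinate. A stays free: its choice will supply the \<open>t0\<close> component of the dual
  point.\<close>

lemma sphere_cap_upper:
  assumes A: "0 < A" and \<zeta>: "0 < \<zeta>"
  shows "eventually (\<lambda>n. \<forall>\<nu> y (\<kappa>::real) (w::real). sphere_uniform n \<nu> \<longrightarrow> 0 \<le> \<kappa> \<longrightarrow> 0 \<le> w \<longrightarrow>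
     emeasure \<nu> {\<theta> \<in> space \<nu>. sqrt n * w \<le> dot n y \<theta>}
      \<le> ennreal (exp (- \<kappa> * n * w + \<kappa>\<^sup>2 * sq_norm n y / (2 * A) + n * ((A - 1 - ln A) / 2 + \<zeta>)))) sequentially"
proof -
  \<comment> \<open>Solves \<open>d + d / (2 * A) = \<zeta> / 2\<close>, where the left side bounds
    the loss from aiming at A + d with a band of radius d. The other half of \<zeta> absorbs the
    factor 1/2.\<close>
  define d where "d = \<zeta> / (2 + 1 / A)"
  have d: "0 < d" using A \<zeta> by (simp add: d_def add_pos_pos)
  define s where "s = sqrt (A + d)"
  have s: "0 < s" "s\<^sup>2 = A + d" using A d by (auto simp: s_def)
  define k where "k = ln s - (0\<^sup>2 + s\<^sup>2) / 2 + 1/2 - d * (1/2 + (1 + 2 * \<bar>0\<bar>) / (2 * s\<^sup>2))"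
  have k: "- ((A - 1 - ln A) / 2 + \<zeta>) \<le> k - \<zeta> / 2"
  proof -
    have "ln s = ln (A + d) / 2" using A d by (simp add: s_def ln_sqrt)
    moreover have "ln A \<le> ln (A + d)" using A d by simp
    moreover have "d / (2 * (A + d)) \<le> d / (2 * A)"
      using A d by (intro divide_left_mono) auto
    moreover have "d + d / (2 * A) = \<zeta> / 2"
    proof -
      have "2 + 1 / A \<noteq> 0" using A by (simp add: add_pos_pos less_imp_neq[symmetric])
      then have "d * (2 + 1 / A) = \<zeta>" by (simp add: d_def)
      then show ?thesis by (simp add: distrib_left)
    qed
    moreover have "k = ln s - (A + d) / 2 + 1/2 - (d / 2 + d / (2 * (A + d)))"
      unfolding k_def s(2) by (simp add: distrib_left)
    ultimately show ?thesis
      by (simp add: field_sum_of_halves diff_divide_distrib add_divide_distrib)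
  qed
  have ev: "eventually (\<lambda>n. n \<ge> 1 \<and> exp (real n * (- \<zeta> / 2)) \<le> 1/2 \<and> (\<forall>\<theta>. sq_norm n \<theta> = 1 \<longrightarrow> ennreal (1/2 * exp (n * k))
     \<le> emeasure (gauss n) {g \<in> space (gauss n).
        \<bar>sq_norm n g / n - (0\<^sup>2 + s\<^sup>2)\<bar> < d \<and> \<bar>dot n \<theta> g / sqrt n - 0\<bar> < d})) sequentially"
    unfolding k_def using \<zeta>
    by (intro eventually_conj gauss_band_lower[OF s(1) d] eventually_exp_mult_le eventually_ge_at_top) auto
  show ?thesis
    using ev
  proof eventually_elim
    case (elim n)
    then have n: "1 \<le> real n" by simp
    have [measurable_cong]: "sets (gauss n) = sets (lborel_Rn n)" by (simp add: gauss_def)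
    \<comment> \<open>Any unit vector serves, because only the norm part of the band is kept. With
      s^2 = A + d the band of radius d lies above A.\<close>
    have "sq_norm n (\<lambda>i. if i = 1 then 1 else 0) = 1"
      using elim by (simp add: sq_norm_def if_distrib[of "\<lambda>x. x\<^sup>2"] cong: if_cong)
    then have "ennreal (1/2 * exp (n * k)) \<le> emeasure (gauss n) {g \<in> space (gauss n).
        \<bar>sq_norm n g / n - (0\<^sup>2 + s\<^sup>2)\<bar> < d \<and> \<bar>dot n (\<lambda>i. if i = 1 then 1 else 0) g / sqrt n - 0\<bar> < d}"
      using elim by blast
    also have "\<dots> \<le> emeasure (gauss n) {g \<in> space (gauss n). sq_norm n g \<in> {n * A<..}}"
    proof (intro emeasure_mono subsetI)
      fix g assume g: "g \<in> {g \<in> space (gauss n).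
        \<bar>sq_norm n g / n - (0\<^sup>2 + s\<^sup>2)\<bar> < d \<and> \<bar>dot n (\<lambda>i. if i = 1 then 1 else 0) g / sqrt n - 0\<bar> < d}"
      then have "A < sq_norm n g / n" by (auto simp: s(2))
      then show "g \<in> {g \<in> space (gauss n). sq_norm n g \<in> {n * A<..}}"
        using n g by (simp add: pos_less_divide_eq mult.commute)
    qed measurable
    finally have G: "ennreal (1/2 * exp (n * k)) \<le> emeasure (gauss n) {g \<in> space (gauss n). sq_norm n g \<in> {n * A<..}}" .
    have half: "exp (- (n * ((A - 1 - ln A) / 2 + \<zeta>))) \<le> 1/2 * exp (n * k)"
    proof -
      have "- (n * ((A - 1 - ln A) / 2 + \<zeta>)) \<le> n * (- \<zeta> / 2) + n * k"
        using mult_left_mono[OF k, of n] by (simp add: algebra_simps)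
      then have "exp (- (n * ((A - 1 - ln A) / 2 + \<zeta>))) \<le> exp (n * (- \<zeta> / 2)) * exp (n * k)"
        by (simp flip: exp_add)
      also have "\<dots> \<le> 1/2 * exp (n * k)"
        using elim by (intro mult_right_mono) auto
      finally show ?thesis .
    qed
    show ?case
    proof (intro allI impI)
      fix \<nu> and y :: "nat \<Rightarrow> real" and \<kappa> w :: real
      assume \<nu>: "sphere_uniform n \<nu>" and \<kappa>: "0 \<le> \<kappa>" and w: "0 \<le> w"
      interpret N: prob_space \<nu> by (rule sphere_uniformD[OF \<nu>])
      define l where "l = sqrt (sq_norm n y)"
      have l: "0 \<le> l" by (simp add: l_def)
      define u where "u = exp (\<kappa>\<^sup>2 * sq_norm n y / (2 * A) - \<kappa> * n * w)"
      have bound: "emeasure (gauss n) {g \<in> space (gauss n). sq_norm n g \<in> {n * A<..}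
          \<and> sqrt (sq_norm n y) * dot n \<theta> g / sqrt (sq_norm n g) \<in> {sqrt n * w..}} \<le> ennreal u"
        if \<theta>: "sq_norm n \<theta> = 1" for \<theta>
      proof -
        let ?h = "\<lambda>g. \<kappa> * l / sqrt A * dot n \<theta> g"
        have "emeasure (gauss n) {g \<in> space (gauss n). sq_norm n g \<in> {n * A<..}
          \<and> sqrt (sq_norm n y) * dot n \<theta> g / sqrt (sq_norm n g) \<in> {sqrt n * w..}}
          \<le> emeasure (gauss n) {g \<in> space (gauss n). \<kappa> * n * w \<le> ?h g}"
        proof (intro emeasure_mono subsetI)
          fix g assume g: "g \<in> {g \<in> space (gauss n). sq_norm n g \<in> {n * A<..}
            \<and> sqrt (sq_norm n y) * dot n \<theta> g / sqrt (sq_norm n g) \<in> {sqrt n * w..}}"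
          have big: "sqrt n * sqrt A \<le> sqrt (sq_norm n g)" "0 < sqrt n * sqrt A"
            using g n A by (auto simp flip: real_sqrt_mult)
          then have "sqrt n * w * sqrt (sq_norm n g) \<le> l * dot n \<theta> g"
          proof -
            have "sqrt n * w \<le> l * dot n \<theta> g / sqrt (sq_norm n g)" using g by (simp add: l_def)
            moreover have "0 < sqrt (sq_norm n g)" using big by linarith
            ultimately show ?thesis by (simp only: pos_le_divide_eq)
          qed
          moreover have "sqrt n * w * (sqrt n * sqrt A) \<le> sqrt n * w * sqrt (sq_norm n g)"
            using big w by (intro mult_left_mono) auto
          ultimately have "n * w * sqrt A \<le> l * dot n \<theta> g"
            by (simp add: algebra_simps)
          then have "\<kappa> * (n * w * sqrt A) \<le> \<kappa> * (l * dot n \<theta> g)"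
            using \<kappa> by (rule mult_left_mono)
          then have "\<kappa> * n * w \<le> ?h g"
            using A by (simp add: pos_le_divide_eq algebra_simps)
          then show "g \<in> {g \<in> space (gauss n). \<kappa> * n * w \<le> ?h g}" using g by simp
        qed measurable
        also have "\<dots> \<le> (\<integral>\<^sup>+g. ennreal (exp (?h g - \<kappa> * n * w)) \<partial>gauss n)"
          by (rule emeasure_le_exp) measurable
        also have "\<dots> = (\<integral>\<^sup>+g. ennreal (exp (?h g)) * ennreal (exp (- \<kappa> * n * w)) \<partial>gauss n)"
          by (simp add: ennreal_mult[symmetric] exp_add[symmetric])
        also have "\<dots> = ennreal (exp ((\<kappa> * l / sqrt A)\<^sup>2 * sq_norm n \<theta> / 2)) * ennreal (exp (- \<kappa> * n * w))"
          by (subst nn_integral_multc) (simp_all add: gauss_linear_mgf del: times_divide_eq_left)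
        also have "\<dots> = ennreal u"
          using A \<theta> by (simp add: u_def l_def ennreal_mult[symmetric] exp_add[symmetric] power_divide power_mult_distrib algebra_simps)
        finally show ?thesis .
      qed
      have "emeasure \<nu> {\<theta> \<in> space \<nu>. dot n y \<theta> \<in> {sqrt n * w..}} * ennreal (exp (- (n * ((A - 1 - ln A) / 2 + \<zeta>))))
         \<le> emeasure \<nu> {\<theta> \<in> space \<nu>. dot n y \<theta> \<in> {sqrt n * w..}} * emeasure (gauss n) {g \<in> space (gauss n). sq_norm n g \<in> {n * A<..}}"
        using half by (intro mult_left_mono order_trans[OF _ G]) (auto intro!: ennreal_leI)
      also have "\<dots> = (\<integral>\<^sup>+\<theta>. emeasure (gauss n) {g \<in> space (gauss n). sq_norm n g \<in> {n * A<..}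
          \<and> sqrt (sq_norm n y) * dot n \<theta> g / sqrt (sq_norm n g) \<in> {sqrt n * w..}} \<partial>\<nu>)"
        using A n by (intro sphere_gauss_exchange[OF \<nu>]) (auto intro: order_le_less_trans[of 0 "real n * A"])
      also have "\<dots> \<le> (\<integral>\<^sup>+\<theta>. ennreal u \<partial>\<nu>)"
        by (rule nn_integral_mono_AE) (use sphere_uniformD(4)[OF \<nu>] in eventually_elim, rule bound)
      also have "\<dots> = ennreal u" by (simp add: N.emeasure_space_1)
      finally have "emeasure \<nu> {\<theta> \<in> space \<nu>. dot n y \<theta> \<in> {sqrt n * w..}}
          \<le> ennreal (u / exp (- (n * ((A - 1 - ln A) / 2 + \<zeta>))))"
        by (rule ennreal_le_divide_real) (auto simp: u_def)
      also have "u / exp (- (n * ((A - 1 - ln A) / 2 + \<zeta>)))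
         = exp (- \<kappa> * n * w + \<kappa>\<^sup>2 * sq_norm n y / (2 * A) + n * ((A - 1 - ln A) / 2 + \<zeta>))"
        by (simp add: u_def exp_diff[symmetric])
      finally show "emeasure \<nu> {\<theta> \<in> space \<nu>. sqrt n * w \<le> dot n y \<theta>}
         \<le> ennreal (exp (- \<kappa> * n * w + \<kappa>\<^sup>2 * sq_norm n y / (2 * A) + n * ((A - 1 - ln A) / 2 + \<zeta>)))"
        by simp
    qed
  qed
qed

text \<open>A Gaussian vector with mean parameter v and variance \<open>1 - v\<^sup>2\<close> has
  squared norm about n and inner product about \<open>sqrt n * v\<close> with \<theta>, hence cosine
  about v. As m^2 + s^2 = 1, its relative entropy reduces to \<open>- ln s\<close>. The event that g
  is nonzero has probability at most 1, which is the right direction for a lower bound.\<close>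

lemma sphere_cap_lower:
  assumes v: "\<bar>v\<bar> < 1" and \<zeta>: "0 < \<zeta>" and e: "0 < e"
  shows "eventually (\<lambda>n. \<forall>\<nu> y. sphere_uniform n \<nu> \<longrightarrow> 0 < sq_norm n y \<longrightarrow>
     ennreal (exp (n * (ln (1 - v\<^sup>2) / 2 - \<zeta>)))
      \<le> emeasure \<nu> {\<theta> \<in> space \<nu>. \<bar>dot n y \<theta> - sqrt (sq_norm n y) * v\<bar> < sqrt (sq_norm n y) * e}) sequentially"
proof -
  define s where "s = sqrt (1 - v\<^sup>2)"
  have v2: "v\<^sup>2 < 1" using v by (simp add: abs_square_less_1)
  then have s: "0 < s" "v\<^sup>2 + s\<^sup>2 = 1" by (auto simp: s_def)
  \<comment> \<open>Turns closeness of the pair (squared norm per coordinate, scaled inner product)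
    to (1, v) into closeness of the cosine to v.\<close>
  have "continuous (at (1, v)) (\<lambda>z::real \<times> real. snd z / sqrt (fst z))"
    by (intro continuous_intros) auto
  then obtain d0 where d0: "0 < d0" and d0': "\<And>z. dist z (1, v) < d0 \<Longrightarrow> dist (snd z / sqrt (fst z)) v < e"
    using e unfolding continuous_at_eps_delta by fastforce
  define C where "C = 1/2 + (1 + 2 * \<bar>v\<bar>) / (2 * s\<^sup>2)"
  have C: "0 < C" unfolding C_def using s by (intro add_pos_nonneg) auto
  \<comment> \<open>The three bounds secure the continuity radius in the sum of both deviations,
    positivity of the norm, and an entropy error \<open>d * C\<close> of at most \<zeta>/2.\<close>
  define d where "d = min (min (d0 / 2) (1/2)) (\<zeta> / (2 * C))"
  have d: "0 < d" "d \<le> d0 / 2" "d \<le> 1/2" "d \<le> \<zeta> / (2 * C)" using d0 \<zeta> C by (auto simp: d_def)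
  define k where "k = ln s - (v\<^sup>2 + s\<^sup>2) / 2 + 1/2 - d * (1/2 + (1 + 2 * \<bar>v\<bar>) / (2 * s\<^sup>2))"
  have k: "ln (1 - v\<^sup>2) / 2 - \<zeta> \<le> - \<zeta> / 2 + k"
  proof -
    have "d * C \<le> \<zeta> / 2" using mult_right_mono[OF d(4), of C] C by simp
    moreover have "ln s = ln (1 - v\<^sup>2) / 2" using v2 by (simp add: s_def ln_sqrt)
    ultimately show ?thesis unfolding k_def C_def[symmetric] s(2) by simp
  qed
  have ev: "eventually (\<lambda>n. n \<ge> 1 \<and> exp (real n * (- \<zeta> / 2)) \<le> 1/2 \<and> (\<forall>\<theta>. sq_norm n \<theta> = 1 \<longrightarrow> ennreal (1/2 * exp (n * k))
     \<le> emeasure (gauss n) {g \<in> space (gauss n).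
        \<bar>sq_norm n g / n - (v\<^sup>2 + s\<^sup>2)\<bar> < d \<and> \<bar>dot n \<theta> g / sqrt n - v\<bar> < d})) sequentially"
    unfolding k_def using \<zeta>
    by (intro eventually_conj gauss_band_lower[OF s(1) d(1)] eventually_exp_mult_le eventually_ge_at_top) auto
  show ?thesis
    using ev
  proof eventually_elim
    case (elim n)
    then have n: "1 \<le> real n" by simp
    have [measurable_cong]: "sets (gauss n) = sets (lborel_Rn n)" by (simp add: gauss_def)
    interpret G: prob_space "gauss n" by (rule prob_space_gauss)
    have half: "exp (n * (ln (1 - v\<^sup>2) / 2 - \<zeta>)) \<le> 1/2 * exp (n * k)"
    proof -
      have "exp (n * (ln (1 - v\<^sup>2) / 2 - \<zeta>)) \<le> exp (n * (- \<zeta> / 2)) * exp (n * k)"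
        using mult_left_mono[OF k, of n] by (simp add: algebra_simps flip: exp_add)
      also have "\<dots> \<le> 1/2 * exp (n * k)"
        using elim by (intro mult_right_mono) auto
      finally show ?thesis .
    qed
    show ?case
    proof (intro allI impI)
      fix \<nu> and y :: "nat \<Rightarrow> real"
      assume \<nu>: "sphere_uniform n \<nu>" and y: "0 < sq_norm n y"
      note [measurable_cong] = sphere_uniformD(2)[OF \<nu>]
      interpret N: prob_space \<nu> by (rule sphere_uniformD[OF \<nu>])
      define l where "l = sqrt (sq_norm n y)"
      have l: "0 < l" using y by (simp add: l_def)
      define S where "S = ball (l * v) (l * e)"
      have S [measurable]: "S \<in> sets borel" by (simp add: S_def)
      have Seq: "{\<theta> \<in> space \<nu>. dot n y \<theta> \<in> S} = {\<theta> \<in> space \<nu>. \<bar>dot n y \<theta> - l * v\<bar> < l * e}"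
        by (auto simp: S_def dist_real_def)
      have bound: "ennreal (exp (n * (ln (1 - v\<^sup>2) / 2 - \<zeta>))) \<le> emeasure (gauss n) {g \<in> space (gauss n). sq_norm n g \<in> {0<..}
          \<and> l * dot n \<theta> g / sqrt (sq_norm n g) \<in> S}"
        if \<theta>: "sq_norm n \<theta> = 1" for \<theta>
      proof -
        have "ennreal (exp (n * (ln (1 - v\<^sup>2) / 2 - \<zeta>))) \<le> ennreal (1/2 * exp (n * k))"
          using half by (rule ennreal_leI)
        also have "\<dots> \<le> emeasure (gauss n) {g \<in> space (gauss n).
            \<bar>sq_norm n g / n - (v\<^sup>2 + s\<^sup>2)\<bar> < d \<and> \<bar>dot n \<theta> g / sqrt n - v\<bar> < d}"
          using elim \<theta> by blast
        also have "\<dots> \<le> emeasure (gauss n) {g \<in> space (gauss n). sq_norm n g \<in> {0<..}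
          \<and> l * dot n \<theta> g / sqrt (sq_norm n g) \<in> S}"
        proof (intro emeasure_mono subsetI)
          fix g assume g: "g \<in> {g \<in> space (gauss n).
            \<bar>sq_norm n g / n - (v\<^sup>2 + s\<^sup>2)\<bar> < d \<and> \<bar>dot n \<theta> g / sqrt n - v\<bar> < d}"
          define z where "z = (sq_norm n g / n, dot n \<theta> g / sqrt n)"
          have z: "\<bar>fst z - 1\<bar> < d" "\<bar>snd z - v\<bar> < d" using g s by (auto simp: z_def)
          have pos: "0 < sq_norm n g"
            using z(1) d(3) n by (smt (verit) fst_conv z_def divide_nonpos_nonneg field_sum_of_halves)
          have "dist z (1, v) \<le> \<bar>fst z - 1\<bar> + \<bar>snd z - v\<bar>"
            by (simp add: dist_prod_def dist_real_def sqrt_sum_squares_le_sum_abs split_beta)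
          also have "\<dots> < d0" using z d by linarith
          finally have "dist (snd z / sqrt (fst z)) v < e" by (rule d0')
          moreover have "snd z / sqrt (fst z) = dot n \<theta> g / sqrt (sq_norm n g)"
            using n pos by (simp add: z_def real_sqrt_divide)
          ultimately have "\<bar>dot n \<theta> g / sqrt (sq_norm n g) - v\<bar> < e" by (simp add: dist_real_def)
          then have "l * \<bar>dot n \<theta> g / sqrt (sq_norm n g) - v\<bar> < l * e" using l by simp
          then have "\<bar>l * (dot n \<theta> g / sqrt (sq_norm n g) - v)\<bar> < l * e" using l by (simp add: abs_mult)
          then have "l * dot n \<theta> g / sqrt (sq_norm n g) \<in> S"
            by (simp add: S_def dist_real_def abs_minus_commute algebra_simps)
          then show "g \<in> {g \<in> space (gauss n). sq_norm n g \<in> {0<..}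
            \<and> l * dot n \<theta> g / sqrt (sq_norm n g) \<in> S}" using pos g by simp
        qed measurable
        finally show ?thesis .
      qed
      have "ennreal (exp (n * (ln (1 - v\<^sup>2) / 2 - \<zeta>))) = (\<integral>\<^sup>+\<theta>. ennreal (exp (n * (ln (1 - v\<^sup>2) / 2 - \<zeta>))) \<partial>\<nu>)"
        by (simp add: N.emeasure_space_1)
      also have "\<dots> \<le> (\<integral>\<^sup>+\<theta>. emeasure (gauss n) {g \<in> space (gauss n). sq_norm n g \<in> {0<..}
          \<and> l * dot n \<theta> g / sqrt (sq_norm n g) \<in> S} \<partial>\<nu>)"
        by (rule nn_integral_mono_AE) (use sphere_uniformD(4)[OF \<nu>] in eventually_elim, rule bound)
      also have "\<dots> = emeasure \<nu> {\<theta> \<in> space \<nu>. dot n y \<theta> \<in> S} * emeasure (gauss n) {g \<in> space (gauss n). sq_norm n g \<in> {0<..}}"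
        unfolding l_def by (rule sphere_gauss_exchange[OF \<nu>, symmetric]) auto
      also have "\<dots> \<le> emeasure \<nu> {\<theta> \<in> space \<nu>. dot n y \<theta> \<in> S} * 1"
        by (intro mult_left_mono G.emeasure_le_1) simp
      finally show "ennreal (exp (n * (ln (1 - v\<^sup>2) / 2 - \<zeta>)))
        \<le> emeasure \<nu> {\<theta> \<in> space \<nu>. \<bar>dot n y \<theta> - sqrt (sq_norm n y) * v\<bar> < sqrt (sq_norm n y) * e}"
        by (simp add: Seq l_def)
    qed
  qed
qed


section \<open>Tilted powers on the ball\<close>

definition pow_sum :: "nat \<Rightarrow> real \<Rightarrow> (nat \<Rightarrow> real) \<Rightarrow> real" where
  "pow_sum n p x = (\<Sum>i=1..n. \<bar>x i\<bar> powr p)"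

lemma pow_sum_measurable [measurable]: "pow_sum n p \<in> borel_measurable (lborel_Rn n)"
  unfolding pow_sum_def[abs_def] by (rule sum_coord_measurable) measurable

text \<open>Integrating out z in \<Phi> leaves this weight in y, with
  \<open>a = t1\<^sup>2 / (2 * (1 - 2 * t0))\<close> and \<open>b = 1/p - t2\<close>. The density of
  \<open>\<mu> p\<close> is the normalised case a = 0, b = 1/p.\<close>

definition tilt :: "real \<Rightarrow> real \<Rightarrow> real \<Rightarrow> real \<Rightarrow> real" where
  "tilt p a b y = exp (a * y\<^sup>2 - b * \<bar>y\<bar> powr p)"

definition partition_fn :: "real \<Rightarrow> real \<Rightarrow> real \<Rightarrow> ennreal" where
  "partition_fn p a b = (\<integral>\<^sup>+y. ennreal (tilt p a b y) \<partial>lborel)"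

lemma tilt_pos [simp]: "0 < tilt p a b y" "0 \<le> tilt p a b y"
  by (simp_all add: tilt_def)

lemma tilt_measurable [measurable]: "tilt p a b \<in> borel_measurable borel"
  unfolding tilt_def[abs_def] by measurable

text \<open>The scaling law behind both the normalisation of the p-th moment and the reduction of
  the rate function to a single Legendre transform.\<close>

lemma partition_fn_scale:
  assumes "0 < r"
  shows "partition_fn p a b = ennreal r * partition_fn p (a * r\<^sup>2) (b * r powr p)"
proof -
  have "tilt p a b (0 + r * y) = tilt p (a * r\<^sup>2) (b * r powr p) y" for y
    using assms by (simp add: tilt_def abs_mult powr_mult power_mult_distrib mult_ac)
  then show ?thesis
    unfolding partition_fn_def using assms
    by (subst nn_integral_real_affine[where c = r and t = 0]) auto
qed

lemma partition_fn_pos: "0 < partition_fn p a b"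
proof -
  have "partition_fn p a b \<noteq> 0"
  proof
    assume "partition_fn p a b = 0"
    then have "emeasure lborel {y \<in> space lborel. ennreal (tilt p a b y) \<noteq> 0} = 0"
      unfolding partition_fn_def by (subst (asm) nn_integral_0_iff) auto
    moreover have "{y \<in> space lborel. ennreal (tilt p a b y) \<noteq> 0} = UNIV"
      using tilt_pos(1) by (auto simp: ennreal_eq_0_iff not_le)
    ultimately show False by simp
  qed
  then show ?thesis by (simp add: zero_less_iff_neq_zero)
qed

text \<open>Used in the contrapositive: where \<Phi> is finite, b is positive, and then an
  exponential in \<open>pow_sum\<close> can dominate the indicator of the ball.\<close>

lemma partition_fn_infinite:
  assumes "0 \<le> a" "b \<le> 0"
  shows "partition_fn p a b = \<infinity>"
proof -
  have "(\<integral>\<^sup>+y. 1 \<partial>(lborel :: real measure)) \<le> partition_fn p a b"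
    unfolding partition_fn_def
  proof (rule nn_integral_mono)
    fix y :: real
    have "b * \<bar>y\<bar> powr p \<le> 0" using assms by (simp add: mult_nonpos_nonneg)
    then have "0 \<le> a * y\<^sup>2 - b * \<bar>y\<bar> powr p" using assms by (smt (verit) mult_nonneg_nonneg zero_le_power2)
    then have "1 \<le> tilt p a b y" by (simp add: tilt_def)
    then show "1 \<le> ennreal (tilt p a b y)" by simp
  qed
  then show ?thesis by (simp add: top_unique)
qed

text \<open>A condition for finiteness that is open in (a, b). For p = 2 the weight is
  \<open>exp (- (b - a) * y\<^sup>2)\<close>, so the two parameters compete; for p > 2 the p-th
  power always wins.\<close>

definition admissible :: "real \<Rightarrow> real \<Rightarrow> real \<Rightarrow> bool" where
  "admissible p a b \<longleftrightarrow> 2 \<le> p \<and> 0 < b \<and> (p = 2 \<longrightarrow> a < b)"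

lemma admissible_bound:
  assumes "admissible p a b"
  obtains C c where "0 < c" "\<And>y. a * y\<^sup>2 - b * \<bar>y\<bar> powr p \<le> C - c * y\<^sup>2"
proof (cases "p = 2")
  case True
  then have "a * y\<^sup>2 - b * \<bar>y\<bar> powr p \<le> 0 - (b - a) * y\<^sup>2" for y
    by (cases "y = 0") (simp_all add: algebra_simps powr_numeral)
  then show ?thesis using that[of "b - a" 0] True assms by (simp add: admissible_def)
next
  case False
  then have p: "2 < p" and b: "0 < b" using assms by (auto simp: admissible_def)
  \<comment> \<open>Threshold beyond which \<open>b * \<bar>y\<bar> powr (p - 2)\<close> is at least
    \<open>\<bar>a\<bar> + 1\<close>, so that the p-th power beats the quadratic term with one y^2
    to spare; below it y^2 is bounded.\<close>
  define M where "M = (((\<bar>a\<bar> + 1) / b)) powr (1 / (p - 2))"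
  have Mp: "M powr (p - 2) = (\<bar>a\<bar> + 1) / b" using p b by (simp add: M_def powr_powr)
  have M: "0 < M" using b by (simp add: M_def)
  show ?thesis
  proof (rule that[of 1 "(\<bar>a\<bar> + 1) * M\<^sup>2"])
    fix y :: real
    have split: "\<bar>y\<bar> powr p = \<bar>y\<bar> powr (p - 2) * y\<^sup>2"
    proof (cases "y = 0")
      case False
      then have "\<bar>y\<bar> powr p = \<bar>y\<bar> powr (p - 2) * \<bar>y\<bar> powr 2" by (simp only: powr_add[symmetric], simp)
      then show ?thesis using False by (simp add: powr_numeral)
    qed simp
    have "(\<bar>a\<bar> + 1) * y\<^sup>2 \<le> (\<bar>a\<bar> + 1) * M\<^sup>2 + b * \<bar>y\<bar> powr p"
    proof (cases "\<bar>y\<bar> \<le> M")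
      case True
      then have "y\<^sup>2 \<le> M\<^sup>2" using M by (metis abs_le_square_iff abs_of_pos)
      then have "(\<bar>a\<bar> + 1) * y\<^sup>2 \<le> (\<bar>a\<bar> + 1) * M\<^sup>2" by (intro mult_left_mono) auto
      moreover have "0 \<le> b * \<bar>y\<bar> powr p" using b by simp
      ultimately show ?thesis by linarith
    next
      case False
      then have "M powr (p - 2) \<le> \<bar>y\<bar> powr (p - 2)" using M p by (intro powr_mono2) auto
      then have "(\<bar>a\<bar> + 1) / b * y\<^sup>2 \<le> \<bar>y\<bar> powr p" unfolding Mp split by (intro mult_right_mono) auto
      then have "b * ((\<bar>a\<bar> + 1) / b * y\<^sup>2) \<le> b * \<bar>y\<bar> powr p" using b by (intro mult_left_mono) auto
      moreover have "b * ((\<bar>a\<bar> + 1) / b * y\<^sup>2) = (\<bar>a\<bar> + 1) * y\<^sup>2" using b by simp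
      moreover have "0 \<le> (\<bar>a\<bar> + 1) * M\<^sup>2" by simp
      ultimately show ?thesis by linarith
    qed
    moreover have "a * y\<^sup>2 \<le> \<bar>a\<bar> * y\<^sup>2" by (intro mult_right_mono) auto
    ultimately show "a * y\<^sup>2 - b * \<bar>y\<bar> powr p \<le> (\<bar>a\<bar> + 1) * M\<^sup>2 - 1 * y\<^sup>2"
      by (simp add: algebra_simps)
  qed simp
qed

lemma admissible_finite:
  assumes "admissible p a b"
  shows "partition_fn p a b < \<infinity>"
proof -
  obtain C c where c: "0 < c" "\<And>y. a * y\<^sup>2 - b * \<bar>y\<bar> powr p \<le> C - c * y\<^sup>2"
    using admissible_bound[OF assms] by metis
  have "partition_fn p a b \<le> (\<integral>\<^sup>+y. ennreal (exp C) * ennreal (exp (0 * y - c * y\<^sup>2)) \<partial>lborel)"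
    unfolding partition_fn_def tilt_def
    using c(2) by (intro nn_integral_mono) (auto simp: ennreal_mult[symmetric] exp_add[symmetric] intro!: ennreal_leI)
  also have "\<dots> = ennreal (exp C) * ennreal (sqrt (pi / c) * exp (0\<^sup>2 / (4 * c)))"
    by (subst nn_integral_cmult) (simp_all only: nn_integral_gauss[OF c(1)], measurable)
  also have "\<dots> < \<infinity>" by (simp add: ennreal_mult_less_top)
  finally show ?thesis .
qed

lemma integrable_tilt:
  assumes "partition_fn p a b < \<infinity>"
  shows "integrable lborel (tilt p a b)"
  using assms by (intro integrableI_nonneg) (auto simp: partition_fn_def)

text \<open>Openness yields exponential moments of y^2 and \<open>\<bar>y\<bar> powr p\<close> under
  the weight, since multiplying by their exponentials only shifts a or b.\<close>

lemma admissible_slack: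
  assumes "admissible p a b"
  obtains e where "0 < e" "admissible p (a + e) b" "admissible p a (b - e)"
proof (cases "p = 2")
  case True
  then show ?thesis using that[of "min b (b - a) / 2"] assms by (auto simp: admissible_def min_def field_simps)
next
  case False
  then show ?thesis using that[of "b / 2"] assms by (auto simp: admissible_def)
qed

section \<open>Chernoff bounds on the line\<close>

lemma exp_le_quadratic: "exp x \<le> 1 + x + x\<^sup>2 * exp \<bar>x\<bar>" for x :: real
proof -
  have "exp x * (1 - x) \<le> exp x * exp (- x)"
    using exp_ge_add_one_self[of "- x"] by (intro mult_left_mono) auto
  then have 1: "exp x - 1 - x \<le> x * (exp x - 1)" by (simp add: algebra_simps flip: exp_add)
  have "x * (exp x - 1) \<le> x\<^sup>2 * exp \<bar>x\<bar>"
  proof (cases "0 \<le> x")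
    case True
    have "exp x - 1 \<le> x * exp x" using 1 by (simp add: algebra_simps)
    then have "x * (exp x - 1) \<le> x * (x * exp x)" using True by (rule mult_left_mono)
    then show ?thesis using True by (simp add: power2_eq_square mult.assoc)
  next
    case False
    have "(- x) * (1 - exp x) \<le> (- x) * (- x)"
      using exp_ge_add_one_self[of x] False by (intro mult_left_mono) linarith+
    moreover have "x\<^sup>2 * 1 \<le> x\<^sup>2 * exp \<bar>x\<bar>" by (intro mult_left_mono) auto
    ultimately show ?thesis by (simp add: power2_eq_square algebra_simps)
  qed
  with 1 show ?thesis by simp
qed

lemma abs_le_exp: "0 < e \<Longrightarrow> \<bar>x\<bar> \<le> exp (e * \<bar>x\<bar>) / e" for x e :: real
  using exp_ge_add_one_self[of "e * \<bar>x\<bar>"] by (simp add: pos_le_divide_eq mult.commute del: exp_ge_add_one_self)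

lemma sq_le_exp: "0 < e \<Longrightarrow> x\<^sup>2 \<le> 2 / e\<^sup>2 * exp (e * \<bar>x\<bar>)" for x e :: real
proof -
  assume "0 < e"
  have "(e * \<bar>x\<bar>)\<^sup>2 / 2 \<le> exp (e * \<bar>x\<bar>)"
    using exp_lower_Taylor_quadratic[of "e * \<bar>x\<bar>"] \<open>0 < e\<close> by (smt (verit) mult_nonneg_nonneg abs_ge_zero)
  then show ?thesis using \<open>0 < e\<close> by (simp add: field_simps power_mult_distrib)
qed

text \<open>A quadratic bound for exp with integrable remainder replaces differentiation of the
  Laplace transform: the linear term gains \<open>\<eta> * d * Z\<close>, the quadratic one costs
  order \<eta>^2. In a product measure the factor \<rho> < 1 is raised to the power n, which makes
  the tail vanish.\<close>

lemma chernoff_bound: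
  fixes F h :: "real \<Rightarrow> real"
  assumes F: "\<And>y. 0 \<le> F y" "integrable lborel F" "0 < Z" "(\<integral>y. F y \<partial>lborel) = Z"
    and h [measurable]: "h \<in> borel_measurable borel"
    and e: "0 < e" "integrable lborel (\<lambda>y. F y * exp (e * \<bar>h y\<bar>))"
    and m: "(\<integral>y. F y * h y \<partial>lborel) = m * Z" and d: "0 < d"
  shows "\<exists>\<eta>>0. \<exists>\<rho>. 0 < \<rho> \<and> \<rho> < 1 \<and>
     (\<integral>\<^sup>+y. ennreal (F y * exp (\<eta> * (h y - m - d))) \<partial>lborel) \<le> ennreal (\<rho> * Z)"
proof -
  have [measurable]: "F \<in> borel_measurable borel" using borel_measurable_integrable[OF F(2)] by simp
  have hF: "integrable lborel (\<lambda>y. F y * h y)"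
  proof (rule Bochner_Integration.integrable_bound)
    show "integrable lborel (\<lambda>y. F y * exp (e * \<bar>h y\<bar>) / e)" using e by simp
    show "AE y in lborel. norm (F y * h y) \<le> norm (F y * exp (e * \<bar>h y\<bar>) / e)"
      using abs_le_exp[OF e(1)] F(1) e(1)
      by (intro AE_I2) (auto simp: abs_mult times_divide_eq_right[symmetric] simp del: times_divide_eq_right intro!: mult_left_mono)
  qed measurable
  \<comment> \<open>Majorant of the remainder. With \<open>k = h y - m - d\<close>, half of the
    exponent e controls k^2, giving the constant 2 / (e/2)^2 = 8 / e^2; the other half controls
    \<open>exp \<bar>\<eta> * k\<bar>\<close>; then \<bar>k\<bar> is bounded by the triangle
    inequality.\<close>
  define G where "G = (\<lambda>y. 8 / e\<^sup>2 * exp (e * (\<bar>m\<bar> + d)) * (F y * exp (e * \<bar>h y\<bar>)))"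
  have G: "integrable lborel G" unfolding G_def using e by simp
  define B where "B = (\<integral>y. G y \<partial>lborel)"
  have G0: "0 \<le> G y" for y unfolding G_def using F(1) by simp
  have B: "0 \<le> B" unfolding B_def using G0 by (intro integral_nonneg_AE) auto
  \<comment> \<open>The first bound makes the majorant applicable, the second keeps
    \<open>\<rho> = 1 - \<eta> * d / 2\<close> positive, the third limits the quadratic cost to half
    of the linear gain. B may be 0, hence B + 1.\<close>
  define \<eta> where "\<eta> = min (min (e / 2) (1 / d)) (d * Z / (2 * (B + 1)))"
  have \<eta>: "0 < \<eta>" "\<eta> \<le> e / 2" "\<eta> \<le> 1 / d" "\<eta> \<le> d * Z / (2 * (B + 1))"
    unfolding \<eta>_def using e(1) d F(3) B by (simp_all only: min_le_iff_disj order_refl simp_thms) simp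
  have \<eta>B: "\<eta> * B \<le> d * Z / 2"
  proof -
    have "\<eta> * B \<le> \<eta> * (B + 1)" using \<eta> by simp
    also have "\<dots> \<le> d * Z / (2 * (B + 1)) * (B + 1)" using \<eta> B by (intro mult_right_mono) auto
    also have "\<dots> = d * Z / 2"
      using B by (subst times_divide_eq_left) (auto simp: divide_eq_eq algebra_simps)
    finally show ?thesis .
  qed
  have \<eta>d: "\<eta> * d \<le> 1" using \<eta>(3) d by (simp add: pos_le_divide_eq)
  have pw: "F y * exp (\<eta> * (h y - m - d)) \<le> F y + \<eta> * (F y * h y - (m + d) * F y) + \<eta>\<^sup>2 * G y" for y
  proof -
    define k where "k = h y - m - d"
    have "exp (\<eta> * k) \<le> 1 + \<eta> * k + (\<eta> * k)\<^sup>2 * exp \<bar>\<eta> * k\<bar>" by (rule exp_le_quadratic)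
    also have "(\<eta> * k)\<^sup>2 * exp \<bar>\<eta> * k\<bar> \<le> \<eta>\<^sup>2 * (8 / e\<^sup>2 * exp (e * (\<bar>m\<bar> + d)) * exp (e * \<bar>h y\<bar>))"
    proof -
      have "k\<^sup>2 \<le> 2 / (e / 2)\<^sup>2 * exp (e / 2 * \<bar>k\<bar>)" using sq_le_exp[of "e / 2" k] e by simp
      then have k2: "k\<^sup>2 \<le> 8 / e\<^sup>2 * exp (e / 2 * \<bar>k\<bar>)" by (simp add: power_divide)
      have "\<eta> * \<bar>k\<bar> \<le> e / 2 * \<bar>k\<bar>" using \<eta> by (intro mult_right_mono) auto
      then have "exp \<bar>\<eta> * k\<bar> \<le> exp (e / 2 * \<bar>k\<bar>)" using \<eta>(1) by (simp add: abs_mult)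
      with k2 have "k\<^sup>2 * exp \<bar>\<eta> * k\<bar> \<le> (8 / e\<^sup>2 * exp (e / 2 * \<bar>k\<bar>)) * exp (e / 2 * \<bar>k\<bar>)"
        by (intro mult_mono) auto
      also have "\<dots> = 8 / e\<^sup>2 * exp (e * \<bar>k\<bar>)" by (simp add: mult.assoc exp_add[symmetric])
      also have "\<dots> \<le> 8 / e\<^sup>2 * exp (e * ((\<bar>m\<bar> + d) + \<bar>h y\<bar>))"
        using e d by (intro mult_left_mono) (auto simp: k_def)
      also have "\<dots> = 8 / e\<^sup>2 * exp (e * (\<bar>m\<bar> + d)) * exp (e * \<bar>h y\<bar>)" by (simp add: distrib_left exp_add)
      finally have "\<eta>\<^sup>2 * (k\<^sup>2 * exp \<bar>\<eta> * k\<bar>) \<le> \<eta>\<^sup>2 * (8 / e\<^sup>2 * exp (e * (\<bar>m\<bar> + d)) * exp (e * \<bar>h y\<bar>))"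
        by (intro mult_left_mono) auto
      then show ?thesis by (simp add: power_mult_distrib mult.assoc)
    qed
    finally have "exp (\<eta> * k) \<le> 1 + \<eta> * k + \<eta>\<^sup>2 * (8 / e\<^sup>2 * exp (e * (\<bar>m\<bar> + d)) * exp (e * \<bar>h y\<bar>))" by simp
    from mult_left_mono[OF this F(1)[of y]] show ?thesis
      unfolding k_def[symmetric] G_def by (simp add: k_def algebra_simps)
  qed
  define H where "H = (\<lambda>y. F y + \<eta> * (F y * h y - (m + d) * F y) + \<eta>\<^sup>2 * G y)"
  have Hi: "integrable lborel H" unfolding H_def using F hF G by simp
  have H0: "0 \<le> H y" for y using pw[of y] F(1)[of y] unfolding H_def by (smt (verit) exp_ge_zero mult_nonneg_nonneg)
  have "(\<integral>y. H y \<partial>lborel) = Z + \<eta> * (m * Z - (m + d) * Z) + \<eta>\<^sup>2 * B"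
    unfolding H_def B_def using F hF G m by simp
  also have "\<dots> = Z * (1 - \<eta> * d) + \<eta> * (\<eta> * B)" by (simp add: algebra_simps power2_eq_square)
  also have "\<dots> \<le> Z * (1 - \<eta> * d) + \<eta> * (d * Z / 2)" using \<eta>B \<eta> by (intro add_left_mono mult_left_mono) auto
  also have "\<dots> = (1 - \<eta> * d / 2) * Z" by (simp add: algebra_simps)
  finally have le: "(\<integral>y. H y \<partial>lborel) \<le> (1 - \<eta> * d / 2) * Z" .
  have "(\<integral>\<^sup>+y. ennreal (F y * exp (\<eta> * (h y - m - d))) \<partial>lborel) \<le> (\<integral>\<^sup>+y. ennreal (H y) \<partial>lborel)"
    using pw by (intro nn_integral_mono) (auto simp: H_def intro!: ennreal_leI)
  also have "\<dots> = ennreal (\<integral>y. H y \<partial>lborel)" using Hi H0 by (intro nn_integral_eq_integral) auto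
  also have "\<dots> \<le> ennreal ((1 - \<eta> * d / 2) * Z)" using le by (rule ennreal_leI)
  finally show ?thesis
    using \<eta> d \<eta>d by (intro exI[of _ \<eta>] conjI exI[of _ "1 - \<eta> * d / 2"]) (auto simp: mult_pos_pos)
qed


section \<open>Means of the tilted density\<close>

definition pfun :: "real \<Rightarrow> real \<Rightarrow> real \<Rightarrow> real" where
  "pfun p a b = (\<integral>y. tilt p a b y \<partial>lborel)"

definition mean_sq :: "real \<Rightarrow> real \<Rightarrow> real \<Rightarrow> real" where
  "mean_sq p a b = (\<integral>y. tilt p a b y * y\<^sup>2 \<partial>lborel) / pfun p a b"

definition mean_pow :: "real \<Rightarrow> real \<Rightarrow> real \<Rightarrow> real" where
  "mean_pow p a b = (\<integral>y. tilt p a b y * \<bar>y\<bar> powr p \<partial>lborel) / pfun p a b"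

lemma partition_fn_eq_pfun:
  assumes "partition_fn p a b < \<infinity>"
  shows "partition_fn p a b = ennreal (pfun p a b)"
  unfolding partition_fn_def pfun_def
  using integrable_tilt[OF assms] by (intro nn_integral_eq_integral) auto

lemma pfun_pos:
  assumes "partition_fn p a b < \<infinity>"
  shows "0 < pfun p a b"
  using partition_fn_pos[of p a b] unfolding partition_fn_eq_pfun[OF assms] by simp

lemma integrable_tilt_moments:
  assumes "admissible p a b"
  shows "integrable lborel (\<lambda>y. tilt p a b y * y\<^sup>2)"
    and "integrable lborel (\<lambda>y. tilt p a b y * \<bar>y\<bar> powr p)"
proof -
  obtain e where e: "0 < e" "admissible p (a + e) b" "admissible p a (b - e)"
    using admissible_slack[OF assms] .
  have le: "x \<le> exp (e * x) / e" if "0 \<le> x" for x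
    using abs_le_exp[OF e(1), of x] that by simp
  show "integrable lborel (\<lambda>y. tilt p a b y * y\<^sup>2)"
  proof (rule Bochner_Integration.integrable_bound)
    show "integrable lborel (\<lambda>y. tilt p (a + e) b y / e)"
      using integrable_tilt[OF admissible_finite[OF e(2)]] by simp
    have "tilt p a b y * y\<^sup>2 \<le> tilt p (a + e) b y / e" for y
    proof -
      have "tilt p a b y * y\<^sup>2 \<le> tilt p a b y * (exp (e * y\<^sup>2) / e)" by (intro mult_left_mono le) auto
      also have "\<dots> = tilt p (a + e) b y / e" by (simp add: tilt_def exp_add[symmetric] algebra_simps)
      finally show ?thesis .
    qed
    then show "AE y in lborel. norm (tilt p a b y * y\<^sup>2) \<le> norm (tilt p (a + e) b y / e)"
      using e(1) by (intro AE_I2) simp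
  qed measurable
  show "integrable lborel (\<lambda>y. tilt p a b y * \<bar>y\<bar> powr p)"
  proof (rule Bochner_Integration.integrable_bound)
    show "integrable lborel (\<lambda>y. tilt p a (b - e) y / e)"
      using integrable_tilt[OF admissible_finite[OF e(3)]] by simp
    have "tilt p a b y * \<bar>y\<bar> powr p \<le> tilt p a (b - e) y / e" for y
    proof -
      have "tilt p a b y * \<bar>y\<bar> powr p \<le> tilt p a b y * (exp (e * \<bar>y\<bar> powr p) / e)" by (intro mult_left_mono le) auto
      also have "\<dots> = tilt p a (b - e) y / e" by (simp add: tilt_def exp_add[symmetric] algebra_simps)
      finally show ?thesis .
    qed
    then show "AE y in lborel. norm (tilt p a b y * \<bar>y\<bar> powr p) \<le> norm (tilt p a (b - e) y / e)"
      using e(1) by (intro AE_I2) simp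
  qed measurable
qed

lemma mean_eqs:
  assumes "admissible p a b"
  shows "(\<integral>y. tilt p a b y * y\<^sup>2 \<partial>lborel) = mean_sq p a b * pfun p a b"
    and "(\<integral>y. tilt p a b y * \<bar>y\<bar> powr p \<partial>lborel) = mean_pow p a b * pfun p a b"
  using pfun_pos[OF admissible_finite[OF assms]] by (simp_all add: mean_sq_def mean_pow_def)

lemma nn_integral_scaled:
  assumes [measurable]: "f \<in> borel_measurable borel" and c: "0 < c"
  shows "(\<integral>\<^sup>+y. f (c * y) \<partial>lborel) = ennreal (1 / c) * (\<integral>\<^sup>+y. f y \<partial>lborel)"
proof -
  have "(\<integral>\<^sup>+y. f y \<partial>lborel) = ennreal \<bar>c\<bar> * (\<integral>\<^sup>+y. f (0 + c * y) \<partial>lborel)"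
    using c by (intro nn_integral_real_affine) auto
  then have "ennreal (1 / c) * (\<integral>\<^sup>+y. f y \<partial>lborel) = ennreal (1 / c) * ennreal c * (\<integral>\<^sup>+y. f (c * y) \<partial>lborel)"
    using c by (simp add: mult.assoc)
  then show ?thesis using c by (simp flip: ennreal_mult)
qed

lemma sum_sq_scaled:
  assumes "1 \<le> n"
  shows "(\<Sum>i=1..n. (real n powr (1/p) * x i)\<^sup>2) = n powr (2/p) * sq_norm n x"
proof -
  have "(real n powr (1/p))\<^sup>2 = n powr (2/p)" using assms by (simp add: powr_power)
  then show ?thesis by (simp add: sq_norm_def power_mult_distrib sum_distrib_left)
qed

lemma sum_pow_scaled:
  assumes "1 \<le> n" "p \<noteq> 0"
  shows "(\<Sum>i=1..n. \<bar>real n powr (1/p) * x i\<bar> powr p) = n * pow_sum n p x"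
proof -
  have "\<bar>real n powr (1/p) * x i\<bar> powr p = n * \<bar>x i\<bar> powr p" for i
    using assms by (simp add: abs_mult powr_mult powr_powr)
  then show ?thesis by (simp add: pow_sum_def sum_distrib_left)
qed

text \<open>The coordinates are scaled by \<open>n\<^bsup>1/p\<^esup>\<close>, which maps the unit ball to \<open>{y. \<Sum>\<bar>y\<^sub>i\<bar>\<^bsup>p\<^esup> \<le> n}\<close>.\<close>

lemma nn_integral_tilt_n:
  assumes "1 \<le> n" "p \<noteq> 0"
  shows "(\<integral>\<^sup>+x. ennreal (exp (a * (n powr (2/p) * sq_norm n x) - b * (n * pow_sum n p x))) \<partial>lborel_Rn n)
     = (ennreal (n powr (-1/p)) * partition_fn p a b) ^ n"
proof -
  define c where "c = real n powr (1/p)"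
  have c: "0 < c" using assms by (simp add: c_def)
  have "a * (n powr (2/p) * sq_norm n x) - b * (n * pow_sum n p x) = (\<Sum>i=1..n. ln (tilt p a b (c * x i)))" for x
    unfolding sum_sq_scaled[OF assms(1), symmetric] sum_pow_scaled[OF assms, symmetric] c_def
    by (simp add: tilt_def sum_subtractf sum_distrib_left)
  then have "(\<integral>\<^sup>+x. ennreal (exp (a * (n powr (2/p) * sq_norm n x) - b * (n * pow_sum n p x))) \<partial>lborel_Rn n)
     = (\<integral>\<^sup>+x. ennreal (exp (\<Sum>i=1..n. ln (tilt p a b (c * x i)))) \<partial>lborel_Rn n)"
    by (simp only:)
  also have "\<dots> = (\<Prod>i=1..n. \<integral>\<^sup>+y. ennreal (exp (ln (tilt p a b (c * y)))) \<partial>lborel)"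
    by (rule nn_integral_exp_sum) measurable
  also have "\<dots> = (\<integral>\<^sup>+y. ennreal (tilt p a b (c * y)) \<partial>lborel) ^ n" by simp
  also have "(\<integral>\<^sup>+y. ennreal (tilt p a b (c * y)) \<partial>lborel) = ennreal (1 / c) * partition_fn p a b"
    unfolding partition_fn_def using c by (intro nn_integral_scaled) measurable
  also have "1 / c = n powr (-1/p)" by (simp add: c_def powr_minus_divide)
  finally show ?thesis .
qed

text \<open>A change of measure as in the Gaussian case, now to independent coordinates
  \<open>n powr (1/p) * x i\<close> with density proportional to the tilt;
  \<open>(n powr (-1/p)) ^ n\<close> is the Jacobian. The result is the volume of the typical
  points: exp of n times the entropy \<open>ln Z - a * s + b * m\<close> of the tilted density, up
  to the error in d.\<close>

lemma tilt_band_lower: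
  assumes adm: "admissible p a b" and a: "0 \<le> a" and d: "0 < d"
  shows "eventually (\<lambda>n. ennreal (1/2 * (n powr (-1/p)) ^ n *
      exp (n * (ln (pfun p a b) - a * mean_sq p a b + b * mean_pow p a b - d * (a + b))))
    \<le> emeasure (lborel_Rn n) {x \<in> space (lborel_Rn n).
        \<bar>n powr (2/p) * sq_norm n x / n - mean_sq p a b\<bar> < d \<and> \<bar>pow_sum n p x - mean_pow p a b\<bar> < d}) sequentially"
proof -
  have p: "2 \<le> p" and b: "0 < b" using adm by (auto simp: admissible_def)
  define Z where "Z = pfun p a b"
  have Zp: "partition_fn p a b = ennreal Z" "0 < Z" "integrable lborel (tilt p a b)"
    using admissible_finite[OF adm] by (auto simp: Z_def partition_fn_eq_pfun pfun_pos integrable_tilt)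
  obtain e where e: "0 < e" "admissible p (a + e) b" "admissible p a (b - e)"
    using admissible_slack[OF adm] .
  have "tilt p a b y * exp (e * \<bar>y\<^sup>2\<bar>) = tilt p (a + e) b y"
    "tilt p a b y * exp (e * \<bar>\<bar>y\<bar> powr p\<bar>) = tilt p a (b - e) y" for y
    by (simp_all add: tilt_def exp_add[symmetric] algebra_simps)
  then have sq_int: "integrable lborel (\<lambda>y. tilt p a b y * exp (e * \<bar>y\<^sup>2\<bar>))"
    and pw_int: "integrable lborel (\<lambda>y. tilt p a b y * exp (e * \<bar>\<bar>y\<bar> powr p\<bar>))"
    using integrable_tilt[OF admissible_finite[OF e(2)]] integrable_tilt[OF admissible_finite[OF e(3)]]
    by (simp_all only:)
  let ?s = "mean_sq p a b" and ?m = "mean_pow p a b"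
  have chern: "\<exists>\<eta>>0. \<exists>\<rho>. 0 < \<rho> \<and> \<rho> < 1 \<and>
     (\<integral>\<^sup>+y. ennreal (tilt p a b y * exp (\<eta> * (h y - m - d))) \<partial>lborel) \<le> ennreal (\<rho> * Z)"
    if "h \<in> borel_measurable borel" "integrable lborel (\<lambda>y. tilt p a b y * exp (e * \<bar>h y\<bar>))"
      "(\<integral>y. tilt p a b y * h y \<partial>lborel) = m * Z" for h :: "real \<Rightarrow> real" and m
    using that by (intro chernoff_bound[where e = e] Zp e d) (auto simp: Z_def pfun_def)
  \<comment> \<open>The upper tail, beyond m + d per coordinate, of an additive statistic with
    summand h and mean m. Taking both h and m with either sign covers the four sides of the
    band.\<close>
  define small where "small = (\<lambda>n h m. n \<ge> 1 \<and>
      emeasure (density (lborel_Rn n) (\<lambda>x. ennreal (exp (a * (n powr (2/p) * sq_norm n x) - b * (n * pow_sum n p x)) * (n powr (1/p) / Z) ^ n)))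
       {x \<in> space (lborel_Rn n). n * (m + d) \<le> (\<Sum>i=1..n. h (n powr (1/p) * x i))} \<le> ennreal (1/8))"
  have tail: "eventually (\<lambda>n. small n h m) sequentially"
    if h [measurable]: "h \<in> borel_measurable borel" and hi: "integrable lborel (\<lambda>y. tilt p a b y * exp (e * \<bar>h y\<bar>))"
      "(\<integral>y. tilt p a b y * h y \<partial>lborel) = m * Z" for h :: "real \<Rightarrow> real" and m
  proof -
    obtain \<eta> \<rho> where \<eta>: "0 < \<eta>" and \<rho>: "0 < \<rho>" "\<rho> < 1"
      and le: "(\<integral>\<^sup>+y. ennreal (tilt p a b y * exp (\<eta> * (h y - m - d))) \<partial>lborel) \<le> ennreal (\<rho> * Z)"
      using chern[OF h hi] by blast
    have "eventually (\<lambda>n. n \<ge> 1 \<and> exp (real n * ln \<rho>) \<le> 1/8) sequentially"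
      using \<rho> by (intro eventually_conj eventually_exp_mult_le eventually_ge_at_top) auto
    then show ?thesis
    proof eventually_elim
      case (elim n)
      define c where "c = real n powr (1/p)"
      have c: "0 < c" using elim by (simp add: c_def)
      have c2: "c\<^sup>2 = n powr (2/p)" using elim by (simp add: c_def powr_power)
      have cp: "c powr p = n" using elim p by (simp add: c_def powr_powr)
      let ?q = "\<lambda>x. exp (a * (n powr (2/p) * sq_norm n x) - b * (n * pow_sum n p x)) * (n powr (1/p) / Z) ^ n"
      let ?Q = "density (lborel_Rn n) (\<lambda>x. ennreal (?q x))"
      define f where "f = (\<lambda>x. \<Sum>i=1..n. h (n powr (1/p) * x i))"
      have [measurable]: "f \<in> borel_measurable (lborel_Rn n)"
        unfolding f_def by (rule sum_coord_measurable) measurable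
      have eq: "?q x * exp (\<eta> * f x - \<eta> * (n * (m + d)))
          = (c / Z) ^ n * exp (\<Sum>i=1..n. ln (tilt p a b (c * x i) * exp (\<eta> * (h (c * x i) - m - d))))" for x
      proof -
        have "ln (tilt p a b y * exp (\<eta> * (h y - m - d))) = a * y\<^sup>2 - b * \<bar>y\<bar> powr p + \<eta> * h y - \<eta> * (m + d)" for y
          by (simp add: tilt_def exp_add[symmetric] algebra_simps)
        then have "(\<Sum>i=1..n. ln (tilt p a b (c * x i) * exp (\<eta> * (h (c * x i) - m - d))))
          = (a * (c\<^sup>2 * sq_norm n x) - b * (c powr p * pow_sum n p x)) + (\<eta> * f x - \<eta> * (n * (m + d)))"
          using c by (simp add: sq_norm_def pow_sum_def f_def c_def[symmetric] sum.distrib sum_subtractf sum_distrib_left power_mult_distrib abs_mult powr_mult mult_ac)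
        then show ?thesis
          unfolding c2 cp by (simp add: exp_add c_def mult_ac)
      qed
      have "emeasure ?Q {x \<in> space (lborel_Rn n). n * (m + d) \<le> f x}
          = emeasure ?Q {x \<in> space ?Q. \<eta> * (n * (m + d)) \<le> \<eta> * f x}"
        using \<eta> by simp
      also have "\<dots> \<le> (\<integral>\<^sup>+x. ennreal (exp (\<eta> * f x - \<eta> * (n * (m + d)))) \<partial>?Q)"
        by (rule emeasure_le_exp) measurable
      also have "\<dots> = (\<integral>\<^sup>+x. ennreal (?q x * exp (\<eta> * f x - \<eta> * (n * (m + d)))) \<partial>lborel_Rn n)"
        using Zp by (subst nn_integral_density) (auto simp: ennreal_mult'' intro!: nn_integral_cong)
      also have "\<dots> = (\<integral>\<^sup>+x. ennreal ((c / Z) ^ n) * ennreal (exp (\<Sum>i=1..n. ln (tilt p a b (c * x i) * exp (\<eta> * (h (c * x i) - m - d))))) \<partial>lborel_Rn n)"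
        unfolding eq using c Zp by (intro nn_integral_cong ennreal_mult) auto
      also have "\<dots> = ennreal ((c / Z) ^ n) * (\<integral>\<^sup>+x. ennreal (exp (\<Sum>i=1..n. ln (tilt p a b (c * x i) * exp (\<eta> * (h (c * x i) - m - d))))) \<partial>lborel_Rn n)"
        by (rule nn_integral_cmult) (intro measurable_compose[OF _ measurable_ennreal] measurable_compose[OF sum_coord_measurable borel_measurable_exp], measurable)
      also have "(\<integral>\<^sup>+x. ennreal (exp (\<Sum>i=1..n. ln (tilt p a b (c * x i) * exp (\<eta> * (h (c * x i) - m - d))))) \<partial>lborel_Rn n)
          = (\<Prod>i=1..n. \<integral>\<^sup>+y. ennreal (exp (ln (tilt p a b (c * y) * exp (\<eta> * (h (c * y) - m - d))))) \<partial>lborel)"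
        by (rule nn_integral_exp_sum) measurable
      also have "\<dots> = (\<integral>\<^sup>+y. ennreal (tilt p a b (c * y) * exp (\<eta> * (h (c * y) - m - d))) \<partial>lborel) ^ n"
        by simp
      also have "(\<integral>\<^sup>+y. ennreal (tilt p a b (c * y) * exp (\<eta> * (h (c * y) - m - d))) \<partial>lborel)
          = ennreal (1 / c) * (\<integral>\<^sup>+y. ennreal (tilt p a b y * exp (\<eta> * (h y - m - d))) \<partial>lborel)"
        using c by (intro nn_integral_scaled) measurable
      also have "ennreal ((c / Z) ^ n) * (ennreal (1 / c) * (\<integral>\<^sup>+y. ennreal (tilt p a b y * exp (\<eta> * (h y - m - d))) \<partial>lborel)) ^ n
          \<le> ennreal ((c / Z) ^ n) * (ennreal (1 / c) * ennreal (\<rho> * Z)) ^ n"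
        by (intro mult_left_mono power_mono le) auto
      also have "\<dots> = ennreal (\<rho> ^ n)"
        using c Zp \<rho> by (simp add: ennreal_power power_divide power_mult_distrib flip: ennreal_mult)
      also have "\<rho> ^ n = exp (n * ln \<rho>)" using \<rho> by (simp add: exp_of_nat_mult)
      also have "ennreal (exp (n * ln \<rho>)) \<le> ennreal (1/8)" using elim by (intro ennreal_leI) auto
      finally show ?case using elim by (simp add: f_def small_def)
    qed
  qed
  have m1: "(\<integral>y. tilt p a b y * y\<^sup>2 \<partial>lborel) = ?s * Z" "(\<integral>y. tilt p a b y * \<bar>y\<bar> powr p \<partial>lborel) = ?m * Z"
    using mean_eqs[OF adm] by (simp_all add: Z_def)
  have "eventually (\<lambda>n. small n (\<lambda>y. y\<^sup>2) ?s \<and> small n (\<lambda>y. - y\<^sup>2) (- ?s)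
      \<and> small n (\<lambda>y. \<bar>y\<bar> powr p) ?m \<and> small n (\<lambda>y. - (\<bar>y\<bar> powr p)) (- ?m)) sequentially"
    using m1 sq_int pw_int by (intro eventually_conj tail) simp_all
  then show ?thesis
  proof eventually_elim
    case (elim n)
    then have n: "1 \<le> real n" by (simp add: small_def)
    define c where "c = real n powr (1/p)"
    have c: "0 < c" using n by (simp add: c_def)
    define q where "q = (\<lambda>x. exp (a * (n powr (2/p) * sq_norm n x) - b * (n * pow_sum n p x)) * (n powr (1/p) / Z) ^ n)"
    have [measurable]: "q \<in> borel_measurable (lborel_Rn n)" unfolding q_def by measurable
    define Q where "Q = density (lborel_Rn n) (\<lambda>x. ennreal (q x))"
    have [measurable_cong]: "sets Q = sets (lborel_Rn n)" by (simp add: Q_def)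
    have sp: "space Q = space (lborel_Rn n)" by (simp add: Q_def)
    interpret Q: prob_space Q
    proof
      have "emeasure Q (space Q) = (\<integral>\<^sup>+x. ennreal (q x) \<partial>lborel_Rn n)"
        unfolding Q_def by (subst emeasure_density) (auto intro!: nn_integral_cong)
      also have "\<dots> = (\<integral>\<^sup>+x. ennreal (exp (a * (n powr (2/p) * sq_norm n x) - b * (n * pow_sum n p x))) * ennreal ((c / Z) ^ n) \<partial>lborel_Rn n)"
        unfolding q_def c_def[symmetric] using c Zp by (intro nn_integral_cong ennreal_mult) auto
      also have "\<dots> = (ennreal (1 / c) * ennreal Z) ^ n * ennreal ((c / Z) ^ n)"
        using n p by (subst nn_integral_multc) (auto simp: nn_integral_tilt_n Zp c_def powr_minus_divide)
      also have "\<dots> = 1"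
        using c Zp by (simp add: ennreal_power power_divide power_mult_distrib flip: ennreal_mult)
      finally show "emeasure Q (space Q) = 1" .
    qed
    have sq: "(\<Sum>i=1..n. (n powr (1/p) * x i)\<^sup>2) = n powr (2/p) * sq_norm n x" for x
      using n by (intro sum_sq_scaled) simp
    have pw: "(\<Sum>i=1..n. \<bar>n powr (1/p) * x i\<bar> powr p) = n * pow_sum n p x" for x
      using n p by (intro sum_pow_scaled) simp_all
    have "ennreal (1/2) \<le> emeasure Q {x \<in> space Q. \<bar>n powr (2/p) * sq_norm n x / n - ?s\<bar> < d \<and> \<bar>pow_sum n p x - ?m\<bar> < d}"
    proof (rule Q.prob_band_ge)
      have *: "?s + d \<le> n powr (2/p) * sq_norm n x / n \<longleftrightarrow> n * (?s + d) \<le> n powr (2/p) * sq_norm n x"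
        "- ?s + d \<le> - (n powr (2/p) * sq_norm n x / n) \<longleftrightarrow> n * (- ?s + d) \<le> - (n powr (2/p) * sq_norm n x)"
        "?m + d \<le> pow_sum n p x \<longleftrightarrow> n * (?m + d) \<le> n * pow_sum n p x"
        "- ?m + d \<le> - pow_sum n p x \<longleftrightarrow> n * (- ?m + d) \<le> - (n * pow_sum n p x)" for x
      proof -
        have "A \<le> B / n \<longleftrightarrow> n * A \<le> B" for A B :: real
          using n by (simp add: pos_le_divide_eq mult.commute)
        moreover have "A \<le> B \<longleftrightarrow> n * A \<le> n * B" for A B :: real using n by simp
        ultimately show "?s + d \<le> n powr (2/p) * sq_norm n x / n \<longleftrightarrow> n * (?s + d) \<le> n powr (2/p) * sq_norm n x"
          "- ?s + d \<le> - (n powr (2/p) * sq_norm n x / n) \<longleftrightarrow> n * (- ?s + d) \<le> - (n powr (2/p) * sq_norm n x)"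
          "?m + d \<le> pow_sum n p x \<longleftrightarrow> n * (?m + d) \<le> n * pow_sum n p x"
          "- ?m + d \<le> - pow_sum n p x \<longleftrightarrow> n * (- ?m + d) \<le> - (n * pow_sum n p x)"
          by (metis minus_divide_left mult_minus_right)+
      qed
      show "emeasure Q {x \<in> space Q. ?s + d \<le> n powr (2/p) * sq_norm n x / n} \<le> ennreal (1/8)"
        using elim unfolding *(1) sp by (simp add: small_def sq[simplified] Q_def q_def)
      show "emeasure Q {x \<in> space Q. - ?s + d \<le> - (n powr (2/p) * sq_norm n x / n)} \<le> ennreal (1/8)"
        using elim unfolding *(2) sp by (simp add: small_def sq[simplified] Q_def q_def sum_negf)
      show "emeasure Q {x \<in> space Q. ?m + d \<le> pow_sum n p x} \<le> ennreal (1/8)"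
        unfolding *(3) sp using elim unfolding small_def pw Q_def q_def by blast
      show "emeasure Q {x \<in> space Q. - ?m + d \<le> - pow_sum n p x} \<le> ennreal (1/8)"
        using elim unfolding *(4) sp by (simp add: small_def pw[simplified] Q_def q_def sum_negf)
    qed measurable
    then have half: "ennreal (1/2) \<le> emeasure Q {x \<in> space (lborel_Rn n). \<bar>n powr (2/p) * sq_norm n x / n - ?s\<bar> < d \<and> \<bar>pow_sum n p x - ?m\<bar> < d}"
      by (simp add: sp)
    let ?E = "{x \<in> space (lborel_Rn n). \<bar>n powr (2/p) * sq_norm n x / n - ?s\<bar> < d \<and> \<bar>pow_sum n p x - ?m\<bar> < d}"
    define k where "k = - a * ?s + b * ?m - d * (a + b)"
    define K where "K = (Z / c) ^ n * exp (n * k)"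
    have K: "0 < K" using Zp c by (simp add: K_def)
    \<comment> \<open>Because \<open>0 \<le> a\<close> and \<open>0 < b\<close>, an upper bound on
      the squared norm and a lower bound on the power sum suffice to bound the density of Q on the
      band by \<open>1 / K\<close>.\<close>
    have Kq: "K * q x \<le> 1" if "x \<in> ?E" for x
    proof -
      define u where "u = n powr (2/p) * sq_norm n x / n"
      define v where "v = pow_sum n p x"
      have uv: "u \<le> ?s + d" "?m - d \<le> v" using that by (auto simp: u_def v_def)
      have "a * u \<le> a * (?s + d)" using uv a by (intro mult_left_mono) auto
      moreover have "b * (?m - d) \<le> b * v" using uv b by (intro mult_left_mono) auto
      ultimately have "k + (a * u - b * v) \<le> 0" by (simp add: k_def algebra_simps)
      then have "n * (k + (a * u - b * v)) \<le> 0" using n by (simp add: mult_nonneg_nonpos)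
      moreover have "n powr (2/p) * sq_norm n x = n * u" using n by (simp add: u_def)
      ultimately have "exp (n * k) * exp (a * (n powr (2/p) * sq_norm n x) - b * (n * pow_sum n p x)) \<le> 1"
        unfolding v_def[symmetric] by (simp add: exp_add[symmetric] algebra_simps)
      moreover have "(Z / c) ^ n * (c / Z) ^ n = 1" using Zp c by (simp add: power_mult_distrib[symmetric])
      moreover have "K * q x = (exp (n * k) * exp (a * (n powr (2/p) * sq_norm n x) - b * (n * pow_sum n p x))) * ((Z / c) ^ n * (c / Z) ^ n)"
        by (simp add: K_def q_def c_def)
      ultimately show ?thesis by simp
    qed
    have "ennreal (1/2 * K) = ennreal K * ennreal (1/2)"
      unfolding mult.commute[of "1/2 :: real"] using K by (intro ennreal_mult) auto
    also have "\<dots> \<le> ennreal K * emeasure Q ?E" using half by (intro mult_left_mono) auto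
    also have "\<dots> = (\<integral>\<^sup>+x. ennreal K * (ennreal (q x) * indicator ?E x) \<partial>lborel_Rn n)"
      unfolding Q_def by (subst emeasure_density, measurable) (simp add: nn_integral_cmult)
    also have "\<dots> \<le> (\<integral>\<^sup>+x. indicator ?E x \<partial>lborel_Rn n)"
    proof (rule nn_integral_mono)
      fix x
      show "ennreal K * (ennreal (q x) * indicator ?E x) \<le> indicator ?E x"
      proof (cases "x \<in> ?E")
        case True
        have "ennreal K * ennreal (q x) = ennreal (K * q x)" using K by (intro ennreal_mult[symmetric]) (auto simp: q_def Zp less_imp_le)
        also have "\<dots> \<le> 1" using Kq[OF True] by simp
        finally show ?thesis using True by simp
      qed simp
    qed
    also have "\<dots> = emeasure (lborel_Rn n) ?E" by (rule nn_integral_indicator) measurable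
    also have "1/2 * K = 1/2 * (n powr (-1/p)) ^ n * exp (n * (ln Z - a * ?s + b * ?m - d * (a + b)))"
    proof -
      have "(Z / c) ^ n = (n powr (-1/p)) ^ n * exp (n * ln Z)"
        using Zp by (simp add: c_def powr_minus_divide power_divide exp_of_nat_mult)
      moreover have "exp (n * ln Z) * exp (n * k) = exp (n * (ln Z - a * ?s + b * ?m - d * (a + b)))"
        by (simp add: k_def exp_add[symmetric] algebra_simps)
      ultimately show ?thesis by (simp add: K_def)
    qed
    finally show ?case by (simp add: Z_def)
  qed
qed


section \<open>Volumes and shells of the ball\<close>

text \<open>Layer cake: \<open>exp (- t)\<close> is the integral of \<open>exp (- u)\<close> over u
  \<ge> t. After exchanging the integrals, the inner one is the length
  \<open>2 * (p * u) powr (1 / p)\<close> times \<open>exp (- u)\<close>, and a Gamma integral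
  remains. This ties the closed constant in \<open>f_density\<close> to the partition
  function.\<close>

lemma partition_fn_normalization:
  assumes p: "0 < p"
  shows "partition_fn p 0 (1 / p) = ennreal (2 * p powr (1 / p) * Gamma (1 + 1 / p))"
proof -
  define f :: "real \<times> real \<Rightarrow> ennreal"
    where "f = (\<lambda>(y, u). indicator {(y, u). \<bar>y\<bar> powr p / p \<le> u} (y, u) * ennreal (exp (- u)))"
  have [measurable]: "f \<in> borel_measurable (lborel \<Otimes>\<^sub>M lborel)"
    unfolding f_def split_beta by measurable
  have outer: "(\<integral>\<^sup>+u. f (y, u) \<partial>lborel) = ennreal (tilt p 0 (1 / p) y)" for y
  proof -
    define t where "t = \<bar>y\<bar> powr p / p"
    have lim: "((\<lambda>u::real. - exp (- u)) \<longlongrightarrow> - 0) at_top"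
      by (intro tendsto_minus filterlim_compose[OF exp_at_bot] filterlim_uminus_at_bot_at_top)
    have "(\<integral>\<^sup>+u. f (y, u) \<partial>lborel) = (\<integral>\<^sup>+u. ennreal (exp (- u)) * indicator {t..} u \<partial>lborel)"
      by (intro nn_integral_cong) (auto simp: f_def t_def indicator_def)
    also have "\<dots> = ennreal (0 - (- exp (- t)))"
      using lim by (intro nn_integral_FTC_atLeast) (auto intro!: derivative_eq_intros)
    finally show ?thesis by (simp add: tilt_def t_def)
  qed
  have inner: "(\<integral>\<^sup>+y. f (y, u) \<partial>lborel) = ennreal (2 * p powr (1 / p)) * ennreal (indicator {0..} u * u powr (1 + 1 / p - 1) / exp u)" for u
  proof (cases "0 \<le> u")
    case True
    have iff: "\<bar>y\<bar> powr p / p \<le> u \<longleftrightarrow> y \<in> {- ((p * u) powr (1 / p)) .. (p * u) powr (1 / p)}" for y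
    proof -
      have "\<bar>y\<bar> powr p / p \<le> u \<longleftrightarrow> \<bar>y\<bar> powr p \<le> p * u" using p by (simp add: pos_divide_le_eq mult.commute)
      also have "\<dots> \<longleftrightarrow> \<bar>y\<bar> powr p \<le> ((p * u) powr (1 / p)) powr p" using p True by (simp add: powr_powr)
      also have "\<dots> \<longleftrightarrow> \<bar>y\<bar> \<le> (p * u) powr (1 / p)"
        using p by (meson abs_ge_zero linorder_not_le order_less_imp_le powr_ge_zero powr_less_mono2 powr_mono2)
      finally show ?thesis by auto
    qed
    have "(\<integral>\<^sup>+y. f (y, u) \<partial>lborel)
      = (\<integral>\<^sup>+y. ennreal (exp (- u)) * indicator {- ((p * u) powr (1 / p)) .. (p * u) powr (1 / p)} y \<partial>lborel)"
      by (intro nn_integral_cong) (auto simp: f_def iff indicator_def)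
    also have "\<dots> = ennreal (exp (- u)) * ennreal (2 * (p * u) powr (1 / p))"
      by (subst nn_integral_cmult_indicator) auto
    also have "\<dots> = ennreal (2 * p powr (1 / p)) * ennreal (u powr (1 / p) * exp (- u))"
      using p True by (simp add: ennreal_mult[symmetric] powr_mult mult_ac)
    finally show ?thesis using True by (simp add: exp_minus divide_inverse)
  next
    case False
    have "f (y, u) = 0" for y
    proof -
      have "0 \<le> \<bar>y\<bar> powr p / p" using p by simp
      then show ?thesis using False by (simp add: f_def)
    qed
    then show ?thesis using False by simp
  qed
  have g0: "0 < 1 + 1 / p" using p by (simp add: add_pos_pos)
  have "partition_fn p 0 (1 / p) = (\<integral>\<^sup>+y. \<integral>\<^sup>+u. f (y, u) \<partial>lborel \<partial>lborel)"
    by (simp add: partition_fn_def outer)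
  also have "\<dots> = (\<integral>\<^sup>+u. \<integral>\<^sup>+y. f (y, u) \<partial>lborel \<partial>lborel)"
    by (rule lborel_pair.Fubini[symmetric]) measurable
  also have "\<dots> = ennreal (2 * p powr (1 / p)) * ennreal (Gamma (1 + 1 / p))"
    unfolding inner Gamma_conv_nn_integral_real[OF g0] by (rule nn_integral_cmult) measurable
  also have "\<dots> = ennreal (2 * p powr (1 / p) * Gamma (1 + 1 / p))"
    using p g0 by (intro ennreal_mult[symmetric]) (auto intro!: less_imp_le Gamma_real_pos)
  finally show ?thesis .
qed

lemma pfun_scale:
  assumes "partition_fn p a b < \<infinity>" "0 < r"
  shows "partition_fn p (a * r\<^sup>2) (b * r powr p) < \<infinity>" "pfun p a b = r * pfun p (a * r\<^sup>2) (b * r powr p)"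
proof -
  let ?P = "partition_fn p (a * r\<^sup>2) (b * r powr p)"
  have eq: "partition_fn p a b = ennreal r * ?P"
    by (rule partition_fn_scale[OF assms(2)])
  show fin: "?P < \<infinity>"
    using assms eq by (auto simp: ennreal_mult_less_top less_top[symmetric] ennreal_mult_eq_top_iff)
  have "ennreal (pfun p a b) = ennreal (r * pfun p (a * r\<^sup>2) (b * r powr p))"
    using eq assms(2) pfun_pos[OF fin] unfolding partition_fn_eq_pfun[OF fin] partition_fn_eq_pfun[OF assms(1)]
    by (simp add: ennreal_mult)
  then show "pfun p a b = r * pfun p (a * r\<^sup>2) (b * r powr p)"
    using assms pfun_pos[OF fin] pfun_pos[OF assms(1)] by (subst (asm) ennreal_inj) auto
qed

lemma mean_sq_scale:
  assumes "partition_fn p a b < \<infinity>" "0 < r"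
  shows "mean_sq p a b = r\<^sup>2 * mean_sq p (a * r\<^sup>2) (b * r powr p)"
proof -
  have t: "tilt p a b (0 + r * y) = tilt p (a * r\<^sup>2) (b * r powr p) y" for y
    using assms by (simp add: tilt_def abs_mult powr_mult power_mult_distrib mult_ac)
  have "(\<integral>y. tilt p a b y * y\<^sup>2 \<partial>lborel) = r * (\<integral>y. tilt p a b (0 + r * y) * (0 + r * y)\<^sup>2 \<partial>lborel)"
    using assms by (subst lborel_integral_real_affine[where c = r and t = 0]) auto
  also have "\<dots> = r * (\<integral>y. r\<^sup>2 * (tilt p (a * r\<^sup>2) (b * r powr p) y * y\<^sup>2) \<partial>lborel)"
    unfolding t by (simp add: power_mult_distrib mult_ac)
  finally show ?thesis
    unfolding mean_sq_def pfun_scale(2)[OF assms] using assms by simp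
qed

text \<open>Differentiate \<open>r \<mapsto> pfun p (a r\<^sup>2) (b r\<^bsup>p\<^esup>) = pfun p a b / r\<close> at \<open>r = 1\<close>; convexity of \<open>exp\<close> replaces
  differentiation under the integral sign.\<close>

lemma mean_identity:
  assumes adm: "admissible p a b"
  shows "b * p * mean_pow p a b - 2 * a * mean_sq p a b = 1"
proof -
  let ?s = "mean_sq p a b" and ?m = "mean_pow p a b" and ?Z = "pfun p a b"
  have fin: "partition_fn p a b < \<infinity>" by (rule admissible_finite[OF adm])
  have Z: "0 < ?Z" by (rule pfun_pos[OF fin])
  \<comment> \<open>The integrated gap in the tangent inequality for exp, divided by the partition
    function. It is nonnegative for r > 0 and zero at r = 1, so its derivative there vanishes, which
    is the claim.\<close>
  define G where "G = (\<lambda>r::real. 1 / r - 1 - a * (r\<^sup>2 - 1) * ?s + b * (r powr p - 1) * ?m)"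
  have G: "0 \<le> G r" if r: "0 < r" for r
  proof -
    let ?T = "tilt p (a * r\<^sup>2) (b * r powr p)"
    define c1 where "c1 = a * (r\<^sup>2 - 1)"
    define c2 where "c2 = b * (r powr p - 1)"
    have "(\<integral>y. tilt p a b y + c1 * (tilt p a b y * y\<^sup>2) - c2 * (tilt p a b y * \<bar>y\<bar> powr p) \<partial>lborel)
       = ?Z + c1 * (?s * ?Z) - c2 * (?m * ?Z)"
      using integrable_tilt[OF fin] integrable_tilt_moments[OF adm] mean_eqs[OF adm]
      by (simp add: pfun_def[symmetric])
    then have "?Z * (1 + a * (r\<^sup>2 - 1) * ?s - b * (r powr p - 1) * ?m)
       = (\<integral>y. tilt p a b y + a * (r\<^sup>2 - 1) * (tilt p a b y * y\<^sup>2) - b * (r powr p - 1) * (tilt p a b y * \<bar>y\<bar> powr p) \<partial>lborel)"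
      unfolding c1_def c2_def by (simp add: algebra_simps)
    also have "\<dots> \<le> (\<integral>y. ?T y \<partial>lborel)"
    proof (rule integral_mono)
      show "integrable lborel (\<lambda>y. tilt p a b y + a * (r\<^sup>2 - 1) * (tilt p a b y * y\<^sup>2) - b * (r powr p - 1) * (tilt p a b y * \<bar>y\<bar> powr p))"
        using integrable_tilt[OF fin] integrable_tilt_moments[OF adm] by simp
      show "integrable lborel ?T" by (rule integrable_tilt[OF pfun_scale(1)[OF fin r]])
      fix y
      define z where "z = a * (r\<^sup>2 - 1) * y\<^sup>2 - b * (r powr p - 1) * \<bar>y\<bar> powr p"
      have "?T y = tilt p a b y * exp z"
        by (simp add: tilt_def z_def exp_add[symmetric] algebra_simps)
      moreover have "tilt p a b y * (1 + z) \<le> tilt p a b y * exp z"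
        by (intro mult_left_mono exp_ge_add_one_self) auto
      ultimately show "tilt p a b y + a * (r\<^sup>2 - 1) * (tilt p a b y * y\<^sup>2) - b * (r powr p - 1) * (tilt p a b y * \<bar>y\<bar> powr p) \<le> ?T y"
        by (simp add: z_def algebra_simps)
    qed
    also have "\<dots> = ?Z * (1 / r)"
      using pfun_scale(2)[OF fin r] r by (simp add: pfun_def)
    finally have "1 + a * (r\<^sup>2 - 1) * ?s - b * (r powr p - 1) * ?m \<le> 1 / r"
      using Z by (simp only: mult_le_cancel_left_pos)
    then show ?thesis by (simp add: G_def)
  qed
  have D: "(G has_real_derivative (- 1 - 2 * a * ?s + b * p * ?m)) (at 1)"
    unfolding G_def by (auto intro!: derivative_eq_intros simp: has_real_derivative_powr)
  have "- 1 - 2 * a * ?s + b * p * ?m = 0"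
  proof (rule DERIV_local_min[OF D, of 1])
    show "\<forall>r. \<bar>1 - r\<bar> < 1 \<longrightarrow> G 1 \<le> G r" using G by (auto simp: G_def)
  qed simp
  then show ?thesis by simp
qed

lemma lp_ball_eq: "lp_ball n p = {x \<in> space (lborel_Rn n). pow_sum n p x \<le> 1}"
  by (simp add: lp_ball_def pow_sum_def)

lemma lp_ball_measurable [measurable]: "lp_ball n p \<in> sets (lborel_Rn n)"
  unfolding lp_ball_eq by measurable

text \<open>On the ball \<open>pow_sum n p x \<le> 1\<close>, so its indicator is at most
  \<open>exp (n * b * (1 - pow_sum n p x))\<close>, and the integral factorises over the
  coordinates.\<close>

lemma lp_ball_integral_upper:
  assumes "1 \<le> n" "p \<noteq> 0" "0 \<le> b"
  shows "(\<integral>\<^sup>+x. ennreal (exp (a * (n powr (2/p) * sq_norm n x))) * indicator (lp_ball n p) x \<partial>lborel_Rn n)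
    \<le> ennreal (exp (n * b)) * (ennreal (n powr (-1/p)) * partition_fn p a b) ^ n"
proof -
  have "(\<integral>\<^sup>+x. ennreal (exp (a * (n powr (2/p) * sq_norm n x))) * indicator (lp_ball n p) x \<partial>lborel_Rn n)
    \<le> (\<integral>\<^sup>+x. ennreal (exp (n * b)) * ennreal (exp (a * (n powr (2/p) * sq_norm n x) - b * (n * pow_sum n p x))) \<partial>lborel_Rn n)"
  proof (rule nn_integral_mono)
    fix x
    show "ennreal (exp (a * (n powr (2/p) * sq_norm n x))) * indicator (lp_ball n p) x
      \<le> ennreal (exp (n * b)) * ennreal (exp (a * (n powr (2/p) * sq_norm n x) - b * (n * pow_sum n p x)))"
    proof (cases "x \<in> lp_ball n p")
      case True
      then have "b * (n * pow_sum n p x) \<le> b * (n * 1)"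
        using assms by (intro mult_left_mono) (auto simp: lp_ball_eq)
      then have "exp (a * (n powr (2/p) * sq_norm n x)) \<le> exp (n * b) * exp (a * (n powr (2/p) * sq_norm n x) - b * (n * pow_sum n p x))"
        by (simp add: exp_add[symmetric] mult.commute)
      then show ?thesis using True by (simp add: ennreal_mult[symmetric] ennreal_leI)
    qed simp
  qed
  also have "\<dots> = ennreal (exp (n * b)) * (ennreal (n powr (-1/p)) * partition_fn p a b) ^ n"
    using assms by (subst nn_integral_cmult) (simp_all add: nn_integral_tilt_n)
  finally show ?thesis .
qed

text \<open>By the mean identity the p-th moment under the tilt (a, 1/p) is P \<ge> 1, so typical
  points need not lie in the ball. Shrinking by \<open>P powr (-1/p)\<close>, and by a further r < 1
  close to 1, puts the whole band inside. The squared norm per coordinate is then near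
  \<open>s * P powr (-2/p)\<close>, and \<open>ln P / p\<close> is the price in volume.\<close>

lemma lp_ball_shell_lower:
  assumes adm: "admissible p a (1/p)" and a: "0 \<le> a" and \<zeta>: "0 < \<zeta>" and e: "0 < e"
  defines "s \<equiv> mean_sq p a (1/p)" and "Z \<equiv> pfun p a (1/p)"
  defines "P \<equiv> 1 + 2 * a * s"
  shows "eventually (\<lambda>n. ennreal ((n powr (-1/p)) ^ n * exp (n * (ln Z - ln P / p - a * s + P / p - \<zeta>)))
    \<le> emeasure (lborel_Rn n) {x \<in> lp_ball n p.
        \<bar>sqrt (n powr (2/p) * sq_norm n x / n) - sqrt (s * P powr (-2/p))\<bar> < e}) sequentially"
proof -
  have p: "2 \<le> p" using adm by (simp add: admissible_def)
  have fin: "partition_fn p a (1/p) < \<infinity>" by (rule admissible_finite[OF adm])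
  have Z: "0 < Z" unfolding Z_def by (rule pfun_pos[OF fin])
  have s: "0 \<le> s" unfolding s_def mean_sq_def using pfun_pos[OF fin] by (intro divide_nonneg_nonneg integral_nonneg_AE) auto
  have P: "1 \<le> P" using a s by (simp add: P_def)
  define s0 where "s0 = s * P powr (-2/p)"
  \<comment> \<open>Minus the exponent lost through r: ln r comes from the volume, and the second
    term is \<open>d * (a' + b')\<close> for the band radius \<open>d = 1 - r powr p\<close> and the
    rescaled parameters. It tends to 0 as r tends to 1.\<close>
  define f where "f = (\<lambda>r::real. ln r - (1 - r powr p) * (a * P powr (2/p) / r\<^sup>2 + P / (p * r powr p)))"
  have f1: "f 1 = 0" by (simp add: f_def)
  have "isCont f 1" unfolding f_def using p by (intro continuous_intros) auto
  then have t1: "(f \<longlongrightarrow> 0) (at_left 1)" using f1 unfolding isCont_def by (metis filterlim_at_split)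
  have c2: "isCont (\<lambda>r. sqrt (r\<^sup>2 * s0 + (1 - r powr p))) 1" by (intro continuous_intros) auto
  then have t2: "((\<lambda>r. sqrt (r\<^sup>2 * s0 + (1 - r powr p))) \<longlongrightarrow> sqrt s0) (at_left 1)"
    unfolding isCont_def by (simp add: filterlim_at_split)
  have c3: "isCont (\<lambda>r. sqrt (r\<^sup>2 * s0 - (1 - r powr p))) 1" by (intro continuous_intros) auto
  then have t3: "((\<lambda>r. sqrt (r\<^sup>2 * s0 - (1 - r powr p))) \<longlongrightarrow> sqrt s0) (at_left 1)"
    unfolding isCont_def by (simp add: filterlim_at_split)
  have "eventually (\<lambda>r. - \<zeta> / 2 < f r \<and> sqrt (r\<^sup>2 * s0 + (1 - r powr p)) < sqrt s0 + e
      \<and> sqrt s0 - e < sqrt (r\<^sup>2 * s0 - (1 - r powr p)) \<and> 0 < r \<and> r < 1) (at_left 1)"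
  proof (intro eventually_conj)
    show "eventually (\<lambda>r. 0 < r) (at_left (1::real))" using eventually_at_left_real[of 0 1] by (auto elim: eventually_mono)
    show "eventually (\<lambda>r. r < 1) (at_left (1::real))" by (simp add: eventually_at_filter)
  qed (use \<zeta> e t1 t2 t3 in \<open>auto intro!: order_tendstoD\<close>)
  then obtain r where r: "- \<zeta> / 2 < f r" "sqrt (r\<^sup>2 * s0 + (1 - r powr p)) < sqrt s0 + e"
      "sqrt s0 - e < sqrt (r\<^sup>2 * s0 - (1 - r powr p))" "0 < r" "r < 1"
    using eventually_happens'[OF trivial_limit_at_left_real] by blast
  define d where "d = 1 - r powr p"
  have d: "0 < d" using r p powr_less_mono2[of p r 1] by (simp add: d_def)
  define q where "q = r * P powr (-1/p)"
  have q: "0 < q" using r P by (simp add: q_def)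
  have qp: "q powr p = r powr p / P" using r P p by (simp add: q_def powr_mult powr_divide powr_powr powr_minus_divide)
  have q2: "q\<^sup>2 = r\<^sup>2 * P powr (-2/p)" using P by (simp add: q_def power_mult_distrib powr_power)
  \<comment> \<open>With b', the parameters of the law of q times a variable with tilt (a,
    1/p).\<close>
  define a' where "a' = a * (1/q)\<^sup>2"
  define b' where "b' = 1/p * (1/q) powr p"
  have b'_eq: "b' = P / (p * r powr p)"
    using q r P p by (simp add: b'_def powr_divide qp)
  have a'_eq: "a' = a * P powr (2/p) / r\<^sup>2"
    using P by (simp add: a'_def power_divide q2 powr_minus_divide)
  have adm': "admissible p a' b'"
  proof -
    have "a' < b'" if "p = 2"
    proof -
      have "b' = 1/2 * (1/q)\<^sup>2" using q unfolding b'_def that by (simp add: powr_numeral)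
      moreover have "a < 1/2" using adm that by (simp add: admissible_def)
      ultimately show ?thesis using q unfolding a'_def by (simp add: power_divide field_simps)
    qed
    then show ?thesis using p q by (simp add: admissible_def b'_def)
  qed
  have Z': "pfun p a' b' = q * Z"
    using pfun_scale(2)[OF fin, of "1/q"] q unfolding a'_def b'_def Z_def by simp
  have s': "mean_sq p a' b' = q\<^sup>2 * s"
    using mean_sq_scale[OF fin, of "1/q"] q unfolding a'_def b'_def s_def by (simp add: power_divide)
  have s'_eq: "mean_sq p a' b' = r\<^sup>2 * s0" unfolding s' q2 s0_def by simp
  have as': "a' * mean_sq p a' b' = a * s" unfolding s' unfolding a'_def using q by (simp add: power_divide)
  \<comment> \<open>The product of a and the mean square is invariant under scaling, so the mean
    identity for (a', b') again produces P. This centres the power sum at \<open>r powr p\<close>,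
    exactly d below 1.\<close>
  have bm': "b' * mean_pow p a' b' = P / p"
  proof -
    have "b' * p * mean_pow p a' b' = P" using mean_identity[OF adm'] as' by (simp add: P_def)
    then show ?thesis using p by (simp add: field_simps)
  qed
  have m': "mean_pow p a' b' = r powr p"
    using bm' P p r unfolding b'_eq by (simp add: field_simps)
  have a'0: "0 \<le> a'" using a by (simp add: a'_def)
  have rate: "ln Z - ln P / p - a * s + P / p - \<zeta> \<le> - \<zeta> / 2 + (ln (pfun p a' b') - a' * mean_sq p a' b' + b' * mean_pow p a' b' - d * (a' + b'))"
  proof -
    have "ln (pfun p a' b') = ln r - ln P / p + ln Z"
      unfolding Z' q_def using r P Z by (simp add: ln_mult ln_powr)
    moreover have "f r = ln r - d * (a' + b')" unfolding f_def d_def a'_eq b'_eq by simp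
    ultimately show ?thesis unfolding as' bm' using r(1) by simp
  qed
  have "eventually (\<lambda>n. n \<ge> 1 \<and> exp (real n * (- \<zeta> / 2)) \<le> 1/2) sequentially"
    using \<zeta> by (intro eventually_conj eventually_ge_at_top eventually_exp_mult_le) auto
  with tilt_band_lower[OF adm' a'0 d] show ?thesis
  proof eventually_elim
    case (elim n)
    define k where "k = ln (pfun p a' b') - a' * mean_sq p a' b' + b' * mean_pow p a' b' - d * (a' + b')"
    have "exp (n * (ln Z - ln P / p - a * s + P / p - \<zeta>)) \<le> exp (n * (- \<zeta> / 2)) * exp (n * k)"
      using mult_left_mono[OF rate, of n] unfolding k_def[symmetric] by (simp add: algebra_simps flip: exp_add)
    also have "\<dots> \<le> 1/2 * exp (n * k)" using elim by (intro mult_right_mono) auto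
    finally have "(n powr (-1/p)) ^ n * exp (n * (ln Z - ln P / p - a * s + P / p - \<zeta>)) \<le> (n powr (-1/p)) ^ n * (1/2 * exp (n * k))"
      by (intro mult_left_mono) auto
    also have "\<dots> = 1/2 * (n powr (-1/p)) ^ n * exp (n * k)" by simp
    finally have "ennreal ((n powr (-1/p)) ^ n * exp (n * (ln Z - ln P / p - a * s + P / p - \<zeta>)))
       \<le> ennreal (1/2 * (n powr (-1/p)) ^ n * exp (n * k))" by (rule ennreal_leI)
    also have "\<dots> \<le> emeasure (lborel_Rn n) {x \<in> space (lborel_Rn n).
        \<bar>n powr (2/p) * sq_norm n x / n - mean_sq p a' b'\<bar> < d \<and> \<bar>pow_sum n p x - mean_pow p a' b'\<bar> < d}"
      using elim unfolding k_def by simp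
    also have "\<dots> \<le> emeasure (lborel_Rn n) {x \<in> lp_ball n p.
        \<bar>sqrt (n powr (2/p) * sq_norm n x / n) - sqrt s0\<bar> < e}"
    proof (rule emeasure_mono)
      show "{x \<in> space (lborel_Rn n). \<bar>n powr (2/p) * sq_norm n x / n - mean_sq p a' b'\<bar> < d \<and> \<bar>pow_sum n p x - mean_pow p a' b'\<bar> < d}
        \<subseteq> {x \<in> lp_ball n p. \<bar>sqrt (n powr (2/p) * sq_norm n x / n) - sqrt s0\<bar> < e}"
      proof safe
        fix x assume x: "x \<in> space (lborel_Rn n)" "\<bar>n powr (2/p) * sq_norm n x / n - mean_sq p a' b'\<bar> < d" "\<bar>pow_sum n p x - mean_pow p a' b'\<bar> < d"
        show "x \<in> lp_ball n p" using x by (simp add: lp_ball_eq m' d_def)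
        define u where "u = n powr (2/p) * sq_norm n x / n"
        have "r\<^sup>2 * s0 - d < u" "u < r\<^sup>2 * s0 + d" using x(2) unfolding s'_eq u_def[symmetric] by auto
        then have "sqrt (r\<^sup>2 * s0 - d) < sqrt u" "sqrt u < sqrt (r\<^sup>2 * s0 + d)" by auto
        then show "\<bar>sqrt (n powr (2/p) * sq_norm n x / n) - sqrt s0\<bar> < e"
          using r(2,3) unfolding u_def[symmetric] d_def by linarith
      qed
      have "{x \<in> lp_ball n p. \<bar>sqrt (n powr (2/p) * sq_norm n x / n) - sqrt s0\<bar> < e}
         = lp_ball n p \<inter> {x \<in> space (lborel_Rn n). \<bar>sqrt (n powr (2/p) * sq_norm n x / n) - sqrt s0\<bar> < e}"
        by (auto simp: lp_ball_eq)
      also have "\<dots> \<in> sets (lborel_Rn n)" by measurable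
      finally show "{x \<in> lp_ball n p. \<bar>sqrt (n powr (2/p) * sq_norm n x / n) - sqrt s0\<bar> < e} \<in> sets (lborel_Rn n)" .
    qed
    finally show ?case by (simp add: s0_def)
  qed
qed


section \<open>Solving for the tilt\<close>

lemma pot_less:
  fixes p x y :: real
  assumes p: "2 < p" and xy: "0 \<le> x" "x < y" "y \<le> 1"
  shows "x\<^sup>2 / 2 - x powr p / p < y\<^sup>2 / 2 - y powr p / p"
proof (rule DERIV_pos_imp_increasing_open[OF xy(2), of "\<lambda>t. t\<^sup>2 / 2 - t powr p / p"])
  fix t assume t: "x < t" "t < y"
  then have t01: "0 < t" "t < 1" using xy by auto
  have "((\<lambda>t. t\<^sup>2 / 2 - t powr p / p) has_real_derivative (t - t powr (p - 1))) (at t)"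
    using p t01 by (auto intro!: derivative_eq_intros)
  moreover have "t powr (p - 1) < t powr 1" using t01 p by (intro powr_less_mono') auto
  ultimately show "\<exists>z. ((\<lambda>t. t\<^sup>2 / 2 - t powr p / p) has_real_derivative z) (at t) \<and> 0 < z"
    using t01 by (intro exI[of _ "t - t powr (p - 1)"]) auto
next
  show "continuous_on {x..y} (\<lambda>t. t\<^sup>2 / 2 - t powr p / p)"
    using p xy by (intro continuous_intros continuous_on_powr') auto
qed

text \<open>Laplace's method: \<open>t\<^sup>2 / 2 - t powr p / p\<close> increases on [0, 1], so
  [-\<theta>, \<theta>] carries an exponentially small share of the mass. The cube is the lower
  bound \<theta>^2 for y^2 outside this interval times \<theta> for the mass found there.\<close>

lemma mean_sq_concentration:
  assumes p: "2 < p" and \<theta>: "0 < \<theta>" "\<theta> < 1"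
  shows "eventually (\<lambda>N. \<theta> ^ 3 \<le> mean_sq p (N / 2) (N / p)) at_top"
proof -
  \<comment> \<open>Strictly between \<theta> and 1: already the interval from \<theta>' to 1 gives
    Z the order \<open>exp (N * h \<theta>')\<close>, which outgrows
    \<open>exp (N * h \<theta>)\<close>.\<close>
  define \<theta>' where "\<theta>' = (1 + \<theta>) / 2"
  have \<theta>': "\<theta> < \<theta>'" "\<theta>' < 1" using \<theta> by (auto simp: \<theta>'_def)
  define h where "h = (\<lambda>t::real. t\<^sup>2 / 2 - \<bar>t\<bar> powr p / p)"
  have h_mono: "h x \<le> h y" if "\<bar>x\<bar> \<le> \<bar>y\<bar>" "\<bar>y\<bar> \<le> 1" for x y
    using pot_less[OF p, of "\<bar>x\<bar>" "\<bar>y\<bar>"] that by (cases "\<bar>x\<bar> = \<bar>y\<bar>") (auto simp: h_def abs_eq_iff)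
  define \<Delta> where "\<Delta> = h \<theta>' - h \<theta>"
  have \<Delta>: "0 < \<Delta>" using pot_less[OF p, of \<theta> \<theta>'] \<theta> \<theta>' by (simp add: \<Delta>_def h_def)
  have "((\<lambda>N. 2 / (1 - \<theta>') * exp (- (\<Delta> * N))) \<longlongrightarrow> 2 / (1 - \<theta>') * 0) at_top"
    using \<Delta> by (intro tendsto_intros filterlim_compose[OF exp_at_bot] filterlim_compose[OF filterlim_uminus_at_bot_at_top]
        filterlim_tendsto_pos_mult_at_top[OF tendsto_const] filterlim_ident)
  then have "eventually (\<lambda>N. 2 / (1 - \<theta>') * exp (- (\<Delta> * N)) < 1 - \<theta>) at_top"
    using \<theta> by (intro order_tendstoD) auto
  with eventually_gt_at_top[of 0] show ?thesis
  proof eventually_elim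
    case (elim N)
    let ?F = "tilt p (N / 2) (N / p)"
    have F: "?F y = exp (N * h y)" for y by (simp add: tilt_def h_def algebra_simps)
    have adm: "admissible p (N / 2) (N / p)" using p elim by (simp add: admissible_def)
    have fin: "partition_fn p (N / 2) (N / p) < \<infinity>" by (rule admissible_finite[OF adm])
    define Z where "Z = pfun p (N / 2) (N / p)"
    have Z: "0 < Z" unfolding Z_def by (rule pfun_pos[OF fin])
    have Zlow: "(1 - \<theta>') * exp (N * h \<theta>') \<le> Z"
    proof -
      have "(1 - \<theta>') * exp (N * h \<theta>') = (\<integral>y. indicator {\<theta>'..1} y * exp (N * h \<theta>') \<partial>lborel)"
        using \<theta>' by simp
      also have "\<dots> \<le> (\<integral>y. ?F y \<partial>lborel)"
      proof (rule integral_mono)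
        show "integrable lborel ?F" by (rule integrable_tilt[OF fin])
        show "indicator {\<theta>'..1} y * exp (N * h \<theta>') \<le> ?F y" for y
          using h_mono[of \<theta>' y] \<theta> \<theta>' elim by (auto simp: F indicator_def)
      qed (use \<theta>' in \<open>auto intro!: integrable_mult_left integrable_real_indicator\<close>)
      finally show ?thesis by (simp add: Z_def pfun_def)
    qed
    have "\<theta>\<^sup>2 * (Z - 2 * \<theta> * exp (N * h \<theta>)) = (\<integral>y. \<theta>\<^sup>2 * (?F y - indicator {- \<theta>..\<theta>} y * exp (N * h \<theta>)) \<partial>lborel)"
    proof -
      have i: "integrable lborel (\<lambda>y. indicator {- \<theta>..\<theta>} y * exp (N * h \<theta>))"
        using \<theta> by (auto intro!: integrable_mult_left integrable_real_indicator)
      have "(\<integral>y. indicator {- \<theta>..\<theta>} y * exp (N * h \<theta>) \<partial>lborel) = 2 * \<theta> * exp (N * h \<theta>)"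
        using \<theta> by simp
      then show ?thesis
        using integrable_tilt[OF fin] i by (simp add: Z_def pfun_def del: integral_mult_left_zero)
    qed
    also have "\<dots> \<le> (\<integral>y. ?F y * y\<^sup>2 \<partial>lborel)"
    proof (rule integral_mono)
      show "integrable lborel (\<lambda>y. \<theta>\<^sup>2 * (?F y - indicator {- \<theta>..\<theta>} y * exp (N * h \<theta>)))"
        using integrable_tilt[OF fin] \<theta>
        by (auto intro!: integrable_mult_left integrable_mult_right Bochner_Integration.integrable_diff integrable_real_indicator)
      show "integrable lborel (\<lambda>y. ?F y * y\<^sup>2)" by (rule integrable_tilt_moments[OF adm])
      fix y
      show "\<theta>\<^sup>2 * (?F y - indicator {- \<theta>..\<theta>} y * exp (N * h \<theta>)) \<le> ?F y * y\<^sup>2"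
      proof (cases "y \<in> {- \<theta>..\<theta>}")
        case True
        then have "h y \<le> h \<theta>" using \<theta> by (intro h_mono) auto
        then have "?F y - exp (N * h \<theta>) \<le> 0" using elim by (simp add: F)
        then have "\<theta>\<^sup>2 * (?F y - exp (N * h \<theta>)) \<le> 0" by (intro mult_nonneg_nonpos) auto
        also have "0 \<le> ?F y * y\<^sup>2" by simp
        finally show ?thesis using True by simp
      next
        case False
        then have "\<theta>\<^sup>2 \<le> y\<^sup>2" using \<theta> by (intro abs_le_square_iff[THEN iffD1]) auto
        then have "\<theta>\<^sup>2 * ?F y \<le> y\<^sup>2 * ?F y" by (intro mult_right_mono) auto
        then show ?thesis using False by (simp add: mult.commute)
      qed
    qed
    also have "\<dots> = mean_sq p (N / 2) (N / p) * Z" unfolding Z_def by (rule mean_eqs[OF adm])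
    finally have 1: "\<theta>\<^sup>2 * (Z - 2 * \<theta> * exp (N * h \<theta>)) \<le> mean_sq p (N / 2) (N / p) * Z" .
    have "2 * \<theta> * exp (N * h \<theta>) \<le> (1 - \<theta>) * Z"
    proof -
      have ex: "exp (N * h \<theta>) = exp (- (\<Delta> * N)) * exp (N * h \<theta>')"
        by (simp add: \<Delta>_def exp_add[symmetric] algebra_simps)
      have "2 * \<theta> * exp (N * h \<theta>) \<le> 2 * exp (N * h \<theta>)" using \<theta> by simp
      also have "2 * exp (N * h \<theta>) = (2 / (1 - \<theta>') * exp (- (\<Delta> * N))) * ((1 - \<theta>') * exp (N * h \<theta>'))"
        unfolding ex using \<theta>' by simp
      also have "\<dots> \<le> (1 - \<theta>) * Z" using elim \<theta> \<theta>' Zlow by (intro mult_mono) auto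
      finally show ?thesis .
    qed
    then have "\<theta>\<^sup>2 * (\<theta> * Z) \<le> \<theta>\<^sup>2 * (Z - 2 * \<theta> * exp (N * h \<theta>))"
      by (intro mult_left_mono) (auto simp: algebra_simps)
    with 1 have "\<theta> ^ 3 * Z \<le> mean_sq p (N / 2) (N / p) * Z"
      by (simp add: power2_eq_square power3_eq_cube mult.assoc)
    then show ?case using Z by simp
  qed
qed

text \<open>Dominated convergence; the weight is monotone in a, so its value at the right end A is a
  majorant.\<close>

lemma continuous_on_tilt_integral:
  assumes p: "2 < p" and g [measurable]: "g \<in> borel_measurable borel" and g0: "\<And>y. 0 \<le> g y"
    and i: "integrable lborel (\<lambda>y. tilt p A b y * g y)"
  shows "continuous_on {0..A} (\<lambda>a. \<integral>y. tilt p a b y * g y \<partial>lborel)"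
proof (rule continuous_on_sequentiallyI)
  fix u a assume u: "\<forall>n. u n \<in> {0..A}" and a: "a \<in> {0..A}" and lim: "u \<longlonglongrightarrow> a"
  show "(\<lambda>n. \<integral>y. tilt p (u n) b y * g y \<partial>lborel) \<longlonglongrightarrow> (\<integral>y. tilt p a b y * g y \<partial>lborel)"
  proof (rule integral_dominated_convergence[where w = "\<lambda>y. tilt p A b y * g y"])
    show "AE y in lborel. (\<lambda>n. tilt p (u n) b y * g y) \<longlonglongrightarrow> tilt p a b y * g y"
      unfolding tilt_def by (intro AE_I2 tendsto_intros lim)
    show "AE y in lborel. norm (tilt p (u n) b y * g y) \<le> tilt p A b y * g y" for n
    proof (intro AE_I2)
      fix y :: real
      have "u n * y\<^sup>2 \<le> A * y\<^sup>2" using u by (intro mult_right_mono) auto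
      then have "tilt p (u n) b y * g y \<le> tilt p A b y * g y" using g0 by (intro mult_right_mono) (auto simp: tilt_def)
      then show "norm (tilt p (u n) b y * g y) \<le> tilt p A b y * g y" using g0 by simp
    qed
  qed (use i in measurable)
qed

text \<open>With s the mean square and P = 1 + 2 a s, the left side is
  \<open>(1 - 1/P) * (s * P powr (-2/p))\<close>: a squared cosine times a squared norm, hence the
  square of the value of W that the tilt a brings about. For p = 2 it equals 2 a. For p > 2 it is 0
  at a = 0 and comes arbitrarily close to 1, so the intermediate value theorem applies.\<close>

lemma exists_tilt:
  assumes p: "2 \<le> p" and u: "0 \<le> u" "u < 1"
  shows "\<exists>a\<ge>0. admissible p a (1/p) \<and>
    2 * a * (mean_sq p a (1/p))\<^sup>2 * (1 + 2 * a * mean_sq p a (1/p)) powr (- 1 - 2/p) = u"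
proof (cases "p = 2")
  case True
  have adm: "admissible p (u / 2) (1/p)" using True u by (simp add: admissible_def)
  have "mean_pow p (u / 2) (1/p) = mean_sq p (u / 2) (1/p)"
  proof -
    have "\<bar>y\<bar> powr p = y\<^sup>2" for y using True by simp
    then show ?thesis by (simp add: mean_pow_def mean_sq_def)
  qed
  then have s: "1 + u * mean_sq p (u / 2) (1/p) = mean_sq p (u / 2) (1/p)"
    using mean_identity[OF adm] True by simp
  have pos: "0 < mean_sq p (u / 2) (1/p)"
  proof -
    have "mean_sq p (u / 2) (1/p) * (1 - u) = 1" using s by (simp add: algebra_simps)
    then show ?thesis using u by (smt (verit) mult_nonpos_nonneg)
  qed
  have "(mean_sq p (u / 2) (1/p)) powr (- 1 - 2/p) = 1 / (mean_sq p (u / 2) (1/p))\<^sup>2"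
    using pos True by (simp add: powr_minus_divide powr_numeral)
  then show ?thesis
    using adm u s pos by (intro exI[of _ "u / 2"]) simp
next
  case False
  then have p: "2 < p" using p by simp
  have adm: "admissible p a (1/p)" for a using p by (simp add: admissible_def)
  define s where "s = (\<lambda>a. mean_sq p a (1/p))"
  have s0: "0 \<le> s a" for a unfolding s_def mean_sq_def
    using pfun_pos[OF admissible_finite[OF adm[of a]]] by (intro divide_nonneg_nonneg integral_nonneg_AE) auto
  define V where "V = (\<lambda>a. 2 * a * (s a)\<^sup>2 * (1 + 2 * a * s a) powr (- 1 - 2/p))"
  have cont: "continuous_on {0..A} V" for A
  proof -
    have "continuous_on {0..A} (\<lambda>a. pfun p a (1/p))"
      using continuous_on_tilt_integral[OF p, of "\<lambda>_. 1" A "1/p"] integrable_tilt[OF admissible_finite[OF adm[of A]]]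
      by (simp add: pfun_def)
    moreover have "continuous_on {0..A} (\<lambda>a. \<integral>y. tilt p a (1/p) y * y\<^sup>2 \<partial>lborel)"
      using continuous_on_tilt_integral[OF p, of "\<lambda>y. y\<^sup>2" A "1/p"] integrable_tilt_moments[OF adm[of A]] by simp
    moreover have "pfun p a (1/p) \<noteq> 0" for a
      using pfun_pos[OF admissible_finite[OF adm[of a]]] by simp
    ultimately have cs: "continuous_on {0..A} s"
      unfolding s_def mean_sq_def by (intro continuous_on_divide) auto
    have "1 + 2 * a * s a \<noteq> 0" if "a \<in> {0..A}" for a
      using that s0[of a] by (smt (verit) atLeastAtMost_iff mult_nonneg_nonneg)
    with cs show ?thesis unfolding V_def by (intro continuous_intros) auto
  qed
  obtain A where A: "0 \<le> A" "u \<le> V A"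
  proof -
    \<comment> \<open>The sixth root, because V will be bounded below by the square of \<theta>^3;
      the maximum with 1/2 keeps \<theta> positive when u = 0.\<close>
    define \<theta> where "\<theta> = max (1/2) (root 6 u)"
    have \<theta>: "0 < \<theta>" "\<theta> < 1" using u by (auto simp: \<theta>_def less_max_iff_disj)
    have \<theta>6: "u \<le> \<theta> ^ 6"
    proof -
      have "u = root 6 u ^ 6" using u by (simp add: real_root_pow_pos2)
      also have "\<dots> \<le> \<theta> ^ 6" using u by (intro power_mono) (auto simp: \<theta>_def)
      finally show ?thesis .
    qed
    \<comment> \<open>The threshold equals \<open>1 / (1 - \<theta>^3)\<close>; beyond it, q \<ge>
      \<theta>^3 implies \<open>N * q / (1 + N * q) \<ge> \<theta>^3\<close>.\<close>
    have "eventually (\<lambda>N. N > 1 / (\<theta>^3) * (\<theta>^3 / (1 - \<theta>^3))) at_top" by (rule eventually_gt_at_top)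
    with mean_sq_concentration[OF p \<theta>] eventually_gt_at_top[of 0]
    have "eventually (\<lambda>N. 0 < N \<and> \<theta> ^ 3 \<le> mean_sq p (N / 2) (N / p) \<and> N > 1 / (\<theta>^3) * (\<theta>^3 / (1 - \<theta>^3))) at_top"
      by eventually_elim auto
    then obtain N where N: "0 < N" "\<theta> ^ 3 \<le> mean_sq p (N / 2) (N / p)" "N > 1 / (\<theta>^3) * (\<theta>^3 / (1 - \<theta>^3))"
      using eventually_happens'[OF trivial_limit_at_top_linorder] by blast
    \<comment> \<open>Scaling by x turns the weight with parameters (a, 1/p) into the concentrated
      one with (N/2, N/p): \<open>x powr p = N\<close> and
      \<open>a * x\<^sup>2 = N / 2\<close>.\<close>
    define x where "x = N powr (1/p)"
    have x: "0 < x" using N by (simp add: x_def)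
    define a where "a = x powr (p - 2) / 2"
    have xp: "x powr p = N" using N p by (simp add: x_def powr_powr)
    have ax: "a * x\<^sup>2 = N / 2"
    proof -
      have "x powr (p - 2) * x powr 2 = x powr p" by (simp flip: powr_add)
      then show ?thesis using x xp by (simp add: a_def powr_numeral)
    qed
    define q where "q = mean_sq p (N / 2) (N / p)"
    define c where "c = \<theta> ^ 3"
    have c: "0 < c" "c < 1" "c \<le> q" using \<theta> N by (auto simp: c_def q_def power_less_one_iff)
    have sa: "s a = x\<^sup>2 * q"
      using mean_sq_scale[OF admissible_finite[OF adm[of a]] x] unfolding s_def q_def ax by (simp add: xp)
    have as: "2 * a * s a = N * q" unfolding sa using ax by (simp add: algebra_simps)
    have Nc: "c \<le> N * q / (1 + N * q)"
    proof -
      have "1 / (1 - c) < N" using N(3) c by (simp add: c_def[symmetric])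
      then have "1 < N * (1 - c)" using c by (simp add: pos_divide_less_eq)
      then have "c * 1 \<le> c * (N * (1 - c))" using c by (intro mult_left_mono) auto
      also have "\<dots> = N * c * (1 - c)" by simp
      also have "\<dots> \<le> N * q * (1 - c)" using c N by (intro mult_right_mono mult_left_mono) auto
      finally have "c * (1 + N * q) \<le> N * q" by (simp add: algebra_simps)
      moreover have "0 < 1 + N * q" using N c by (intro add_pos_nonneg) auto
      ultimately show ?thesis by (simp add: pos_le_divide_eq)
    qed
    \<comment> \<open>Both bases are at least c, both exponents are nonnegative, and the exponents
      add up to 2; so this form shows V a \<ge> c^2.\<close>
    have "V a = q powr (1 - 2/p) * (N * q / (1 + N * q)) powr (1 + 2/p)"
    proof -
      have q: "0 < q" using c by linarith
      have "V a = N * q * s a * (1 + N * q) powr (- 1 - 2/p)"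
        unfolding V_def as[symmetric] by (simp add: power2_eq_square)
      also have "s a = N powr (2/p) * q" unfolding sa x_def using N by (simp add: powr_power)
      also have "(1 + N * q) powr (- 1 - 2/p) = 1 / (1 + N * q) powr (1 + 2/p)"
        by (metis add_uminus_conv_diff minus_add_distrib powr_minus_divide)
      also have "N * q * (N powr (2/p) * q) * (1 / (1 + N * q) powr (1 + 2/p))
          = (q powr (1 - 2/p) * q powr (1 + 2/p)) * (N powr (1 + 2/p)) / (1 + N * q) powr (1 + 2/p)"
      proof -
        have "q powr (1 - 2/p) * q powr (1 + 2/p) = q * q" using q by (simp flip: powr_add add: powr_numeral power2_eq_square)
        moreover have "N powr (1 + 2/p) = N * N powr (2/p)" using N by (simp add: powr_add)
        ultimately show ?thesis by (simp add: mult_ac)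
      qed
      also have "\<dots> = q powr (1 - 2/p) * (N * q / (1 + N * q)) powr (1 + 2/p)"
        using q N by (simp add: powr_mult powr_divide mult_ac add_nonneg_nonneg)
      finally show ?thesis .
    qed
    moreover have "c powr (1 - 2/p) * c powr (1 + 2/p) \<le> q powr (1 - 2/p) * (N * q / (1 + N * q)) powr (1 + 2/p)"
      using c p Nc by (intro mult_mono powr_mono2) auto
    moreover have "c powr (1 - 2/p) * c powr (1 + 2/p) = \<theta> ^ 6"
    proof -
      have "c powr (1 - 2/p) * c powr (1 + 2/p) = c\<^sup>2" using c by (simp flip: powr_add add: powr_numeral)
      then show ?thesis by (simp add: c_def flip: power_mult)
    qed
    ultimately have "u \<le> V a" using \<theta>6 by linarith
    moreover have "0 \<le> a" by (simp add: a_def)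
    ultimately show ?thesis using that by blast
  qed
  have "\<exists>a. 0 \<le> a \<and> a \<le> A \<and> V a = u"
    using IVT'[of V 0 u A] A u cont by (auto simp: V_def)
  then show ?thesis using adm unfolding V_def s_def by blast
qed


section \<open>The rate function\<close>

lemma elog_ennreal [simp]: "0 < x \<Longrightarrow> elog (ennreal x) = ereal (ln x)"
  by (simp add: elog_def ennreal_eq_0_iff)

lemma elog_top [simp]: "elog \<top> = \<infinity>"
  by (simp add: elog_def)

lemma elog_mono:
  assumes "x \<le> y"
  shows "elog x \<le> elog y"
proof (cases "x = 0 \<or> y = \<infinity>")
  case False
  then have "0 < enn2real x" "enn2real x \<le> enn2real y"
    using assms by (auto simp: enn2real_positive_iff less_top zero_less_iff_neq_zero top_unique intro!: enn2real_mono)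
  then show ?thesis using False assms by (auto simp: elog_def top_unique)
qed (auto simp: elog_def)

definition mass :: "real \<Rightarrow> real" where
  "mass p = pfun p 0 (1 / p)"

lemma mass_eq:
  assumes "2 \<le> p"
  shows "mass p = 2 * p powr (1 / p) * Gamma (1 + 1 / p)" "0 < mass p"
    "partition_fn p 0 (1 / p) = ennreal (mass p)"
proof -
  have adm: "admissible p 0 (1 / p)" using assms by (simp add: admissible_def)
  have fin: "partition_fn p 0 (1 / p) < \<infinity>" by (rule admissible_finite[OF adm])
  show m: "0 < mass p" unfolding mass_def by (rule pfun_pos[OF fin])
  show eq: "partition_fn p 0 (1 / p) = ennreal (mass p)" unfolding mass_def by (rule partition_fn_eq_pfun[OF fin])
  have "ennreal (mass p) = ennreal (2 * p powr (1 / p) * Gamma (1 + 1 / p))"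
    using partition_fn_normalization[of p] assms eq by simp
  moreover have "0 \<le> 2 * p powr (1 / p) * Gamma (1 + 1 / p)"
    using assms by (intro mult_nonneg_nonneg less_imp_le[OF Gamma_real_pos]) (auto simp: add_pos_pos)
  ultimately show "mass p = 2 * p powr (1 / p) * Gamma (1 + 1 / p)"
    using m by (simp add: ennreal_inj)
qed

lemma f_density_eq:
  assumes "2 \<le> p"
  shows "f_density p y = tilt p 0 (1 / p) y / mass p"
  using assms by (simp add: f_density_def tilt_def mass_eq(1))

lemma mass_2: "mass 2 = sqrt (2 * pi)"
proof -
  have "Gamma (1 + 1 / 2 :: real) = sqrt pi / 2"
  proof -
    have "(1 / 2 :: real) \<notin> \<int>\<^sub>\<le>\<^sub>0" using nonpos_Ints_nonpos[of "1 / 2 :: real"] by auto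
    then show ?thesis using Gamma_plus1[of "1 / 2 :: real"] by (simp add: Gamma_one_half_real add.commute)
  qed
  then show ?thesis
    by (simp add: mass_eq(1) powr_half_sqrt real_sqrt_mult)
qed

lemma f_density_2: "f_density 2 z = exp (- z\<^sup>2 / 2) / sqrt (2 * pi)"
  by (simp add: f_density_eq tilt_def mass_2)

lemma f_density_measurable [measurable]: "f_density p \<in> borel_measurable borel"
  unfolding f_density_def[abs_def] by measurable

lemma f_density_nonneg: "2 \<le> p \<Longrightarrow> 0 \<le> f_density p y"
  using mass_eq(2)[of p] by (simp add: f_density_eq)

lemma nn_integral_mu:
  assumes "f \<in> borel_measurable borel"
  shows "(\<integral>\<^sup>+y. f y \<partial>\<mu> p) = (\<integral>\<^sup>+y. ennreal (f_density p y) * f y \<partial>lborel)"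
  unfolding \<mu>_def using assms by (subst nn_integral_density) auto

lemma prob_space_mu:
  assumes "2 \<le> p"
  shows "prob_space (\<mu> p)"
proof
  have "emeasure (\<mu> p) (space (\<mu> p)) = (\<integral>\<^sup>+y. ennreal (f_density p y) \<partial>lborel)"
    unfolding \<mu>_def by (subst emeasure_density) (auto intro!: nn_integral_cong)
  also have "\<dots> = (\<integral>\<^sup>+y. ennreal (1 / mass p) * ennreal (tilt p 0 (1 / p) y) \<partial>lborel)"
    using mass_eq(2)[OF assms] by (intro nn_integral_cong) (simp add: f_density_eq[OF assms] ennreal_mult[symmetric])
  also have "\<dots> = ennreal (1 / mass p) * partition_fn p 0 (1 / p)"
    unfolding partition_fn_def by (rule nn_integral_cmult) measurable
  also have "\<dots> = 1"
    using mass_eq(2)[OF assms] by (simp add: mass_eq(3)[OF assms] ennreal_mult[symmetric])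
  finally show "emeasure (\<mu> p) (space (\<mu> p)) = 1" .
qed

section \<open>Evaluation of \<Phi>\<close>

lemma inner_integral:
  assumes "t0 < 1 / 2"
  shows "(\<integral>\<^sup>+z. ennreal (exp (t0 * z\<^sup>2 + t1 * z * y + t2 * \<bar>y\<bar> powr p)) \<partial>\<mu> 2)
    = ennreal (exp (t1\<^sup>2 / (2 * (1 - 2 * t0)) * y\<^sup>2 + t2 * \<bar>y\<bar> powr p) / sqrt (1 - 2 * t0))"
proof -
  define a where "a = 1 / 2 - t0"
  have a: "0 < a" "1 - 2 * t0 = 2 * a" using assms by (auto simp: a_def)
  have "(\<integral>\<^sup>+z. ennreal (exp (t0 * z\<^sup>2 + t1 * z * y + t2 * \<bar>y\<bar> powr p)) \<partial>\<mu> 2)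
     = (\<integral>\<^sup>+z. ennreal (f_density 2 z) * ennreal (exp (t0 * z\<^sup>2 + t1 * z * y + t2 * \<bar>y\<bar> powr p)) \<partial>lborel)"
    by (rule nn_integral_mu) measurable
  also have "\<dots> = (\<integral>\<^sup>+z. ennreal (exp (t2 * \<bar>y\<bar> powr p) / sqrt (2 * pi)) * ennreal (exp ((t1 * y) * z - a * z\<^sup>2)) \<partial>lborel)"
    by (intro nn_integral_cong) (simp add: f_density_2 a_def ennreal_mult[symmetric] exp_add[symmetric] algebra_simps)
  also have "\<dots> = ennreal (exp (t2 * \<bar>y\<bar> powr p) / sqrt (2 * pi)) * ennreal (sqrt (pi / a) * exp ((t1 * y)\<^sup>2 / (4 * a)))"
    using a by (subst nn_integral_cmult) (simp_all add: nn_integral_gauss)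
  also have "\<dots> = ennreal (exp (t2 * \<bar>y\<bar> powr p) / sqrt (2 * pi) * (sqrt (pi / a) * exp ((t1 * y)\<^sup>2 / (4 * a))))"
    using a by (intro ennreal_mult[symmetric]) auto
  also have "exp (t2 * \<bar>y\<bar> powr p) / sqrt (2 * pi) * (sqrt (pi / a) * exp ((t1 * y)\<^sup>2 / (4 * a)))
     = exp (t1\<^sup>2 / (2 * (2 * a)) * y\<^sup>2 + t2 * \<bar>y\<bar> powr p) / sqrt (2 * a)"
  proof -
    have sq: "sqrt (pi / a) / sqrt (2 * pi) = 1 / sqrt (2 * a)"
      using a by (simp add: real_sqrt_mult real_sqrt_divide field_simps)
    have "exp (t2 * \<bar>y\<bar> powr p) / sqrt (2 * pi) * (sqrt (pi / a) * exp ((t1 * y)\<^sup>2 / (4 * a)))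
      = (sqrt (pi / a) / sqrt (2 * pi)) * (exp ((t1 * y)\<^sup>2 / (4 * a)) * exp (t2 * \<bar>y\<bar> powr p))" by simp
    also have "(t1 * y)\<^sup>2 / (4 * a) = t1\<^sup>2 / (2 * (2 * a)) * y\<^sup>2" by (simp add: power_mult_distrib)
    finally show ?thesis unfolding sq by (simp add: exp_add power_mult_distrib)
  qed
  finally show ?thesis unfolding a(2) .
qed

text \<open>The cross term has no fixed sign, so z is paired with -z: for one of them it is
  nonnegative, and the sum of the two integrands stays above a positive constant.\<close>

lemma inner_integral_infinite:
  assumes "1 / 2 \<le> t0"
  shows "(\<integral>\<^sup>+z. ennreal (exp (t0 * z\<^sup>2 + t1 * z * y + t2 * \<bar>y\<bar> powr p)) \<partial>\<mu> 2) = \<infinity>"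
proof -
  define f where "f = (\<lambda>z. f_density 2 z * exp (t0 * z\<^sup>2 + t1 * z * y + t2 * \<bar>y\<bar> powr p))"
  have [measurable]: "f \<in> borel_measurable borel" unfolding f_def by measurable
  define K where "K = exp (t2 * \<bar>y\<bar> powr p) / sqrt (2 * pi)"
  have K: "0 < K" by (simp add: K_def)
  have f_eq: "f z = K * exp ((t0 - 1 / 2) * z\<^sup>2 + t1 * y * z)" for z
    by (simp add: f_def K_def f_density_2 exp_add[symmetric] algebra_simps)
  have f0: "0 \<le> f z" for z using K by (simp add: f_eq)
  have sum: "K \<le> f z + f (- z)" for z
  proof (cases "0 \<le> t1 * y * z")
    case True
    then have "1 \<le> exp ((t0 - 1 / 2) * z\<^sup>2 + t1 * y * z)" using assms by simp
    then have "K * 1 \<le> f z" unfolding f_eq using K by (intro mult_left_mono) auto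
    then show ?thesis using f0[of "- z"] by simp
  next
    case False
    moreover have "0 \<le> (t0 - 1 / 2) * z\<^sup>2" using assms by simp
    ultimately have "1 \<le> exp ((t0 - 1 / 2) * (- z)\<^sup>2 + t1 * y * (- z))" by simp
    then have "K * 1 \<le> f (- z)" unfolding f_eq using K by (intro mult_left_mono) auto
    then show ?thesis using f0[of z] by simp
  qed
  have refl: "(\<integral>\<^sup>+z. ennreal (f z) \<partial>lborel) = (\<integral>\<^sup>+z. ennreal (f (- z)) \<partial>lborel)"
    using nn_integral_real_affine[of "\<lambda>z. ennreal (f z)" "- 1" 0] by simp
  have "\<infinity> = (\<integral>\<^sup>+z. ennreal K \<partial>(lborel :: real measure))"
    using K by (simp add: ennreal_mult_top)
  also have "\<dots> \<le> (\<integral>\<^sup>+z. ennreal (f z) + ennreal (f (- z)) \<partial>lborel)"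
    using sum f0 by (intro nn_integral_mono) (simp add: ennreal_plus[symmetric] ennreal_leI del: ennreal_plus)
  also have "\<dots> = (\<integral>\<^sup>+z. ennreal (f z) \<partial>lborel) + (\<integral>\<^sup>+z. ennreal (f z) \<partial>lborel)"
    by (subst nn_integral_add) (simp_all add: refl)
  finally have "(\<integral>\<^sup>+z. ennreal (f z) \<partial>lborel) = \<infinity>" by (simp add: top_unique)
  moreover have "(\<integral>\<^sup>+z. ennreal (exp (t0 * z\<^sup>2 + t1 * z * y + t2 * \<bar>y\<bar> powr p)) \<partial>\<mu> 2) = (\<integral>\<^sup>+z. ennreal (f z) \<partial>lborel)"
    by (subst nn_integral_mu) (auto simp: f_def f_density_nonneg ennreal_mult intro!: nn_integral_cong)
  ultimately show ?thesis by simp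
qed

lemma Phi_infinite:
  assumes p: "2 \<le> p" and "1 / 2 \<le> t0"
  shows "\<Phi> p (t0, t1, t2) = \<infinity>"
proof -
  interpret prob_space "\<mu> p" by (rule prob_space_mu[OF p])
  show ?thesis
    using assms by (simp add: \<Phi>_def inner_integral_infinite emeasure_space_1)
qed

lemma Phi_eq:
  assumes p: "2 \<le> p" and t0: "t0 < 1 / 2"
  shows "\<Phi> p (t0, t1, t2) = elog (ennreal (1 / (mass p * sqrt (1 - 2 * t0))) * partition_fn p (t1\<^sup>2 / (2 * (1 - 2 * t0))) (1 / p - t2))"
proof -
  define a where "a = t1\<^sup>2 / (2 * (1 - 2 * t0))"
  have "(\<integral>\<^sup>+y. ennreal (exp (a * y\<^sup>2 + t2 * \<bar>y\<bar> powr p) / sqrt (1 - 2 * t0)) \<partial>\<mu> p)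
    = (\<integral>\<^sup>+y. ennreal (f_density p y) * ennreal (exp (a * y\<^sup>2 + t2 * \<bar>y\<bar> powr p) / sqrt (1 - 2 * t0)) \<partial>lborel)"
    by (rule nn_integral_mu) measurable
  also have "\<dots> = (\<integral>\<^sup>+y. ennreal (1 / (mass p * sqrt (1 - 2 * t0))) * ennreal (tilt p a (1 / p - t2) y) \<partial>lborel)"
  proof (rule nn_integral_cong)
    fix y
    have "f_density p y * (exp (a * y\<^sup>2 + t2 * \<bar>y\<bar> powr p) / sqrt (1 - 2 * t0))
      = 1 / (mass p * sqrt (1 - 2 * t0)) * (tilt p 0 (1 / p) y * exp (a * y\<^sup>2 + t2 * \<bar>y\<bar> powr p))"
      by (simp add: f_density_eq[OF p])
    also have "tilt p 0 (1 / p) y * exp (a * y\<^sup>2 + t2 * \<bar>y\<bar> powr p) = tilt p a (1 / p - t2) y"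
      by (simp add: tilt_def exp_add[symmetric] algebra_simps)
    finally show "ennreal (f_density p y) * ennreal (exp (a * y\<^sup>2 + t2 * \<bar>y\<bar> powr p) / sqrt (1 - 2 * t0))
      = ennreal (1 / (mass p * sqrt (1 - 2 * t0))) * ennreal (tilt p a (1 / p - t2) y)"
      using mass_eq(2)[OF p] t0 f_density_nonneg[OF p, of y] by (simp add: ennreal_mult[symmetric])
  qed
  also have "\<dots> = ennreal (1 / (mass p * sqrt (1 - 2 * t0))) * partition_fn p a (1 / p - t2)"
    unfolding partition_fn_def by (rule nn_integral_cmult) measurable
  finally show ?thesis
    using t0 by (simp add: \<Phi>_def inner_integral a_def)
qed

lemma Phi_finite:
  assumes p: "2 \<le> p" and t0: "t0 < 1 / 2" and fin: "partition_fn p (t1\<^sup>2 / (2 * (1 - 2 * t0))) (1 / p - t2) < \<infinity>"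
  shows "\<Phi> p (t0, t1, t2) = ereal (ln (pfun p (t1\<^sup>2 / (2 * (1 - 2 * t0))) (1 / p - t2)) - ln (mass p) - ln (1 - 2 * t0) / 2)"
proof -
  have pos: "0 < pfun p (t1\<^sup>2 / (2 * (1 - 2 * t0))) (1 / p - t2)" by (rule pfun_pos[OF fin])
  have "\<Phi> p (t0, t1, t2) = elog (ennreal (1 / (mass p * sqrt (1 - 2 * t0)) * pfun p (t1\<^sup>2 / (2 * (1 - 2 * t0))) (1 / p - t2)))"
    unfolding Phi_eq[OF p t0] partition_fn_eq_pfun[OF fin]
    using mass_eq(2)[OF p] pos t0 by (subst ennreal_mult) auto
  also have "\<dots> = ereal (ln (1 / (mass p * sqrt (1 - 2 * t0)) * pfun p (t1\<^sup>2 / (2 * (1 - 2 * t0))) (1 / p - t2)))"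
    using mass_eq(2)[OF p] pos t0 by (intro elog_ennreal) auto
  also have "ln (1 / (mass p * sqrt (1 - 2 * t0)) * pfun p (t1\<^sup>2 / (2 * (1 - 2 * t0))) (1 / p - t2))
    = ln (pfun p (t1\<^sup>2 / (2 * (1 - 2 * t0))) (1 / p - t2)) - ln (mass p) - ln (1 - 2 * t0) / 2"
    using mass_eq(2)[OF p] pos t0 by (simp add: ln_div ln_mult ln_sqrt)
  finally show ?thesis .
qed

lemma Phi_lt_top_iff:
  assumes p: "2 \<le> p"
  shows "\<Phi> p (t0, t1, t2) \<noteq> \<infinity> \<longleftrightarrow> t0 < 1 / 2 \<and> partition_fn p (t1\<^sup>2 / (2 * (1 - 2 * t0))) (1 / p - t2) < \<infinity>"
proof (cases "t0 < 1 / 2")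
  case True
  show ?thesis
  proof (cases "partition_fn p (t1\<^sup>2 / (2 * (1 - 2 * t0))) (1 / p - t2) < \<infinity>")
    case False
    then have "partition_fn p (t1\<^sup>2 / (2 * (1 - 2 * t0))) (1 / p - t2) = \<infinity>" by (simp add: less_top[symmetric])
    moreover have "0 < 1 / (mass p * sqrt (1 - 2 * t0))" using mass_eq(2)[OF p] True by simp
    ultimately have "ennreal (1 / (mass p * sqrt (1 - 2 * t0))) * partition_fn p (t1\<^sup>2 / (2 * (1 - 2 * t0))) (1 / p - t2) = \<infinity>"
      by (simp add: ennreal_mult_top ennreal_eq_0_iff)
    then show ?thesis using Phi_eq[OF p True] False by simp
  qed (use True in \<open>simp add: Phi_finite[OF p]\<close>)
qed (use Phi_infinite[OF p] in simp)

text \<open>Excludes -\<infinity>, so that subtracting \<Phi> in the extended reals is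
  harmless.\<close>

lemma Phi_cases:
  assumes p: "2 \<le> p"
  obtains "\<Phi> p t = \<infinity>" | r where "\<Phi> p t = ereal r"
proof -
  obtain t0 t1 t2 where t: "t = (t0, t1, t2)" using prod_cases3 by blast
  show ?thesis
    using that Phi_lt_top_iff[OF p, of t0 t1 t2] Phi_finite[OF p, of t0 t1 t2] unfolding t by metis
qed

text \<open>For every t with finite \<Phi> there is a point s whose dual value at \<tau> exceeds
  that of t at (1, w, 1) by \<open>(\<tau>0 - 1 - ln \<tau>0) / 2 + (\<tau>2 - 1 - ln \<tau>2) /
  p\<close>, which is nonnegative.\<close>

lemma I_an_eq:
  assumes p: "2 \<le> p"
  shows "I_an p w = legendre (\<Phi> p) (1, w, 1)"
proof (rule antisym)
  show "I_an p w \<le> legendre (\<Phi> p) (1, w, 1)"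
    unfolding I_an_def
    by (intro Inf_lower CollectI) (rule exI[of _ 1], rule exI[of _ w], rule exI[of _ 1], simp)
  show "legendre (\<Phi> p) (1, w, 1) \<le> I_an p w"
    unfolding I_an_def
  proof (rule Inf_greatest, safe)
    fix x \<tau>0 \<tau>1 \<tau>2 :: real
    assume \<tau>: "0 < \<tau>0" "0 < \<tau>2" and w: "w = \<tau>0 powr (- 1 / 2) * \<tau>1 * \<tau>2 powr (- 1 / p)"
    show "legendre (\<Phi> p) (1, \<tau>0 powr (- 1 / 2) * \<tau>1 * \<tau>2 powr (- 1 / p), 1) \<le> legendre (\<Phi> p) (\<tau>0, \<tau>1, \<tau>2)"
      unfolding legendre_def w[symmetric]
    proof (rule SUP_least)
      fix t :: "real \<times> real \<times> real"
      obtain t0 t1 t2 where t: "t = (t0, t1, t2)" using prod_cases3 by blast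
      show "ereal (t \<bullet> (1, w, 1)) - \<Phi> p t \<le> (SUP t. ereal (t \<bullet> (\<tau>0, \<tau>1, \<tau>2)) - \<Phi> p t)"
      proof (cases "\<Phi> p t = \<infinity>")
        case False
        then have t0: "t0 < 1 / 2" and fin: "partition_fn p (t1\<^sup>2 / (2 * (1 - 2 * t0))) (1 / p - t2) < \<infinity>"
          using Phi_lt_top_iff[OF p] t by auto
        \<comment> \<open>The full coefficients of z^2, z y and |y|^p, those of the reference
          densities included, are divided by \<tau>0, \<tau>0^(1/2) \<tau>2^(1/p) and \<tau>2: the
          effect of rescaling z and y.\<close>
        define s0 where "s0 = 1 / 2 - (1 / 2 - t0) / \<tau>0"
        define s1 where "s1 = t1 * \<tau>0 powr (- 1 / 2) * \<tau>2 powr (- 1 / p)"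
        define s2 where "s2 = 1 / p - (1 / p - t2) / \<tau>2"
        define r where "r = \<tau>2 powr (- 1 / p)"
        have r: "0 < r" "r powr p = 1 / \<tau>2" using \<tau> p by (auto simp: r_def powr_powr powr_divide powr_minus_divide)
        have s0: "1 - 2 * s0 = (1 - 2 * t0) / \<tau>0"
        proof -
          have "1 - 2 * s0 = 2 * (1 / 2 - t0) / \<tau>0" by (simp add: s0_def)
          also have "2 * (1 / 2 - t0) = 1 - 2 * t0" by simp
          finally show ?thesis .
        qed
        have "0 < (1 - 2 * t0) / \<tau>0" using t0 \<tau> by simp
        then have s0': "s0 < 1 / 2" unfolding s0[symmetric] by simp
        have root0: "(\<tau>0 powr (- 1 / 2))\<^sup>2 = 1 / \<tau>0"
          unfolding power2_eq_square powr_add[symmetric] using \<tau> by (simp add: powr_minus_divide)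
        have eq1: "s1\<^sup>2 / (2 * (1 - 2 * s0)) = t1\<^sup>2 / (2 * (1 - 2 * t0)) * r\<^sup>2"
          unfolding s0 s1_def power_mult_distrib root0 r_def[symmetric] using \<tau> t0 by simp
        have eq2: "1 / p - s2 = (1 / p - t2) * r powr p" by (simp add: s2_def r(2))
        have fin': "partition_fn p (s1\<^sup>2 / (2 * (1 - 2 * s0))) (1 / p - s2) < \<infinity>"
          unfolding eq1 eq2 by (rule pfun_scale(1)[OF fin r(1)])
        define Z where "Z = pfun p (t1\<^sup>2 / (2 * (1 - 2 * t0))) (1 / p - t2)"
        define Z' where "Z' = pfun p (s1\<^sup>2 / (2 * (1 - 2 * s0))) (1 / p - s2)"
        have Z: "Z = r * Z'" unfolding Z_def Z'_def eq1 eq2 by (rule pfun_scale(2)[OF fin r(1)])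
        have Z': "0 < Z'" unfolding Z'_def by (rule pfun_pos[OF fin'])
        have lnZ: "ln Z = ln Z' - ln \<tau>2 / p" unfolding Z using r Z' \<tau> by (simp add: ln_mult r_def ln_powr)
        have ln0: "ln (1 - 2 * s0) = ln (1 - 2 * t0) - ln \<tau>0" unfolding s0 using \<tau> t0 by (simp add: ln_div)
        have st: "(s0, s1, s2) \<bullet> (\<tau>0, \<tau>1, \<tau>2) = \<tau>0 / 2 - 1 / 2 + t0 + t1 * w + \<tau>2 / p - 1 / p + t2"
          using \<tau> by (simp add: s0_def s1_def s2_def w field_simps)
        have tt: "t \<bullet> (1, w, 1) = t0 + t1 * w + t2" by (simp add: t)
        have "ln \<tau>0 / 2 \<le> \<tau>0 / 2 - 1 / 2" using ln_le_minus_one[OF \<tau>(1)] by simp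
        moreover have "ln \<tau>2 / p \<le> \<tau>2 / p - 1 / p"
        proof -
          have "ln \<tau>2 / p \<le> (\<tau>2 - 1) / p" using ln_le_minus_one[OF \<tau>(2)] p by (intro divide_right_mono) auto
          then show ?thesis by (simp add: diff_divide_distrib)
        qed
        ultimately have "ereal (t \<bullet> (1, w, 1)) - \<Phi> p t \<le> ereal ((s0, s1, s2) \<bullet> (\<tau>0, \<tau>1, \<tau>2)) - \<Phi> p (s0, s1, s2)"
          unfolding t Phi_finite[OF p t0 fin] Phi_finite[OF p s0' fin'] Z_def[symmetric] Z'_def[symmetric] lnZ ln0 st tt[unfolded t]
          by (simp add: diff_divide_distrib)
        note D = this
        show ?thesis by (rule SUP_upper2[of "(s0, s1, s2)"]) (use D in simp_all)
      qed simp
    qed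
  qed
qed

section \<open>Properties of the rate function\<close>

lemma I_an_ge:
  assumes "2 \<le> p"
  shows "ereal (t0 + t1 * w + t2) - \<Phi> p (t0, t1, t2) \<le> I_an p w"
  unfolding I_an_eq[OF assms] legendre_def by (rule SUP_upper2[of "(t0, t1, t2)"]) (simp_all add: add.assoc)

lemma I_an_le_iff:
  assumes "2 \<le> p"
  shows "I_an p w \<le> c \<longleftrightarrow> (\<forall>t0 t1 t2. ereal (t0 + t1 * w + t2) - \<Phi> p (t0, t1, t2) \<le> c)"
  unfolding I_an_eq[OF assms] legendre_def SUP_le_iff by (auto simp: add.assoc)

lemma less_I_an_iff:
  assumes "2 \<le> p"
  shows "c < I_an p w \<longleftrightarrow> (\<exists>t0 t1 t2. c < ereal (t0 + t1 * w + t2) - \<Phi> p (t0, t1, t2))"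
  unfolding I_an_eq[OF assms] legendre_def less_SUP_iff by (auto simp: add.assoc)

lemma Phi_minus:
  assumes "2 \<le> p"
  shows "\<Phi> p (t0, - t1, t2) = \<Phi> p (t0, t1, t2)"
  by (cases "t0 < 1 / 2") (simp_all add: Phi_eq[OF assms] Phi_infinite[OF assms])

lemma I_an_symmetric:
  assumes p: "2 \<le> p"
  shows "I_an p (- w) = I_an p w"
proof -
  have "I_an p (- w) \<le> I_an p w" for w
    unfolding I_an_le_iff[OF p, of "- w"]
  proof (intro allI)
    fix t0 t1 t2
    show "ereal (t0 + t1 * - w + t2) - \<Phi> p (t0, t1, t2) \<le> I_an p w"
      using I_an_ge[OF p, of t0 "- t1" w t2] by (simp add: Phi_minus[OF p])
  qed
  from this[of w] this[of "- w"] show ?thesis by (intro antisym) simp_all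
qed

lemma I_an_nonneg:
  assumes p: "2 \<le> p"
  shows "0 \<le> I_an p w"
proof -
  have "\<Phi> p (0, 0, 0) = 0"
    using mass_eq(2)[OF p] elog_ennreal[of 1] Phi_eq[OF p, of 0 0 0]
    by (simp add: mass_eq(3)[OF p, simplified] ennreal_mult[symmetric])
  then show ?thesis using I_an_ge[OF p, of 0 0 w 0] by (simp add: zero_ereal_def)
qed

text \<open>The rate is a supremum of functions of w that are affine or identically -\<infinity>;
  quasiconvexity below has the same source.\<close>

lemma I_an_lsc:
  assumes p: "2 \<le> p"
  shows "lower_semicontinuous (I_an p)"
  unfolding lower_semicontinuous_def
proof (intro allI impI)
  fix x c assume "c < I_an p x"
  then obtain t0 t1 t2 where c: "c < ereal (t0 + t1 * x + t2) - \<Phi> p (t0, t1, t2)"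
    unfolding less_I_an_iff[OF p] by blast
  show "eventually (\<lambda>y. c < I_an p y) (nhds x)"
  proof (cases rule: Phi_cases[OF p, of "(t0, t1, t2)"])
    case 1
    then show ?thesis using c by simp
  next
    case (2 r)
    have "((\<lambda>y. ereal (t0 + t1 * y + t2 - r)) \<longlongrightarrow> ereal (t0 + t1 * x + t2 - r)) (nhds x)"
      by (intro tendsto_intros filterlim_ident)
    then have "eventually (\<lambda>y. c < ereal (t0 + t1 * y + t2 - r)) (nhds x)"
      using c 2 by (intro order_tendstoD) auto
    then show ?thesis
    proof eventually_elim
      case (elim y)
      also have "ereal (t0 + t1 * y + t2 - r) \<le> I_an p y" using I_an_ge[OF p, of t0 t1 y t2] 2 by simp
      finally show ?case .
    qed
  qed
qed

lemma I_an_quasiconvex: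
  assumes p: "2 \<le> p"
  shows "quasiconvex (I_an p)"
  unfolding quasiconvex_def convex_alt
proof (intro allI ballI impI)
  fix c x y u :: real
  assume x: "x \<in> {w. I_an p w \<le> ereal c}" and y: "y \<in> {w. I_an p w \<le> ereal c}" and u: "0 \<le> u \<and> u \<le> 1"
  have "I_an p ((1 - u) * x + u * y) \<le> ereal c"
    unfolding I_an_le_iff[OF p]
  proof (intro allI)
    fix t0 t1 t2
    show "ereal (t0 + t1 * ((1 - u) * x + u * y) + t2) - \<Phi> p (t0, t1, t2) \<le> ereal c"
    proof (cases rule: Phi_cases[OF p, of "(t0, t1, t2)"])
      case (2 r)
      have "ereal (t0 + t1 * x + t2) - \<Phi> p (t0, t1, t2) \<le> ereal c" "ereal (t0 + t1 * y + t2) - \<Phi> p (t0, t1, t2) \<le> ereal c"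
        using x y order_trans[OF I_an_ge[OF p, of t0 t1 _ t2]] by blast+
      then have "t0 + t1 * x + t2 - r \<le> c" "t0 + t1 * y + t2 - r \<le> c" using 2 by auto
      then have "(1 - u) * (t0 + t1 * x + t2 - r) + u * (t0 + t1 * y + t2 - r) \<le> (1 - u) * c + u * c"
        using u by (intro add_mono mult_left_mono) auto
      then show ?thesis using 2 by (simp add: algebra_simps)
    qed simp
  qed
  then show "(1 - u) *\<^sub>R x + u *\<^sub>R y \<in> {w. I_an p w \<le> ereal c}" by simp
qed

lemma sq_le_powr:
  fixes p y :: real
  assumes p: "2 \<le> p"
  shows "y\<^sup>2 \<le> 2 / p * \<bar>y\<bar> powr p + (1 - 2 / p)"
proof (cases "y = 0")
  case False
  have "(\<bar>y\<bar> powr p) powr (2 / p) * 1 powr (1 - 2 / p) \<le> 2 / p * (\<bar>y\<bar> powr p) + (1 - 2 / p) * 1"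
    using p False by (intro Youngs_inequality_0) auto
  moreover have "(\<bar>y\<bar> powr p) powr (2 / p) = y\<^sup>2" using p False by (simp add: powr_powr powr_numeral)
  ultimately show ?thesis by simp
qed (use p in simp)

text \<open>Along \<open>\<lambda> (-1/2, 1, -1/p)\<close> the exponent in the definition of \<open>\<Phi>\<close> is bounded by Young's inequality.\<close>

lemma I_an_infinite_pos:
  assumes p: "2 \<le> p" and w: "1 < w"
  shows "I_an p w = \<infinity>"
proof -
  interpret Z: prob_space "\<mu> 2" by (rule prob_space_mu) simp
  interpret Y: prob_space "\<mu> p" by (rule prob_space_mu[OF p])
  \<comment> \<open>The chosen dual point yields
    \<open>l * (- 1/2 + w - 1/p) - C = l * (w - 1)\<close>, unbounded in l. This mirrors
    \<bar>W\<bar> \<le> 1, a consequence of Cauchy-Schwarz and the comparison of the 2-norm with the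
    p-norm.\<close>
  have le: "ereal (l * (w - 1)) \<le> I_an p w" if l: "0 \<le> l" for l
  proof -
    define C where "C = l * (1 / 2 - 1 / p)"
    have "\<Phi> p (- l / 2, l, - l / p) \<le> elog (ennreal (exp C))"
      unfolding \<Phi>_def prod.case
    proof (rule elog_mono)
      have pw: "- l / 2 * z\<^sup>2 + l * z * y + - l / p * \<bar>y\<bar> powr p \<le> C" for y z
      proof -
        have "2 * (z * y) \<le> z\<^sup>2 + y\<^sup>2" using sum_squares_bound[of z y] by simp
        then have "z * y \<le> z\<^sup>2 / 2 + y\<^sup>2 / 2" by simp
        moreover have "y\<^sup>2 / 2 \<le> (2 / p * \<bar>y\<bar> powr p + (1 - 2 / p)) / 2"
          using sq_le_powr[OF p, of y] by (rule divide_right_mono) simp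
        moreover have "(2 / p * \<bar>y\<bar> powr p + (1 - 2 / p)) / 2 = 1 / p * \<bar>y\<bar> powr p + (1 / 2 - 1 / p)"
          by (simp add: field_simps)
        ultimately have "- z\<^sup>2 / 2 + z * y - 1 / p * \<bar>y\<bar> powr p \<le> 1 / 2 - 1 / p" by linarith
        from mult_left_mono[OF this l] show ?thesis by (simp add: C_def algebra_simps)
      qed
      have "(\<integral>\<^sup>+y. \<integral>\<^sup>+z. ennreal (exp (- l / 2 * z\<^sup>2 + l * z * y + - l / p * \<bar>y\<bar> powr p)) \<partial>\<mu> 2 \<partial>\<mu> p)
         \<le> (\<integral>\<^sup>+y. \<integral>\<^sup>+z. ennreal (exp C) \<partial>\<mu> 2 \<partial>\<mu> p)"
        using pw by (intro nn_integral_mono ennreal_leI) simp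
      also have "\<dots> = ennreal (exp C)" by (simp add: Z.emeasure_space_1 Y.emeasure_space_1)
      finally show "(\<integral>\<^sup>+y. \<integral>\<^sup>+z. ennreal (exp (- l / 2 * z\<^sup>2 + l * z * y + - l / p * \<bar>y\<bar> powr p)) \<partial>\<mu> 2 \<partial>\<mu> p) \<le> ennreal (exp C)" .
    qed
    then have "\<Phi> p (- l / 2, l, - l / p) \<le> ereal C" by simp
    then have "ereal (- l / 2 + l * w + - l / p) - ereal C \<le> ereal (- l / 2 + l * w + - l / p) - \<Phi> p (- l / 2, l, - l / p)"
      by (intro ereal_minus_mono order_refl)
    also have "\<dots> \<le> I_an p w" by (rule I_an_ge[OF p])
    finally show ?thesis by (simp add: C_def algebra_simps)
  qed
  have "ereal B \<le> I_an p w" for B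
  proof -
    have "B \<le> \<bar>B\<bar> / (w - 1) * (w - 1)" using w by simp
    then have "ereal B \<le> ereal (\<bar>B\<bar> / (w - 1) * (w - 1))" by simp
    also have "\<dots> \<le> I_an p w" using w by (intro le) simp
    finally show ?thesis .
  qed
  then show ?thesis by (rule ereal_top)
qed

lemma I_an_infinite:
  assumes p: "2 \<le> p" and w: "1 < \<bar>w\<bar>"
  shows "I_an p w = \<infinity>"
  using I_an_infinite_pos[OF p, of "\<bar>w\<bar>"] w I_an_symmetric[OF p, of w] by (auto simp: abs_if split: if_splits)

lemma I_an_good:
  assumes p: "2 \<le> p"
  shows "good_rate (I_an p)"
  unfolding good_rate_def
proof
  fix c
  have "{x. I_an p x \<le> ereal c} \<subseteq> {-1..1}"
  proof
    fix x assume "x \<in> {x. I_an p x \<le> ereal c}"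
    then have "\<not> 1 < \<bar>x\<bar>" using I_an_infinite[OF p, of x] by auto
    then show "x \<in> {-1..1}" by auto
  qed
  then have "bounded {x. I_an p x \<le> ereal c}" by (rule bounded_subset[rotated]) simp
  moreover have "closed {x. I_an p x \<le> ereal c}"
  proof -
    have "open {x. ereal c < I_an p x}"
      using I_an_lsc[OF p] unfolding lower_semicontinuous_def open_dist
      by (auto simp: eventually_nhds_metric)
    moreover have "- {x. I_an p x \<le> ereal c} = {x. ereal c < I_an p x}" by auto
    ultimately show ?thesis by (simp add: closed_def)
  qed
  ultimately show "compact {x. I_an p x \<le> ereal c}" by (simp add: compact_eq_bounded_closed)
qed


section \<open>The large deviation principle\<close>

text \<open>The law of W after conditioning on X. The sphere measure is a parameter, so that
  asymptotic bounds can be uniform in \<nu> and free of the underlying probability spaces.\<close>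

definition ball_sphere_law :: "nat \<Rightarrow> real \<Rightarrow> (nat \<Rightarrow> real) measure \<Rightarrow> real set \<Rightarrow> ennreal" where
  "ball_sphere_law n p \<nu> S =
     (\<integral>\<^sup>+x. emeasure \<nu> {\<theta> \<in> space \<nu>. n powr (1/p) / n powr (1/2) * dot n x \<theta> \<in> S} * indicator (lp_ball n p) x \<partial>lborel_Rn n)
       / emeasure (lborel_Rn n) (lp_ball n p)"

lemma dot_measurable_comp:
  assumes "X \<in> measurable M (lborel_Rn n)" "Y \<in> measurable M (lborel_Rn n)"
  shows "(\<lambda>\<omega>. dot n (X \<omega>) (Y \<omega>)) \<in> borel_measurable M"
  using measurable_compose[OF measurable_Pair[OF assms] dot_measurable_pair] by simp

lemma ball_sphere_law_eq:
  assumes M: "prob_space M"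
    and X: "X \<in> measurable M (lborel_Rn n)" "distr M (lborel_Rn n) X = uniform_measure (lborel_Rn n) (lp_ball n p)"
    and \<Theta>: "\<Theta> \<in> measurable M (lborel_Rn n)"
    and indep: "prob_space.indep_var M (lborel_Rn n) X (lborel_Rn n) \<Theta>"
    and S [measurable]: "S \<in> sets borel"
  shows "emeasure M {\<omega> \<in> space M. n powr (1/p) / n powr (1/2) * dot n (X \<omega>) (\<Theta> \<omega>) \<in> S}
    = ball_sphere_law n p (distr M (lborel_Rn n) \<Theta>) S"
proof -
  interpret M: prob_space M by (rule M)
  define c where "c = n powr (1/p) / n powr (1/2)"
  define \<nu> where "\<nu> = distr M (lborel_Rn n) \<Theta>"
  define U where "U = uniform_measure (lborel_Rn n) (lp_ball n p)"
  interpret N: prob_space \<nu> unfolding \<nu>_def by (rule M.prob_space_distr[OF \<Theta>])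
  have sets_U: "sets U = sets (lborel_Rn n)" and sets_\<nu>: "sets \<nu> = sets (lborel_Rn n)"
    by (simp_all add: U_def \<nu>_def)
  have sp_\<nu>: "space \<nu> = space (lborel_Rn n)" by (simp add: \<nu>_def)
  have joint: "U \<Otimes>\<^sub>M \<nu> = distr M (lborel_Rn n \<Otimes>\<^sub>M lborel_Rn n) (\<lambda>\<omega>. (X \<omega>, \<Theta> \<omega>))"
    using indep X(2) unfolding M.indep_var_distribution_eq U_def \<nu>_def by simp
  have XT [measurable]: "(\<lambda>\<omega>. (X \<omega>, \<Theta> \<omega>)) \<in> measurable M (lborel_Rn n \<Otimes>\<^sub>M lborel_Rn n)"
    using X \<Theta> by simp
  define f where "f = (\<lambda>(x, \<theta>). c * dot n x \<theta>)"
  have f [measurable]: "f \<in> borel_measurable (lborel_Rn n \<Otimes>\<^sub>M lborel_Rn n)"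
    unfolding f_def split_beta using dot_measurable_pair[of n] by (simp add: split_beta)
  define E where "E = {z \<in> space (lborel_Rn n \<Otimes>\<^sub>M lborel_Rn n). f z \<in> S}"
  have E [measurable]: "E \<in> sets (lborel_Rn n \<Otimes>\<^sub>M lborel_Rn n)" unfolding E_def by measurable
  have E': "E \<in> sets (U \<Otimes>\<^sub>M \<nu>)" using E by (simp add: sets_pair_measure_cong[OF sets_U sets_\<nu>])
  have "{\<omega> \<in> space M. c * dot n (X \<omega>) (\<Theta> \<omega>) \<in> S} = (\<lambda>\<omega>. (X \<omega>, \<Theta> \<omega>)) -` E \<inter> space M"
    using measurable_space[OF X(1)] measurable_space[OF \<Theta>] by (auto simp: E_def f_def space_pair_measure)
  then have "emeasure M {\<omega> \<in> space M. c * dot n (X \<omega>) (\<Theta> \<omega>) \<in> S} = emeasure (U \<Otimes>\<^sub>M \<nu>) E"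
    unfolding joint by (subst emeasure_distr) auto
  also have "\<dots> = (\<integral>\<^sup>+x. emeasure \<nu> (Pair x -` E) \<partial>U)"
    by (rule N.emeasure_pair_measure_alt[OF E'])
  also have "\<dots> = (\<integral>\<^sup>+x. emeasure \<nu> (Pair x -` E) * indicator (lp_ball n p) x \<partial>lborel_Rn n) / emeasure (lborel_Rn n) (lp_ball n p)"
  proof -
    have "(\<lambda>x. emeasure \<nu> (Pair x -` E)) \<in> borel_measurable (lborel_Rn n)"
      using N.measurable_emeasure_Pair[OF E'] by (simp add: measurable_cong_sets[OF sets_U refl])
    then show ?thesis unfolding U_def by (rule nn_integral_uniform_measure) measurable
  qed
  also have "(\<integral>\<^sup>+x. emeasure \<nu> (Pair x -` E) * indicator (lp_ball n p) x \<partial>lborel_Rn n)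
     = (\<integral>\<^sup>+x. emeasure \<nu> {\<theta> \<in> space \<nu>. c * dot n x \<theta> \<in> S} * indicator (lp_ball n p) x \<partial>lborel_Rn n)"
  proof (rule nn_integral_cong)
    fix x assume "x \<in> space (lborel_Rn n)"
    then have "Pair x -` E = {\<theta> \<in> space \<nu>. c * dot n x \<theta> \<in> S}"
      by (auto simp: E_def f_def space_pair_measure sp_\<nu>)
    then show "emeasure \<nu> (Pair x -` E) * indicator (lp_ball n p) x
      = emeasure \<nu> {\<theta> \<in> space \<nu>. c * dot n x \<theta> \<in> S} * indicator (lp_ball n p) x" by simp
  qed
  finally show ?thesis unfolding ball_sphere_law_def c_def \<nu>_def .
qed

text \<open>The untilted case a = 0 of the shell estimate, where P = 1; the shell is then enlarged
  to the ball.\<close>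

lemma lp_ball_volume_lower:
  assumes p: "2 \<le> p" and \<zeta>: "0 < \<zeta>"
  shows "eventually (\<lambda>n. ennreal ((n powr (-1/p)) ^ n * exp (n * (ln (mass p) + 1 / p - \<zeta>)))
     \<le> emeasure (lborel_Rn n) (lp_ball n p)) sequentially"
proof -
  have adm: "admissible p 0 (1/p)" using p by (simp add: admissible_def)
  show ?thesis
    using lp_ball_shell_lower[OF adm order_refl \<zeta> zero_less_one]
  proof eventually_elim
    case (elim n)
    then have "ennreal ((n powr (-1/p)) ^ n * exp (n * (ln (mass p) + 1 / p - \<zeta>)))
      \<le> emeasure (lborel_Rn n) {x \<in> lp_ball n p. \<bar>sqrt (n powr (2/p) * sq_norm n x / n) - sqrt (mean_sq p 0 (1/p) * (1 + 2 * 0 * mean_sq p 0 (1/p)) powr (-2/p))\<bar> < 1}"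
      by (simp add: mass_def)
    also have "\<dots> \<le> emeasure (lborel_Rn n) (lp_ball n p)" by (intro emeasure_mono) auto
    finally show ?case .
  qed
qed

text \<open>For a = 0 the partition function is proportional to \<open>b powr (-1/p)\<close>, so b =
  1/p minimises the exponent b plus its logarithm. Hence the exponent matches the lower
  bound.\<close>

lemma lp_ball_volume_upper:
  assumes p: "2 \<le> p" and n: "1 \<le> n"
  shows "emeasure (lborel_Rn n) (lp_ball n p) \<le> ennreal ((n powr (-1/p)) ^ n * exp (n * (ln (mass p) + 1 / p)))"
proof -
  have "emeasure (lborel_Rn n) (lp_ball n p) = (\<integral>\<^sup>+x. ennreal (exp (0 * (n powr (2/p) * sq_norm n x))) * indicator (lp_ball n p) x \<partial>lborel_Rn n)"
    by (simp add: nn_integral_indicator)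
  also have "\<dots> \<le> ennreal (exp (n * (1/p))) * (ennreal (n powr (-1/p)) * partition_fn p 0 (1/p)) ^ n"
    using p n by (intro lp_ball_integral_upper) auto
  also have "\<dots> = ennreal (exp (n * (1/p)) * (n powr (-1/p) * mass p) ^ n)"
    using mass_eq(2)[OF p] by (simp add: mass_eq(3)[OF p, simplified] mass_eq(3)[OF p] ennreal_mult[symmetric] ennreal_power)
  also have "exp (n * (1/p)) * (n powr (-1/p) * mass p) ^ n = (n powr (-1/p)) ^ n * exp (n * (ln (mass p) + 1 / p))"
  proof -
    have "mass p ^ n = exp (n * ln (mass p))" using mass_eq(2)[OF p] by (simp add: exp_of_nat_mult)
    then show ?thesis by (simp add: power_mult_distrib distrib_left exp_add)
  qed
  finally show ?thesis .
qed

text \<open>One dual point t supplies every parameter: A and t1 for the spherical bound, whose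
  x-dependent factor is then integrated over the ball with the parameters a and b. Division by the
  volume leaves the exponent \<open>\<Phi>(t) - (t0 + t1 * w + t2)\<close>. The sign \<sigma> treats
  both tails at once.\<close>

lemma ball_sphere_law_upper:
  fixes c w \<sigma> :: real
  assumes p: "2 \<le> p" and w: "0 \<le> w" and c: "ereal c < I_an p w" and \<sigma>: "\<sigma> = 1 \<or> \<sigma> = - 1"
  shows "eventually (\<lambda>n. \<forall>\<nu>. sphere_uniform n \<nu> \<longrightarrow>
    ball_sphere_law n p \<nu> {v. w \<le> \<sigma> * v} \<le> ennreal (exp (- (n * c)))) sequentially"
proof -
  obtain t0 t1' t2 where t': "ereal c < ereal (t0 + t1' * w + t2) - \<Phi> p (t0, t1', t2)"
    using c unfolding less_I_an_iff[OF p] by blast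
  \<comment> \<open>\<Phi> is even in \<open>t1\<close> and w \<ge> 0, so the absolute value only
    improves the dual value; the cap estimate takes nonnegative slopes.\<close>
  define t1 where "t1 = \<bar>t1'\<bar>"
  have t1: "0 \<le> t1" by (simp add: t1_def)
  have Phi_eq: "\<Phi> p (t0, t1', t2) = \<Phi> p (t0, t1, t2)"
    by (auto simp: t1_def abs_if Phi_minus[OF p])
  have nfin: "\<Phi> p (t0, t1, t2) \<noteq> \<infinity>" using t' unfolding Phi_eq by auto
  then have t0: "t0 < 1/2" and fin: "partition_fn p (t1\<^sup>2 / (2 * (1 - 2 * t0))) (1 / p - t2) < \<infinity>"
    using Phi_lt_top_iff[OF p] by auto
  define A where "A = 1 - 2 * t0"
  define a where "a = t1\<^sup>2 / (2 * A)"
  define b where "b = 1 / p - t2"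
  have A: "0 < A" using t0 by (simp add: A_def)
  have a: "0 \<le> a" using A by (simp add: a_def)
  have fin': "partition_fn p a b < \<infinity>" using fin by (simp add: a_def b_def A_def)
  have b: "0 < b" using partition_fn_infinite[OF a, of b p] fin' by (cases "b \<le> 0") auto
  define Z where "Z = pfun p a b"
  have Z: "0 < Z" "partition_fn p a b = ennreal Z" using fin' by (auto simp: Z_def pfun_pos partition_fn_eq_pfun)
  define g where "g = t0 + t1 * w + t2 - (ln Z - ln (mass p) - ln A / 2) - c"
  have g: "0 < g"
  proof -
    have "t1' * w \<le> t1 * w" using w by (intro mult_right_mono) (auto simp: t1_def)
    moreover have "c < t0 + t1' * w + t2 - (ln Z - ln (mass p) - ln A / 2)"
      using t' unfolding Phi_eq Phi_finite[OF p t0 fin] by (simp add: Z_def a_def b_def A_def)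
    ultimately show ?thesis by (simp add: g_def)
  qed
  \<comment> \<open>The slack is split between the cap estimate and the lower bound for the
    volume.\<close>
  define \<zeta> where "\<zeta> = g / 2"
  have \<zeta>: "0 < \<zeta>" using g by (simp add: \<zeta>_def)
  show ?thesis
    using sphere_cap_upper[OF A \<zeta>] lp_ball_volume_lower[OF p \<zeta>] eventually_ge_at_top[of 1]
  proof eventually_elim
    case (elim n)
    define N where "N = (n powr (-1/p)) ^ n"
    have N: "0 < N" using elim by (simp add: N_def)
    define V where "V = N * exp (n * (ln (mass p) + 1 / p - \<zeta>))"
    have V: "0 < V" "ennreal V \<le> emeasure (lborel_Rn n) (lp_ball n p)" using N elim by (auto simp: V_def N_def)
    define E where "E = exp (- t1 * n * w + n * ((A - 1 - ln A) / 2 + \<zeta>))"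
    show ?case
    proof (intro allI impI)
      fix \<nu> assume \<nu>: "sphere_uniform n \<nu>"
      have cap: "emeasure \<nu> {\<theta> \<in> space \<nu>. n powr (1/p) / n powr (1/2) * dot n x \<theta> \<in> {v. w \<le> \<sigma> * v}}
          \<le> ennreal E * ennreal (exp (a * (n powr (2/p) * sq_norm n x)))" for x
      proof -
        define y where "y = (\<lambda>i. \<sigma> * (n powr (1/p) * x i))"
        have "(y i)\<^sup>2 = (n powr (1/p) * x i)\<^sup>2" for i using \<sigma> by (auto simp: y_def)
        then have sqy: "sq_norm n y = n powr (2/p) * sq_norm n x"
          using sum_sq_scaled[OF elim(3), of p x] by (simp add: sq_norm_def)
        have doty: "dot n y \<theta> = \<sigma> * (n powr (1/p) * dot n x \<theta>)" for \<theta>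
          by (simp add: dot_def y_def sum_distrib_left mult_ac)
        have "w \<le> \<sigma> * (n powr (1/p) / n powr (1/2) * dot n x \<theta>) \<longleftrightarrow> sqrt n * w \<le> dot n y \<theta>" for \<theta>
        proof -
          have "0 < sqrt n" using elim by simp
          moreover have "\<sigma> * (n powr (1/p) / n powr (1/2) * dot n x \<theta>) = dot n y \<theta> / sqrt n"
            using elim by (simp add: doty powr_half_sqrt)
          ultimately show ?thesis by (simp add: pos_le_divide_eq mult.commute)
        qed
        then have "emeasure \<nu> {\<theta> \<in> space \<nu>. n powr (1/p) / n powr (1/2) * dot n x \<theta> \<in> {v. w \<le> \<sigma> * v}}
            = emeasure \<nu> {\<theta> \<in> space \<nu>. sqrt n * w \<le> dot n y \<theta>}" by simp
        also have "\<dots> \<le> ennreal (exp (- t1 * n * w + t1\<^sup>2 * sq_norm n y / (2 * A) + n * ((A - 1 - ln A) / 2 + \<zeta>)))"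
          using elim(1) \<nu> t1 w by blast
        also have "exp (- t1 * n * w + t1\<^sup>2 * sq_norm n y / (2 * A) + n * ((A - 1 - ln A) / 2 + \<zeta>))
            = E * exp (a * (n powr (2/p) * sq_norm n x))"
          unfolding E_def sqy a_def by (simp add: exp_add[symmetric] mult_ac)
        finally show ?thesis by (simp add: ennreal_mult E_def)
      qed
      have "(\<integral>\<^sup>+x. emeasure \<nu> {\<theta> \<in> space \<nu>. n powr (1/p) / n powr (1/2) * dot n x \<theta> \<in> {v. w \<le> \<sigma> * v}} * indicator (lp_ball n p) x \<partial>lborel_Rn n)
        \<le> (\<integral>\<^sup>+x. ennreal E * (ennreal (exp (a * (n powr (2/p) * sq_norm n x))) * indicator (lp_ball n p) x) \<partial>lborel_Rn n)"
      proof (rule nn_integral_mono)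
        fix x
        have "emeasure \<nu> {\<theta> \<in> space \<nu>. n powr (1/p) / n powr (1/2) * dot n x \<theta> \<in> {v. w \<le> \<sigma> * v}} * indicator (lp_ball n p) x
          \<le> (ennreal E * ennreal (exp (a * (n powr (2/p) * sq_norm n x)))) * indicator (lp_ball n p) x"
          by (intro mult_right_mono cap) simp
        then show "emeasure \<nu> {\<theta> \<in> space \<nu>. n powr (1/p) / n powr (1/2) * dot n x \<theta> \<in> {v. w \<le> \<sigma> * v}} * indicator (lp_ball n p) x
          \<le> ennreal E * (ennreal (exp (a * (n powr (2/p) * sq_norm n x))) * indicator (lp_ball n p) x)"
          unfolding mult.assoc[of "ennreal E"] .
      qed
      also have "\<dots> = ennreal E * (\<integral>\<^sup>+x. ennreal (exp (a * (n powr (2/p) * sq_norm n x))) * indicator (lp_ball n p) x \<partial>lborel_Rn n)"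
        by (rule nn_integral_cmult) measurable
      also have "\<dots> \<le> ennreal E * (ennreal (exp (n * b)) * (ennreal (n powr (-1/p)) * partition_fn p a b) ^ n)"
        using p b elim by (intro mult_left_mono lp_ball_integral_upper) auto
      also have "\<dots> = ennreal (E * (exp (n * b) * (n powr (-1/p) * Z) ^ n))"
        using Z by (simp add: E_def ennreal_mult[symmetric] ennreal_power)
      \<comment> \<open>Collecting exponents: \<open>(A - 1) / 2 = - t0\<close> and
        \<open>b = 1 / p - t2\<close>, while ln Z, ln A and \<open>ln (mass p)\<close> make up
        \<Phi>.\<close>
      also have "E * (exp (n * b) * (n powr (-1/p) * Z) ^ n) = V * exp (- (n * c))"
      proof -
        have Zn: "Z ^ n = exp (n * ln Z)" using Z by (simp add: exp_of_nat_mult)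
        have "E * (exp (n * b) * (n powr (-1/p) * Z) ^ n)
          = N * exp (- t1 * n * w + n * ((A - 1 - ln A) / 2 + \<zeta>) + n * b + n * ln Z)"
          unfolding power_mult_distrib Zn E_def N_def exp_add by (simp add: mult_ac)
        also have "- t1 * n * w + n * ((A - 1 - ln A) / 2 + \<zeta>) + n * b + n * ln Z
          = n * (- t1 * w + (A - 1 - ln A) / 2 + \<zeta> + b + ln Z)" by (simp add: algebra_simps)
        also have "- t1 * w + (A - 1 - ln A) / 2 + \<zeta> + b + ln Z = (ln (mass p) + 1 / p - \<zeta>) + (- c)"
        proof -
          have "2 * \<zeta> = t0 + t1 * w + t2 - (ln Z - ln (mass p) - ln A / 2) - c" by (simp add: \<zeta>_def g_def)
          then show ?thesis unfolding A_def b_def by (simp add: field_simps)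
        qed
        also have "N * exp (n * ((ln (mass p) + 1 / p - \<zeta>) + (- c))) = V * exp (- (n * c))"
          unfolding V_def distrib_left exp_add by simp
        finally show ?thesis .
      qed
      also have "ennreal (V * exp (- (n * c))) = ennreal V * ennreal (exp (- (n * c)))"
        using V by (intro ennreal_mult) auto
      also have "\<dots> \<le> emeasure (lborel_Rn n) (lp_ball n p) * ennreal (exp (- (n * c)))"
        using V by (intro mult_right_mono) auto
      finally show "ball_sphere_law n p \<nu> {v. w \<le> \<sigma> * v} \<le> ennreal (exp (- (n * c)))"
        unfolding ball_sphere_law_def using V by (intro divide_le_posI_ennreal) (auto intro: order_less_le_trans[of 0 "ennreal V"])
    qed
  qed
qed

text \<open>W is a norm factor times a cosine. The tilt a belonging to w^2 fixes both: the norm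
  factor is near \<open>sqrt s0\<close> on the shell, the cosine near v, and
  \<open>v * sqrt s0 = w\<close>. The total exponent R is minus the dual value at an explicit point,
  hence at least minus the rate at w.\<close>

lemma ball_sphere_law_lower:
  fixes c w e :: real
  assumes p: "2 \<le> p" and w: "\<bar>w\<bar> < 1" and e: "0 < e" and c: "I_an p w < ereal c"
  shows "eventually (\<lambda>n. \<forall>\<nu>. sphere_uniform n \<nu> \<longrightarrow>
    ennreal (exp (- (n * c))) \<le> ball_sphere_law n p \<nu> {w - e<..<w + e}) sequentially"
proof -
  have w2: "w\<^sup>2 < 1" using w by (simp add: abs_square_less_1)
  obtain a where a: "0 \<le> a" and adm: "admissible p a (1/p)"
    and aw: "2 * a * (mean_sq p a (1/p))\<^sup>2 * (1 + 2 * a * mean_sq p a (1/p)) powr (- 1 - 2/p) = w\<^sup>2"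
    using exists_tilt[OF p _ w2] by auto
  define s where "s = mean_sq p a (1/p)"
  define P where "P = 1 + 2 * a * s"
  define Z where "Z = pfun p a (1/p)"
  have fin: "partition_fn p a (1/p) < \<infinity>" by (rule admissible_finite[OF adm])
  have Z: "0 < Z" unfolding Z_def by (rule pfun_pos[OF fin])
  have s: "0 \<le> s" unfolding s_def mean_sq_def using pfun_pos[OF fin] by (intro divide_nonneg_nonneg integral_nonneg_AE) auto
  have P: "1 \<le> P" using a s by (simp add: P_def)
  have aw': "2 * a * s\<^sup>2 * P powr (- 1 - 2/p) = w\<^sup>2" using aw by (simp add: s_def P_def)
  define s0 where "s0 = s * P powr (-2/p)"
  have s0: "0 \<le> s0" using s by (simp add: s0_def)
  \<comment> \<open>The sign of w, taken as 1 at w = 0 so that its square is always 1.\<close>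
  define \<sigma> :: real where "\<sigma> = (if w < 0 then - 1 else 1)"
  have \<sigma>: "\<sigma> * \<sigma> = 1" "w = \<sigma> * \<bar>w\<bar>" "\<sigma>\<^sup>2 = 1" by (auto simp: \<sigma>_def)
  \<comment> \<open>\<open>1 - 1 / P = 2 * a * s / P\<close> is the factor of w^2 that remains once
    \<open>s0\<close> is taken out.\<close>
  define v where "v = \<sigma> * sqrt (1 - 1 / P)"
  have v2: "v\<^sup>2 = 1 - 1 / P" using P by (simp add: v_def power_mult_distrib \<sigma>(3))
  have v1: "\<bar>v\<bar> < 1" using v2 P by (simp flip: abs_square_less_1)
  have pw1: "P powr (- 1 - 2/p) = P powr (-2/p) / P"
    using P powr_add[of P "-1" "-2/p"] by (simp add: powr_minus_divide)
  have vw: "v * sqrt s0 = w"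
  proof -
    have "(1 - 1 / P) * s0 = w\<^sup>2"
    proof -
      have "1 - 1 / P = 2 * a * s / P" using P by (simp add: P_def field_simps)
      then have "(1 - 1 / P) * s0 = 2 * a * s\<^sup>2 * (P powr (-2/p) / P)" by (simp add: s0_def power2_eq_square)
      then show ?thesis using aw' pw1 by simp
    qed
    then have "sqrt (1 - 1 / P) * sqrt s0 = \<bar>w\<bar>" by (simp flip: real_sqrt_mult)
    then have "v * sqrt s0 = \<sigma> * \<bar>w\<bar>" by (simp add: v_def mult.assoc)
    then show ?thesis by (simp only: \<sigma>(2)[symmetric])
  qed
  \<comment> \<open>The cosine exponent, where \<open>ln (1 - v\<^sup>2) / 2 = - ln P / 2\<close>,
    plus the shell exponent, minus the volume exponent.\<close>
  define R where "R = - ln P / 2 + (ln Z - ln P / p - a * s + P / p) - (ln (mass p) + 1 / p)"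
  have "ereal (- R) \<le> I_an p w"
  proof -
    \<comment> \<open>With these values (1, w, 1) is the mean of (z^2, z y, |y|^p) under the
      exponentially tilted law: \<open>1 - 2 * t0 = P\<close>, and (a, 1/p) is rescaled by P^(1/p),
      which brings the p-th moment from P to 1. The sign of \<open>t1\<close> is \<sigma>.\<close>
    define t0 where "t0 = (1 - P) / 2"
    define t1 where "t1 = \<sigma> * sqrt (2 * a * P powr (1 + 2/p))"
    define t2 where "t2 = (1 - P) / p"
    have t0: "1 - 2 * t0 = P" "t0 < 1/2" using P by (auto simp: t0_def field_simps)
    have t2: "1 / p - t2 = P / p" by (simp add: t2_def diff_divide_distrib)
    have t1sq: "t1\<^sup>2 / (2 * P) = a * P powr (2/p)"
    proof -
      have "t1\<^sup>2 = 2 * a * P powr (1 + 2/p)" using a by (simp add: t1_def power_mult_distrib \<sigma>(3))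
      also have "P powr (1 + 2/p) = P * P powr (2/p)" using P by (simp add: powr_add)
      finally show ?thesis using P by simp
    qed
    have t1w: "t1 * w = P - 1"
    proof -
      have "\<bar>w\<bar> = sqrt (2 * a * s\<^sup>2 * P powr (- 1 - 2/p))" using aw' by simp
      moreover have "t1 * w = t1 * (\<sigma> * \<bar>w\<bar>)" by (simp only: \<sigma>(2)[symmetric])
      ultimately have "t1 * w = (\<sigma> * \<sigma>) * (sqrt (2 * a * P powr (1 + 2/p)) * sqrt (2 * a * s\<^sup>2 * P powr (- 1 - 2/p)))"
        unfolding t1_def by (simp only: mult_ac)
      also have "\<dots> = sqrt ((2 * a * P powr (1 + 2/p)) * (2 * a * s\<^sup>2 * P powr (- 1 - 2/p)))"
        by (simp add: \<sigma>(1) real_sqrt_mult)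
      also have "(2 * a * P powr (1 + 2/p)) * (2 * a * s\<^sup>2 * P powr (- 1 - 2/p))
          = (2 * a * s)\<^sup>2 * (P powr (1 + 2/p) * P powr (- 1 - 2/p))" by (simp add: power2_eq_square mult_ac)
      also have "P powr (1 + 2/p) * P powr (- 1 - 2/p) = 1" using P by (simp flip: powr_add)
      finally show ?thesis using a s by (simp add: P_def)
    qed
    define r where "r = P powr (1/p)"
    have r: "0 < r" "r\<^sup>2 = P powr (2/p)" "r powr p = P" using P p by (auto simp: r_def powr_power powr_powr)
    have fin': "partition_fn p (t1\<^sup>2 / (2 * (1 - 2 * t0))) (1 / p - t2) < \<infinity>"
      using pfun_scale(1)[OF fin r(1)] unfolding t0 t2 t1sq r by simp
    define Z' where "Z' = pfun p (t1\<^sup>2 / (2 * (1 - 2 * t0))) (1 / p - t2)"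
    have "Z = r * Z'" using pfun_scale(2)[OF fin r(1)] unfolding Z_def Z'_def t0 t2 t1sq r by simp
    moreover have "0 < Z'" unfolding Z'_def by (rule pfun_pos[OF fin'])
    ultimately have lnZ: "ln Z = ln P / p + ln Z'" using r P by (simp add: ln_mult r_def ln_powr)
    have "ereal (t0 + t1 * w + t2) - \<Phi> p (t0, t1, t2) = ereal (- R)"
    proof -
      have as: "a * s = (P - 1) / 2" by (simp add: P_def)
      show ?thesis
        unfolding Phi_finite[OF p t0(2) fin'] Z'_def[symmetric] unfolding t1w R_def t0(1) as
        by (simp add: t0_def t2_def lnZ diff_divide_distrib)
    qed
    then show ?thesis using I_an_ge[OF p, of t0 t1 w t2] by simp
  qed
  then have "ereal (- R) < ereal c" using c by (rule order_le_less_trans)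
  then have Rc: "0 < c + R" by simp
  \<comment> \<open>Two losses of \<zeta> occur, in the cap and in the shell; the upper bound for
    the volume has none.\<close>
  define \<zeta> where "\<zeta> = (c + R) / 2"
  have \<zeta>: "0 < \<zeta>" using Rc by (simp add: \<zeta>_def)
  \<comment> \<open>Half of e goes to the norm factor, whose error \<bar>v\<bar> < 1 does not
    amplify, and half to the cosine, whose error is multiplied by a norm factor of at most
    \<open>sqrt s0 + e1\<close>.\<close>
  define e1 where "e1 = e / 2"
  define e2 where "e2 = e / (2 * (sqrt s0 + e1))"
  have e1: "0 < e1" "0 < sqrt s0 + e1" using e s0 by (simp_all add: e1_def add_nonneg_pos)
  define D where "D = sqrt s0 + e1"
  have e12: "0 < e1" "0 < e2" "(sqrt s0 + e1) * e2 = e / 2"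
    using e e1 unfolding e2_def D_def[symmetric] by simp_all
  show ?thesis
    using sphere_cap_lower[OF v1 \<zeta> e12(2)] lp_ball_shell_lower[OF adm a \<zeta> e12(1)]
      lp_ball_volume_lower[OF p \<zeta>] eventually_ge_at_top[of 1]
  proof eventually_elim
    case (elim n)
    define N where "N = (n powr (-1/p)) ^ n"
    have N: "0 < N" using elim by (simp add: N_def)
    define c0 where "c0 = real n powr (1/p) / real n powr (1/2)"
    define Sh where "Sh = {x \<in> lp_ball n p. \<bar>sqrt (n powr (2/p) * sq_norm n x / n) - sqrt s0\<bar> < e1}"
    have "Sh = lp_ball n p \<inter> {x \<in> space (lborel_Rn n). \<bar>sqrt (n powr (2/p) * sq_norm n x / n) - sqrt s0\<bar> < e1}"
      by (auto simp: Sh_def lp_ball_eq)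
    also have "\<dots> \<in> sets (lborel_Rn n)" by measurable
    finally have Sh_meas [measurable]: "Sh \<in> sets (lborel_Rn n)" .
    define k where "k = ln Z - ln P / p - a * s + P / p - \<zeta>"
    have Sh: "ennreal (N * exp (n * k)) \<le> emeasure (lborel_Rn n) Sh"
      using elim(2) unfolding Sh_def N_def k_def s0_def s_def P_def Z_def by simp
    define l where "l = ln (1 - v\<^sup>2) / 2 - \<zeta>"
    have lP: "l = - ln P / 2 - \<zeta>" unfolding l_def v2 using P by (simp add: ln_div)
    define vol where "vol = emeasure (lborel_Rn n) (lp_ball n p)"
    define V where "V = N * exp (n * (ln (mass p) + 1 / p))"
    have vol_le: "vol \<le> ennreal V" unfolding vol_def V_def N_def by (rule lp_ball_volume_upper[OF p elim(4)])
    have vol_pos: "vol \<noteq> 0"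
    proof -
      have "0 < ennreal (N * exp (n * (ln (mass p) + 1 / p - \<zeta>)))" using N by (simp add: ennreal_zero_less_mult_iff)
      also have "\<dots> \<le> vol" using elim(3) by (simp add: vol_def N_def)
      finally show ?thesis by simp
    qed
    have vol_fin: "vol \<noteq> \<top>" using vol_le by (auto simp: top_unique)
    show ?case
    proof (intro allI impI)
      fix \<nu> assume \<nu>: "sphere_uniform n \<nu>"
      note [measurable_cong] = sphere_uniformD(2)[OF \<nu>]
      interpret \<nu>: prob_space \<nu> by (rule sphere_uniformD[OF \<nu>])
      have cap: "ennreal (exp (n * l)) \<le> emeasure \<nu> {\<theta> \<in> space \<nu>. c0 * dot n x \<theta> \<in> {w - e<..<w + e}}" if x: "x \<in> Sh" for x
      proof -
        define y where "y = (\<lambda>i. n powr (1/p) * x i)"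
        have sqy: "sq_norm n y = n powr (2/p) * sq_norm n x"
          using sum_sq_scaled[OF elim(4), of p x] by (simp add: sq_norm_def y_def)
        have doty: "c0 * dot n x \<theta> = dot n y \<theta> / sqrt n" for \<theta>
          using elim by (simp add: c0_def dot_def y_def sum_distrib_left sum_divide_distrib powr_half_sqrt mult_ac)
        define \<rho> where "\<rho> = sqrt (sq_norm n y / n)"
        have \<rho>: "\<bar>\<rho> - sqrt s0\<bar> < e1" "0 \<le> \<rho>" using x by (auto simp: \<rho>_def Sh_def sqy)
        have \<rho>v: "\<bar>\<rho> * v - w\<bar> < e1"
        proof -
          have "\<bar>\<rho> * v - w\<bar> = \<bar>\<rho> - sqrt s0\<bar> * \<bar>v\<bar>" unfolding vw[symmetric] abs_mult[symmetric] by (simp add: algebra_simps)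
          also have "\<dots> \<le> \<bar>\<rho> - sqrt s0\<bar> * 1" using v1 by (intro mult_left_mono) auto
          finally show ?thesis using \<rho> by simp
        qed
        show ?thesis
        proof (cases "sq_norm n y = 0")
          \<comment> \<open>The shell may contain the null vector, to which the cap estimate does
            not apply. Then W vanishes and 0 lies within e of w, so the event is certain.\<close>
          case True
          have "y i = 0" if "i \<in> {1..n}" for i
            using True that unfolding sq_norm_def by (subst (asm) sum_nonneg_eq_0_iff) auto
          then have "dot n y \<theta> = 0" for \<theta> by (simp add: dot_def)
          moreover have "\<bar>w\<bar> < e" using \<rho>v True e by (simp add: \<rho>_def e1_def)
          ultimately have "{\<theta> \<in> space \<nu>. c0 * dot n x \<theta> \<in> {w - e<..<w + e}} = space \<nu>" unfolding doty by auto
          moreover have "ennreal (exp (n * l)) \<le> 1"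
          proof -
            have "0 \<le> ln P" using P by simp
            then have "l \<le> 0" unfolding lP using \<zeta> by simp
            then show ?thesis by (simp add: mult_nonneg_nonpos)
          qed
          ultimately show ?thesis by (simp add: \<nu>.emeasure_space_1)
        next
          case False
          then have pos: "0 < sq_norm n y" using sq_norm_nonneg[of n y] by linarith
          have "ennreal (exp (n * l)) \<le> emeasure \<nu> {\<theta> \<in> space \<nu>. \<bar>dot n y \<theta> - sqrt (sq_norm n y) * v\<bar> < sqrt (sq_norm n y) * e2}"
            using elim(1) \<nu> pos unfolding l_def by blast
          also have "\<dots> \<le> emeasure \<nu> {\<theta> \<in> space \<nu>. c0 * dot n x \<theta> \<in> {w - e<..<w + e}}"
          proof (intro emeasure_mono subsetI)
            fix \<theta> assume \<theta>: "\<theta> \<in> {\<theta> \<in> space \<nu>. \<bar>dot n y \<theta> - sqrt (sq_norm n y) * v\<bar> < sqrt (sq_norm n y) * e2}"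
            have sn: "0 < sqrt n" using elim by simp
            have sq: "sqrt (sq_norm n y) = sqrt n * \<rho>" using elim by (simp add: \<rho>_def real_sqrt_divide)
            have "\<bar>dot n y \<theta> - sqrt n * \<rho> * v\<bar> < sqrt n * \<rho> * e2" using \<theta> unfolding sq by simp
            then have "\<bar>dot n y \<theta> - sqrt n * \<rho> * v\<bar> / sqrt n < sqrt n * \<rho> * e2 / sqrt n"
              using sn by (rule divide_strict_right_mono)
            moreover have "\<bar>dot n y \<theta> - sqrt n * \<rho> * v\<bar> / sqrt n = \<bar>dot n y \<theta> / sqrt n - \<rho> * v\<bar>"
            proof -
              have "\<bar>dot n y \<theta> - sqrt n * \<rho> * v\<bar> / sqrt n = \<bar>(dot n y \<theta> - sqrt n * \<rho> * v) / sqrt n\<bar>" using sn by (simp add: abs_divide)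
              also have "(dot n y \<theta> - sqrt n * \<rho> * v) / sqrt n = dot n y \<theta> / sqrt n - \<rho> * v" using sn by (simp add: diff_divide_distrib)
              finally show ?thesis .
            qed
            moreover have "sqrt n * \<rho> * e2 / sqrt n = \<rho> * e2" using sn by simp
            ultimately have "\<bar>dot n y \<theta> / sqrt n - \<rho> * v\<bar> < \<rho> * e2" by simp
            moreover have "\<rho> * e2 \<le> e / 2"
            proof -
              have "\<rho> * e2 \<le> (sqrt s0 + e1) * e2" using \<rho> e12 by (intro mult_right_mono) auto
              then show ?thesis using e12 by simp
            qed
            ultimately have "\<bar>dot n y \<theta> / sqrt n - w\<bar> < e" using \<rho>v unfolding e1_def by linarith
            then show "\<theta> \<in> {\<theta> \<in> space \<nu>. c0 * dot n x \<theta> \<in> {w - e<..<w + e}}"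
              using \<theta> unfolding doty by auto
          qed measurable
          finally show ?thesis .
        qed
      qed
      have "ennreal (exp (- (n * c))) * vol \<le> ennreal (exp (- (n * c))) * ennreal V"
        using vol_le by (intro mult_left_mono) auto
      also have "\<dots> = ennreal (exp (n * l) * (N * exp (n * k)))"
      proof -
        have "- c + (ln (mass p) + 1 / p) = l + k"
          unfolding lP k_def using \<zeta>_def R_def by (simp add: field_simps)
        then have "- (n * c) + n * (ln (mass p) + 1 / p) = n * l + n * k"
          by (metis distrib_left mult_minus_right)
        then have "exp (- (n * c)) * V = exp (n * l) * (N * exp (n * k))"
          unfolding V_def by (simp add: exp_add[symmetric] mult.left_commute[of _ N])
        then show ?thesis using N by (simp add: V_def ennreal_mult[symmetric])
      qed
      also have "\<dots> = ennreal (exp (n * l)) * ennreal (N * exp (n * k))" using N by (intro ennreal_mult) auto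
      also have "\<dots> \<le> ennreal (exp (n * l)) * emeasure (lborel_Rn n) Sh" using Sh by (intro mult_left_mono) auto
      also have "\<dots> = (\<integral>\<^sup>+x. ennreal (exp (n * l)) * indicator Sh x \<partial>lborel_Rn n)"
        by (simp add: nn_integral_cmult_indicator)
      also have "\<dots> \<le> (\<integral>\<^sup>+x. emeasure \<nu> {\<theta> \<in> space \<nu>. c0 * dot n x \<theta> \<in> {w - e<..<w + e}} * indicator (lp_ball n p) x \<partial>lborel_Rn n)"
      proof (rule nn_integral_mono)
        fix x
        show "ennreal (exp (n * l)) * indicator Sh x \<le> emeasure \<nu> {\<theta> \<in> space \<nu>. c0 * dot n x \<theta> \<in> {w - e<..<w + e}} * indicator (lp_ball n p) x"
        proof (cases "x \<in> Sh")
          case True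
          moreover from True have "x \<in> lp_ball n p" by (simp add: Sh_def)
          ultimately show ?thesis using cap[OF True] by simp
        qed simp
      qed
      finally have "ennreal (exp (- (n * c))) * vol / vol \<le> ball_sphere_law n p \<nu> {w - e<..<w + e}"
        unfolding ball_sphere_law_def c0_def vol_def by (rule divide_right_mono_ennreal)
      then show "ennreal (exp (- (n * c))) \<le> ball_sphere_law n p \<nu> {w - e<..<w + e}"
        by (simp add: ennreal_mult_divide_eq vol_pos vol_fin)
    qed
  qed
qed

section \<open>From tails and intervals to closed and open sets\<close>

lemma elog_rate_le:
  assumes "x \<le> ennreal (exp (- (real n * c)))" "1 \<le> n"
  shows "ereal (1 / real n) * elog x \<le> ereal (- c)"
proof -
  have "elog x \<le> ereal (- (real n * c))" using elog_mono[OF assms(1)] by simp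
  then have "ereal (1 / real n) * elog x \<le> ereal (1 / real n) * ereal (- (real n * c))"
    by (rule ereal_mult_left_mono) simp
  also have "\<dots> = ereal (- c)" using assms(2) by simp
  finally show ?thesis .
qed

lemma elog_rate_ge:
  assumes "ennreal (exp (- (real n * c))) \<le> x" "1 \<le> n"
  shows "ereal (- c) \<le> ereal (1 / real n) * elog x"
proof -
  have "ereal (- c) = ereal (1 / real n) * ereal (- (real n * c))" using assms(2) by simp
  also have "ereal (- (real n * c)) \<le> elog x" using elog_mono[OF assms(1)] by simp
  then have "ereal (1 / real n) * ereal (- (real n * c)) \<le> ereal (1 / real n) * elog x"
    by (rule ereal_mult_left_mono) simp
  finally show ?thesis .
qed

lemma le_uminus_if_dense:
  fixes L J :: ereal
  assumes "\<And>c. ereal c < J \<Longrightarrow> L \<le> ereal (- c)"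
  shows "L \<le> - J"
proof (rule ccontr)
  assume "\<not> L \<le> - J"
  then have "- L < J" by (metis ereal_minus_less_minus ereal_uminus_uminus linorder_not_le)
  then obtain c where "- L < ereal c" "ereal c < J" using ereal_dense2 by blast
  then have "L \<le> - ereal c" "- ereal c < L" using assms[of c] ereal_uminus_less_reorder[of L "ereal c"] by auto
  then show False by simp
qed

lemma uminus_le_if_dense:
  fixes L J :: ereal
  assumes "\<And>c. J < ereal c \<Longrightarrow> ereal (- c) \<le> L"
  shows "- J \<le> L"
proof (rule ccontr)
  assume "\<not> - J \<le> L"
  then have "J < - L" by (metis ereal_minus_less_minus ereal_uminus_uminus linorder_not_le)
  then obtain c where "J < ereal c" "ereal c < - L" using ereal_dense2 by blast
  then have "- ereal c \<le> L" "L < - ereal c" using assms[of c] ereal_less_uminus_reorder[of "ereal c" L] by auto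
  then show False by simp
qed

theorem theorem2p2:
  fixes p :: real
    and M :: "nat \<Rightarrow> 'w measure"
    and X \<Theta> :: "nat \<Rightarrow> 'w \<Rightarrow> nat \<Rightarrow> real"
    and W :: "nat \<Rightarrow> 'w \<Rightarrow> real"
  assumes p: "2 \<le> p"
    and M: "\<And>n. n \<ge> 1 \<Longrightarrow> prob_space (M n)"
    and X_meas: "\<And>n. n \<ge> 1 \<Longrightarrow> X n \<in> measurable (M n) (lborel_Rn n)"
    and X_unif: "\<And>n. n \<ge> 1 \<Longrightarrow>
      distr (M n) (lborel_Rn n) (X n) = uniform_measure (lborel_Rn n) (lp_ball n p)"
    and \<Theta>_meas: "\<And>n. n \<ge> 1 \<Longrightarrow> \<Theta> n \<in> measurable (M n) (lborel_Rn n)"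
    and \<Theta>_unif: "\<And>n. n \<ge> 1 \<Longrightarrow> sphere_uniform n (distr (M n) (lborel_Rn n) (\<Theta> n))"
    and indep: "\<And>n. n \<ge> 1 \<Longrightarrow>
      prob_space.indep_var (M n) (lborel_Rn n) (X n) (lborel_Rn n) (\<Theta> n)"
    and W_def: "\<And>n \<omega>. W n \<omega> =
      real n powr (1 / p) / real n powr (1 / 2) * (\<Sum>i=1..n. X n \<omega> i * \<Theta> n \<omega> i)"
  shows "satisfies_LDP M W (\<lambda>n. real n) (I_an p)
    \<and> quasiconvex (I_an p) \<and> symmetric_fun (I_an p) \<and> good_rate (I_an p)"
proof -
  have W_dot: "W n \<omega> = n powr (1/p) / n powr (1/2) * dot n (X n \<omega>) (\<Theta> n \<omega>)" for n \<omega>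
    by (simp add: W_def dot_def)
  have W_meas: "W n \<in> borel_measurable (M n)" if "1 \<le> n" for n
    unfolding W_dot[abs_def] using dot_measurable_comp[OF X_meas[OF that] \<Theta>_meas[OF that]] by simp
  define \<nu> where "\<nu> = (\<lambda>n. distr (M n) (lborel_Rn n) (\<Theta> n))"
  define pr where "pr = (\<lambda>n S. emeasure (M n) {\<omega> \<in> space (M n). W n \<omega> \<in> S})"
  have pr_eq: "pr n S = ball_sphere_law n p (\<nu> n) S" if "1 \<le> n" "S \<in> sets borel" for n S
    unfolding pr_def W_dot \<nu>_def
    by (rule ball_sphere_law_eq[OF M[OF that(1)] X_meas[OF that(1)] X_unif[OF that(1)] \<Theta>_meas[OF that(1)] indep[OF that(1)] that(2)])
  have pr_mono: "pr n S \<le> pr n T" if "1 \<le> n" "S \<subseteq> T" "T \<in> sets borel" for n S T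
    unfolding pr_def
  proof (rule emeasure_mono)
    show "{\<omega> \<in> space (M n). W n \<omega> \<in> S} \<subseteq> {\<omega> \<in> space (M n). W n \<omega> \<in> T}" using that by auto
    show "{\<omega> \<in> space (M n). W n \<omega> \<in> T} \<in> sets (M n)"
      using measurable_sets[OF W_meas[OF that(1)] that(3)] by (simp add: vimage_def Int_def conj_commute)
  qed
  have pr_union: "pr n (S \<union> T) \<le> pr n S + pr n T" if "1 \<le> n" "S \<in> sets borel" "T \<in> sets borel" for n S T
  proof -
    have "{\<omega> \<in> space (M n). W n \<omega> \<in> S \<union> T} = {\<omega> \<in> space (M n). W n \<omega> \<in> S} \<union> {\<omega> \<in> space (M n). W n \<omega> \<in> T}" by auto
    then show ?thesis
      unfolding pr_def using measurable_sets[OF W_meas[OF that(1)] that(2)] measurable_sets[OF W_meas[OF that(1)] that(3)]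
      by (simp add: vimage_def Int_def conj_commute emeasure_subadditive)
  qed
  let ?rate = "\<lambda>S n. ereal (1 / real n) * elog (pr n S)"
  have tail: "eventually (\<lambda>n. pr n {v. w \<le> \<sigma> * v} \<le> ennreal (exp (- (real n * c)))) sequentially"
    if "0 \<le> w" "ereal c < I_an p w" "\<sigma> = 1 \<or> \<sigma> = - 1" for w c \<sigma> :: real
    using ball_sphere_law_upper[OF p that] eventually_ge_at_top[of 1]
  proof eventually_elim
    case (elim n)
    then show ?case using \<Theta>_unif[of n] by (simp add: pr_eq \<nu>_def)
  qed
  \<comment> \<open>The part of F on one side of 0 lies in the half-line that begins at its point
    nearest to 0. This point belongs to the closed set F, so its rate is at least the infimum over
    F. Multiplication by \<sigma> reflects the negative side.\<close>
  have half: "eventually (\<lambda>n. pr n (F \<inter> {v. 0 \<le> \<sigma> * v}) \<le> ennreal (exp (- (real n * c)))) sequentially"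
    if F: "closed F" and c: "ereal c < (INF x\<in>F. I_an p x)" and \<sigma>: "\<sigma> = 1 \<or> \<sigma> = - 1" for F c and \<sigma> :: real
  proof (cases "F \<inter> {v. 0 \<le> \<sigma> * v} = {}")
    case True
    then show ?thesis by (simp add: pr_def)
  next
    case False
    define G where "G = (\<lambda>v. \<sigma> * v) ` (F \<inter> {v. 0 \<le> \<sigma> * v})"
    have G_eq: "G = {u. \<sigma> * u \<in> F \<and> 0 \<le> u}"
    proof (intro equalityI subsetI)
      fix u assume "u \<in> {u. \<sigma> * u \<in> F \<and> 0 \<le> u}"
      then show "u \<in> G" unfolding G_def using \<sigma> by (intro image_eqI[of _ _ "\<sigma> * u"]) auto
    qed (use \<sigma> in \<open>auto simp: G_def\<close>)
    have "closed G"
    proof -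
      have "closed ((\<lambda>u. \<sigma> * u) -` F)" by (intro closed_vimage F continuous_intros)
      moreover have "G = (\<lambda>u. \<sigma> * u) -` F \<inter> {0..}" by (auto simp: G_eq)
      ultimately show ?thesis by (simp add: closed_Int)
    qed
    moreover have "G \<noteq> {}" using False by (auto simp: G_def)
    moreover have bdd: "bdd_below G" by (rule bdd_belowI[of _ 0]) (simp add: G_eq)
    ultimately have "Inf G \<in> G" by (intro closed_contains_Inf)
    then have w: "0 \<le> Inf G" "\<sigma> * Inf G \<in> F" by (auto simp: G_eq)
    have "I_an p (\<sigma> * Inf G) = I_an p (Inf G)" using \<sigma> I_an_symmetric[OF p] by auto
    then have cw: "ereal c < I_an p (Inf G)" using c INF_lower[OF w(2), of "I_an p"] by (metis order_less_le_trans)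
    show ?thesis
      using tail[OF w(1) cw \<sigma>] eventually_ge_at_top[of 1]
    proof eventually_elim
      case (elim n)
      have "F \<inter> {v. 0 \<le> \<sigma> * v} \<subseteq> {v. Inf G \<le> \<sigma> * v}"
        using cInf_lower[OF _ bdd] by (auto simp: G_def)
      then have "pr n (F \<inter> {v. 0 \<le> \<sigma> * v}) \<le> pr n {v. Inf G \<le> \<sigma> * v}"
        using elim by (intro pr_mono) auto
      with elim show ?case by simp
    qed
  qed
  have upper: "limsup (?rate F) \<le> - (INF x\<in>F. I_an p x)" if F: "closed F" for F
  proof (rule le_uminus_if_dense)
    fix c assume c: "ereal c < (INF x\<in>F. I_an p x)"
    \<comment> \<open>The room between c and c' absorbs the factor 2 that comes from the two halves
      of F.\<close>
    then obtain c' where c': "ereal c < ereal c'" "ereal c' < (INF x\<in>F. I_an p x)" using ereal_dense2 by blast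
    have "eventually (\<lambda>n. exp (real n * (c - c')) \<le> 1/2) sequentially"
      using c' by (intro eventually_exp_mult_le) auto
    with half[OF F c'(2) disjI1[OF refl]] half[OF F c'(2) disjI2[OF refl]] eventually_ge_at_top[of 1]
    have "eventually (\<lambda>n. ?rate F n \<le> ereal (- c)) sequentially"
    proof eventually_elim
      case (elim n)
      have bF: "F \<in> sets borel" using F by simp
      have "F = (F \<inter> {v. 0 \<le> 1 * v}) \<union> (F \<inter> {v. 0 \<le> - 1 * v})" by auto
      then have "pr n F \<le> pr n (F \<inter> {v. 0 \<le> 1 * v}) + pr n (F \<inter> {v. 0 \<le> - 1 * v})"
        using pr_union[of n "F \<inter> {v. 0 \<le> 1 * v}" "F \<inter> {v. 0 \<le> - 1 * v}"] bF elim by auto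
      also have "\<dots> \<le> ennreal (exp (- (real n * c'))) + ennreal (exp (- (real n * c')))"
        using elim by (intro add_mono) auto
      also have "\<dots> = ennreal (2 * exp (- (real n * c')))" by (simp flip: ennreal_plus)
      also have "\<dots> \<le> ennreal (exp (- (real n * c)))"
      proof (rule ennreal_leI)
        have "exp (- (real n * c')) = exp (real n * (c - c')) * exp (- (real n * c))"
          by (simp add: exp_add[symmetric] algebra_simps)
        also have "\<dots> \<le> 1/2 * exp (- (real n * c))" using elim by (intro mult_right_mono) auto
        finally show "2 * exp (- (real n * c')) \<le> exp (- (real n * c))" by simp
      qed
      finally show ?case using elim by (intro elog_rate_le) auto
    qed
    then show "limsup (?rate F) \<le> ereal (- c)" by (rule Limsup_bounded)
  qed
  have lower: "- (INF x\<in>U. I_an p x) \<le> liminf (?rate U)" if U: "open U" for U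
  proof (rule uminus_le_if_dense)
    fix c assume "(INF x\<in>U. I_an p x) < ereal c"
    then obtain w where w: "w \<in> U" "I_an p w < ereal c" unfolding INF_less_iff by blast
    then obtain c' where c': "I_an p w < ereal c'" "ereal c' < ereal c" using ereal_dense2 by blast
    have w1: "\<bar>w\<bar> \<le> 1" using I_an_infinite[OF p, of w] w by (cases "1 < \<bar>w\<bar>") auto
    obtain e where e: "0 < e" "ball w e \<subseteq> U" using U w openE by blast
    \<comment> \<open>The interval estimate requires \<bar>w'\<bar> < 1, whereas w may be an
      endpoint, so w' is w moved towards 0 by at most e/2. As a convex combination of w and -w it
      keeps the bound c', by symmetry and quasiconvexity, and c' < c restores strictness.\<close>
    define d where "d = min (1/2) (e / 2)"
    have d: "0 < d" "d \<le> 1/2" "d \<le> e / 2" using e by (auto simp: d_def)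
    define w' where "w' = (1 - d) * w"
    have w'1: "\<bar>w'\<bar> < 1"
    proof -
      have "\<bar>w'\<bar> = (1 - d) * \<bar>w\<bar>" using d by (simp add: w'_def abs_mult)
      also have "\<dots> \<le> (1 - d) * 1" using w1 d by (intro mult_left_mono) auto
      finally show ?thesis using d by simp
    qed
    have "I_an p w' \<le> ereal c'"
    proof -
      have "convex {x. I_an p x \<le> ereal c'}" using I_an_quasiconvex[OF p] by (simp add: quasiconvex_def)
      moreover have "w \<in> {x. I_an p x \<le> ereal c'}" "- w \<in> {x. I_an p x \<le> ereal c'}"
        using c' I_an_symmetric[OF p, of w] by auto
      ultimately have "(1 - d / 2) *\<^sub>R w + (d / 2) *\<^sub>R (- w) \<in> {x. I_an p x \<le> ereal c'}"
        using d by (intro convexD) auto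
      moreover have "(1 - d / 2) *\<^sub>R w + (d / 2) *\<^sub>R (- w) = w'" by (simp add: w'_def algebra_simps)
      ultimately show ?thesis by simp
    qed
    then have Iw': "I_an p w' < ereal c" using c'(2) by (rule order_le_less_trans)
    have sub: "{w' - e / 2<..<w' + e / 2} \<subseteq> U"
    proof
      fix x assume x: "x \<in> {w' - e / 2<..<w' + e / 2}"
      have "\<bar>w' - w\<bar> = d * \<bar>w\<bar>" using d by (simp add: w'_def algebra_simps abs_mult)
      also have "\<dots> \<le> d * 1" using w1 d by (intro mult_left_mono) auto
      finally have "dist w x < e" using x d by (auto simp: dist_real_def)
      then show "x \<in> U" using e by auto
    qed
    have "eventually (\<lambda>n. ereal (- c) \<le> ?rate U n) sequentially"
      using ball_sphere_law_lower[OF p w'1 half_gt_zero[OF e(1)] Iw'] eventually_ge_at_top[of 1]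
    proof eventually_elim
      case (elim n)
      have "ennreal (exp (- (real n * c))) \<le> pr n {w' - e / 2<..<w' + e / 2}"
        using elim \<Theta>_unif[of n] by (simp add: pr_eq \<nu>_def)
      also have "\<dots> \<le> pr n U" using elim sub U by (intro pr_mono) auto
      finally show ?case using elim by (intro elog_rate_ge) auto
    qed
    then show "ereal (- c) \<le> liminf (?rate U)" by (rule Liminf_bounded)
  qed
  have middle: "liminf (?rate S) \<le> limsup (?rate T)" if "S \<subseteq> T" "T \<in> sets borel" for S T
  proof -
    have "liminf (?rate S) \<le> limsup (?rate S)" by (rule Liminf_le_Limsup) simp
    also have "\<dots> \<le> limsup (?rate T)"
    proof (rule Limsup_mono)
      show "eventually (\<lambda>n. ?rate S n \<le> ?rate T n) sequentially"
        using eventually_ge_at_top[of 1]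
      proof eventually_elim
        case (elim n)
        then show ?case using pr_mono[OF _ that] by (intro ereal_mult_left_mono elog_mono) auto
      qed
    qed
    finally show ?thesis .
  qed
  have "satisfies_LDP M W (\<lambda>n. real n) (I_an p)"
    unfolding satisfies_LDP_def
  proof (intro conjI allI impI ballI)
    fix \<Gamma> :: "real set"
    show "- (INF x\<in>interior \<Gamma>. I_an p x)
      \<le> liminf (\<lambda>n. ereal (1 / real n) * elog (emeasure (M n) {\<omega> \<in> space (M n). W n \<omega> \<in> interior \<Gamma>}))"
      using lower[OF open_interior] by (simp add: pr_def)
    show "liminf (\<lambda>n. ereal (1 / real n) * elog (emeasure (M n) {\<omega> \<in> space (M n). W n \<omega> \<in> interior \<Gamma>}))
      \<le> limsup (\<lambda>n. ereal (1 / real n) * elog (emeasure (M n) {\<omega> \<in> space (M n). W n \<omega> \<in> closure \<Gamma>}))"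
      using middle[OF order_trans[OF interior_subset closure_subset], of \<Gamma>] unfolding pr_def by simp
    show "limsup (\<lambda>n. ereal (1 / real n) * elog (emeasure (M n) {\<omega> \<in> space (M n). W n \<omega> \<in> closure \<Gamma>}))
      \<le> - (INF x\<in>closure \<Gamma>. I_an p x)"
      using upper[OF closed_closure] by (simp add: pr_def)
  qed (use M W_meas I_an_nonneg[OF p] I_an_lsc[OF p] in auto)
  then show ?thesis
    using I_an_quasiconvex[OF p] I_an_symmetric[OF p] I_an_good[OF p] by (simp add: symmetric_fun_def)
qed

end
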